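(* Let $\varepsilon>0$. For any entropy function $\phi$, $\mathrm{OT}_\varepsilon$ is convex on $\mathcal{M}_+(X)$ in $\alpha$ and in $\beta$ (each with the other fixed), but it is not jointly convex in $(\alpha,\beta)$. Moreover, assume that $\phi$ is continuous and satisfies the two following assumptions: (A1) $\phi^*$ is strictly convex; (A2) there exist a sequence $(x_n)_n\subset\mathrm{dom}(\phi^* )$ and $s_n\in\partial\phi^*(x_n)$ such that $s_n$ converges either to $0$ or to $+\infty$. If $(\alpha_n,\beta_n)\rightharpoonup(\alpha,\beta)\in\mathcal{M}_{++}(X)^2$, then $\mathrm{OT}_\varepsilon(\alpha_n,\beta_n)\to\mathrm{OT}_\varepsilon(\alpha,\beta)$.
   Context: $(X,d_X)$ is a compact metric space; $\mathcal{M}_+(X)$ is the set of positive (finite) Radon measures, $\mathcal{M}_{++}(X)=\mathcal{M}_+(X)\setminus\{0\}$. Weak* convergence $\alpha_n\rightharpoonup\alpha$ means $\int f\,d\alpha_n\to\int f\,d\alpha$ for all continuous $f$; $(\alpha_n,\beta_n)\rightharpoonup(\alpha,\beta)$ means $\alpha_n\rightharpoonup\alpha$ and $\beta_n\rightharpoonup\beta$. The cost $C:X^2\to\mathbb{R}$ is symmetric, continuous and $\gamma$-Lipschitz: $\|C(x,\cdot)-C(y,\cdot)\|_\infty\le\gamma d_X(x,y)$. An entropy function is a convex, lower semicontinuous $\phi\ge 0$ on $[0,\infty)$ (values in $[0,+\infty]$; the value at $0$ is the lower semicontinuous extension) with $\phi(1)=0$, extended by $+\infty$ on $(-\infty,0)$.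 $\phi^*(q)=\sup_{p\ge0}pq-\phi(p)$. Csiszár divergence: $D_\phi(\alpha|\beta)=\int\phi(\frac{d\alpha}{d\beta})d\beta+\phi'_\infty\int d\alpha^\perp$, where $\alpha=\frac{d\alpha}{d\beta}\beta+\alpha^\perp$ is the Lebesgue decomposition and $\phi'_\infty=\lim_{x\to\infty}\phi(x)/x$. $\mathrm{KL}(\mu|\nu)=\int\log(\frac{d\mu}{d\nu})d\mu-\int d\mu+\int d\nu$ ($+\infty$ if $\mu\not\ll\nu$). Entropic unbalanced optimal transport: $$\mathrm{OT}_\varepsilon(\alpha,\beta)=\inf_{\pi\in\mathcal{M}_+(X^2)}\int C\,d\pi+D_\phi(\pi_1|\alpha)+D_\phi(\pi_2|\beta)+\varepsilon\mathrm{KL}(\pi|\alpha\otimes\beta),$$ with $\pi_1,\pi_2$ the two marginals of $\pi$.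
   Formalization: The failure of joint convexity is claimed unless both φ = 0 on [0,∞) and C = 0; in that excluded case OT_ε is identically 0, hence jointly convex, so the claim as stated is false there. *)

theory Defs
  imports "HOL-Analysis.Analysis"
begin

class compact_metric_space = metric_space +
  assumes compact_UNIV: "compact (UNIV :: 'a set)"

instance compact_metric_space \<subseteq> complete_space
proof
  fix X :: "nat \<Rightarrow> 'a" assume "Cauchy X"
  moreover have "complete (UNIV :: 'a set)"
    using compact_UNIV by (rule compact_imp_complete)
  ultimately show "convergent X"
    unfolding complete_def convergent_def by auto
qed

text \<open>
  Second countability gives \<open>sets (borel \<Otimes>\<^sub>M borel) = sets borel\<close>, so that the library's product
  measure of two Borel measures is a Borel measure on the product space.
\<close>

instance compact_metric_space \<subseteq> second_countable_topology
proof
  have "\<exists>k. finite k \<and> (UNIV::'a set) \<subseteq> (\<Union>x\<in>k. ball x (1 / real (Suc n)))" for n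
    using compact_UNIV[where 'a='a] unfolding compact_eq_totally_bounded by auto
  then obtain k where k: "\<And>n. finite (k n)"
    "\<And>n. (UNIV::'a set) \<subseteq> (\<Union>x\<in>k n. ball x (1 / real (Suc n)))"
    by metis
  define B where "B = (\<Union>n. (\<lambda>x. ball x (1 / real (Suc n))) ` k n)"
  have "countable B"
    unfolding B_def using k(1) by (intro countable_UN countable_image) (auto intro: countable_finite)
  moreover have "topological_basis B"
  proof (rule topological_basisI)
    fix b assume "b \<in> B" then show "open b" by (auto simp: B_def)
  next
    fix S :: "'a set" and x assume S: "open S" "x \<in> S"
    then obtain e where e: "e > 0" "ball x e \<subseteq> S" by (auto simp: open_contains_ball)
    obtain n where n: "1 / real (Suc n) < e / 2"
      using reals_Archimedean[of "e / 2"] e(1) by (auto simp: field_simps)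
    obtain y where y: "y \<in> k n" "x \<in> ball y (1 / real (Suc n))" using k(2)[of n] by blast
    have "ball y (1 / real (Suc n)) \<subseteq> ball x e"
    proof
      fix z assume "z \<in> ball y (1 / real (Suc n))"
      then have "dist x z < 1 / real (Suc n) + 1 / real (Suc n)"
        using y(2) dist_triangle[of x z y] by (simp add: dist_commute)
      then show "z \<in> ball x e" using n by simp
    qed
    then show "\<exists>b\<in>B. x \<in> b \<and> b \<subseteq> S"
      using y e(2) by (intro bexI[of _ "ball y (1 / real (Suc n))"]) (auto simp: B_def)
  qed
  ultimately show "\<exists>B::'a set set. countable B \<and> open = generate_topology B"
    using topological_basis_imp_subbasis by blast
qed

instance compact_metric_space \<subseteq> polish_space ..

text \<open>
  On a Polish space every finite Borel measure is Radon (library theorem \<open>inner_regular\<close>), so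
  no regularity condition is imposed.
\<close>

definition pos_measures :: "'a::topological_space measure set" where
  "pos_measures = {\<mu>. sets \<mu> = sets borel \<and> finite_measure \<mu>}"

definition nonzero_measures :: "'a::topological_space measure set" where
  "nonzero_measures = pos_measures - {null_measure borel}"

definition weak_star_conv ::
    "(nat \<Rightarrow> 'a::topological_space measure) \<Rightarrow> 'a measure \<Rightarrow> bool" where
  "weak_star_conv \<mu>s \<mu> \<longleftrightarrow>
     (\<forall>f::'a \<Rightarrow> real. continuous_on UNIV f \<longrightarrow>
        (\<lambda>n. \<integral>x. f x \<partial>(\<mu>s n)) \<longlonglongrightarrow> (\<integral>x. f x \<partial>\<mu>))"

definition add_measure :: "'a measure \<Rightarrow> 'a measure \<Rightarrow> 'a measure" where
  "add_measure \<mu> \<nu> = measure_of (space \<mu>) (sets \<mu>) (\<lambda>A. emeasure \<mu> A + emeasure \<nu> A)"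

lemma space_add_measure [simp]: "space (add_measure \<mu> \<nu>) = space \<mu>"
  and sets_add_measure [simp, measurable_cong]: "sets (add_measure \<mu> \<nu>) = sets \<mu>"
  by (auto simp: add_measure_def)

lemma emeasure_add_measure:
  assumes "sets \<nu> = sets \<mu>" "A \<in> sets \<mu>"
  shows "emeasure (add_measure \<mu> \<nu>) A = emeasure \<mu> A + emeasure \<nu> A"
proof -
  have "countably_additive (sets \<mu>) (\<lambda>A. emeasure \<mu> A + emeasure \<nu> A)"
    unfolding countably_additive_def
  proof (intro allI impI)
    fix F :: "nat \<Rightarrow> 'a set"
    assume F: "range F \<subseteq> sets \<mu>" "disjoint_family F" "(\<Union>i. F i) \<in> sets \<mu>"
    have "(\<Sum>i. emeasure \<mu> (F i) + emeasure \<nu> (F i)) =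
        (\<Sum>i. emeasure \<mu> (F i)) + (\<Sum>i. emeasure \<nu> (F i))"
      by (rule suminf_add[symmetric]) auto
    also have "\<dots> = emeasure \<mu> (\<Union>i. F i) + emeasure \<nu> (\<Union>i. F i)"
      using F assms(1) by (simp add: suminf_emeasure)
    finally show "(\<Sum>i. emeasure \<mu> (F i) + emeasure \<nu> (F i)) =
        emeasure \<mu> (\<Union>i. F i) + emeasure \<nu> (\<Union>i. F i)" .
  qed
  then show ?thesis
    using assms unfolding add_measure_def
    by (intro emeasure_measure_of_sigma)
       (auto simp: positive_def sets.sigma_algebra_axioms)
qed

definition mix_measure :: "real \<Rightarrow> 'a measure \<Rightarrow> 'a measure \<Rightarrow> 'a measure" where
  "mix_measure t \<mu>0 \<mu>1 =
     add_measure (scale_measure (ennreal (1 - t)) \<mu>0) (scale_measure (ennreal t) \<mu>1)"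

definition convex_on_measures :: "('a::topological_space measure \<Rightarrow> ereal) \<Rightarrow> bool" where
  "convex_on_measures F \<longleftrightarrow>
     (\<forall>\<mu>0\<in>pos_measures. \<forall>\<mu>1\<in>pos_measures. \<forall>t\<in>{0..1}.
        F (mix_measure t \<mu>0 \<mu>1) \<le> ereal (1 - t) * F \<mu>0 + ereal t * F \<mu>1)"

definition jointly_convex_on_measures ::
    "('a::topological_space measure \<Rightarrow> 'b::topological_space measure \<Rightarrow> ereal) \<Rightarrow> bool" where
  "jointly_convex_on_measures F \<longleftrightarrow>
     (\<forall>\<alpha>0\<in>pos_measures. \<forall>\<alpha>1\<in>pos_measures. \<forall>\<beta>0\<in>pos_measures. \<forall>\<beta>1\<in>pos_measures. \<forall>t\<in>{0..1}.
        F (mix_measure t \<alpha>0 \<alpha>1) (mix_measure t \<beta>0 \<beta>1)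
          \<le> ereal (1 - t) * F \<alpha>0 \<beta>0 + ereal t * F \<alpha>1 \<beta>1)"

text \<open>
  Convexity together with \<open>\<phi> 1 = 0\<close> and lower semicontinuity on the whole line forces
  \<open>\<phi> 0\<close> to be the limit of \<open>\<phi>\<close> at \<open>0\<close> from the right.
\<close>

definition entropy_function :: "(real \<Rightarrow> ereal) \<Rightarrow> bool" where
  "entropy_function \<phi> \<longleftrightarrow>
     (\<forall>x<0. \<phi> x = \<infinity>) \<and> (\<forall>x. 0 \<le> \<phi> x) \<and> \<phi> 1 = 0 \<and>
     (\<forall>x y. \<forall>t\<in>{0..1}. \<phi> ((1 - t) * x + t * y) \<le> ereal (1 - t) * \<phi> x + ereal t * \<phi> y) \<and>
     (\<forall>x. \<phi> x \<le> Liminf (at x) \<phi>)"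

definition recession :: "(real \<Rightarrow> ereal) \<Rightarrow> ereal" where
  "recession \<phi> = Lim at_top (\<lambda>x. \<phi> x / ereal x)"

definition legendre :: "(real \<Rightarrow> ereal) \<Rightarrow> real \<Rightarrow> ereal" where
  "legendre \<phi> q = (SUP p\<in>{0..}. ereal (p * q) - \<phi> p)"

definition eff_dom :: "(real \<Rightarrow> ereal) \<Rightarrow> real set" where
  "eff_dom \<psi> = {x. \<psi> x < \<infinity>}"

definition subdifferential :: "(real \<Rightarrow> ereal) \<Rightarrow> real \<Rightarrow> real set" where
  "subdifferential \<psi> x = {s. \<forall>y. \<psi> x + ereal (s * (y - x)) \<le> \<psi> y}"

definition strictly_convex :: "(real \<Rightarrow> ereal) \<Rightarrow> bool" where
  "strictly_convex \<psi> \<longleftrightarrow>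
     (\<forall>x\<in>eff_dom \<psi>. \<forall>y\<in>eff_dom \<psi>. \<forall>t\<in>{0<..<1}. x \<noteq> y \<longrightarrow>
        \<psi> ((1 - t) * x + t * y) < ereal (1 - t) * \<psi> x + ereal t * \<psi> y)"

definition subgradients_reach_zero_or_infinity :: "(real \<Rightarrow> ereal) \<Rightarrow> bool" where
  "subgradients_reach_zero_or_infinity \<psi> \<longleftrightarrow>
     (\<exists>x s :: nat \<Rightarrow> real. (\<forall>n. x n \<in> eff_dom \<psi> \<and> s n \<in> subdifferential \<psi> (x n)) \<and>
        (s \<longlonglongrightarrow> 0 \<or> filterlim s at_top sequentially))"

definition singular_measures :: "'a measure \<Rightarrow> 'a measure \<Rightarrow> bool" where
  "singular_measures \<nu> \<beta> \<longleftrightarrow> (\<exists>N\<in>null_sets \<beta>. emeasure \<nu> (space \<nu> - N) = 0)"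

definition lebesgue_decomposition ::
    "'a::topological_space measure \<Rightarrow> 'a measure \<Rightarrow> ('a \<Rightarrow> real) \<Rightarrow> 'a measure \<Rightarrow> bool" where
  "lebesgue_decomposition \<alpha> \<beta> f \<nu> \<longleftrightarrow>
     f \<in> borel_measurable borel \<and> (\<forall>x. 0 \<le> f x) \<and> \<nu> \<in> pos_measures \<and>
     singular_measures \<nu> \<beta> \<and> \<alpha> = add_measure (density \<beta> (\<lambda>x. ennreal (f x))) \<nu>"

definition csiszar_of ::
    "(real \<Rightarrow> ereal) \<Rightarrow> 'a measure \<Rightarrow> ('a \<Rightarrow> real) \<Rightarrow> 'a measure \<Rightarrow> ereal" where
  "csiszar_of \<phi> \<beta> f \<nu> =
     enn2ereal (\<integral>\<^sup>+x. e2ennreal (\<phi> (f x)) \<partial>\<beta>) + recession \<phi> * ereal (measure \<nu> (space \<nu>))"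

text \<open>
  The description below is well defined: a decomposition exists and its value does not depend on
  the choice (\<open>lebesgue_decomposition_exists\<close>, \<open>csiszar_eq\<close>).  The
  convention \<open>\<infinity> * 0 = 0\<close> of extended reals applies to the singular term.
\<close>

definition csiszar ::
    "(real \<Rightarrow> ereal) \<Rightarrow> 'a::topological_space measure \<Rightarrow> 'a measure \<Rightarrow> ereal" where
  "csiszar \<phi> \<alpha> \<beta> = (THE d. \<exists>f \<nu>. lebesgue_decomposition \<alpha> \<beta> f \<nu> \<and> d = csiszar_of \<phi> \<beta> f \<nu>)"

lemma lebesgue_decomposition_exists:
  fixes \<alpha> \<beta> :: "'a::topological_space measure"
  assumes "\<alpha> \<in> pos_measures" "\<beta> \<in> pos_measures"
  shows "\<exists>f \<nu>. lebesgue_decomposition \<alpha> \<beta> f \<nu>"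
proof -
  have sets [measurable_cong]: "sets \<alpha> = sets borel" "sets \<beta> = sets borel"
    using assms by (auto simp: pos_measures_def)
  have sp: "space \<alpha> = UNIV" "space \<beta> = UNIV"
    using sets by (auto dest: sets_eq_imp_space_eq)
  interpret a: finite_measure \<alpha> using assms by (simp add: pos_measures_def)
  interpret b: finite_measure \<beta> using assms by (simp add: pos_measures_def)
  define \<mu> where "\<mu> = add_measure \<alpha> \<beta>"
  have s\<mu> [measurable_cong]: "sets \<mu> = sets borel" by (simp add: \<mu>_def sets)
  have e\<mu>: "emeasure \<mu> A = emeasure \<alpha> A + emeasure \<beta> A" if "A \<in> sets borel" for A
    unfolding \<mu>_def using that sets by (intro emeasure_add_measure) auto
  have "emeasure \<mu> (space \<mu>) \<noteq> \<infinity>"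
    by (subst e\<mu>) (auto simp: \<mu>_def sp)
  then interpret m: finite_measure \<mu> by (rule finite_measureI)
  have "absolutely_continuous \<mu> \<beta>"
    by (auto simp: absolutely_continuous_def null_sets_def s\<mu> sets e\<mu>)
  then obtain g where g [measurable]: "g \<in> borel_measurable \<mu>" and dg: "density \<mu> g = \<beta>"
    using m.Radon_Nikodym[of \<beta>] sets s\<mu> by auto
  define N where "N = {x. g x = 0}"
  have "{x \<in> space \<mu>. g x = 0} \<in> sets \<mu>" by measurable
  then have N [measurable]: "N \<in> sets borel" by (simp add: N_def s\<mu> \<mu>_def sp)
  have "emeasure \<beta> N = (\<integral>\<^sup>+x. g x * indicator N x \<partial>\<mu>)"
    unfolding dg[symmetric] by (rule emeasure_density) (auto simp: s\<mu>)
  also have "\<dots> = (\<integral>\<^sup>+x. 0 \<partial>\<mu>)"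
    by (intro nn_integral_cong) (auto simp: N_def indicator_def)
  finally have bN: "N \<in> null_sets \<beta>" by (auto simp: sets)
  define \<nu> where "\<nu> = density \<alpha> (indicator N)"
  define \<alpha>1 where "\<alpha>1 = density \<alpha> (indicator (- N))"
  have e\<nu>: "emeasure \<nu> A = emeasure \<alpha> (A \<inter> N)" if "A \<in> sets borel" for A
  proof -
    have "emeasure \<nu> A = (\<integral>\<^sup>+x. indicator N x * indicator A x \<partial>\<alpha>)"
      unfolding \<nu>_def using that by (intro emeasure_density) (auto simp: sets)
    also have "\<dots> = (\<integral>\<^sup>+x. indicator (A \<inter> N) x \<partial>\<alpha>)"
      by (intro nn_integral_cong) (auto split: split_indicator)
    finally show ?thesis using that by (simp add: sets)
  qed
  have e1: "emeasure \<alpha>1 A = emeasure \<alpha> (A - N)" if "A \<in> sets borel" for A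
  proof -
    have "emeasure \<alpha>1 A = (\<integral>\<^sup>+x. indicator (- N) x * indicator A x \<partial>\<alpha>)"
      unfolding \<alpha>1_def using that by (intro emeasure_density) (auto simp: sets)
    also have "\<dots> = (\<integral>\<^sup>+x. indicator (A - N) x \<partial>\<alpha>)"
      by (intro nn_integral_cong) (auto split: split_indicator)
    finally show ?thesis using that by (simp add: sets)
  qed
  have s1: "sets \<nu> = sets borel" "sets \<alpha>1 = sets borel" by (auto simp: \<nu>_def \<alpha>1_def sets)
  have f1: "finite_measure \<nu>" "finite_measure \<alpha>1"
    by (auto intro!: finite_measureI simp: e\<nu> e1 sets_eq_imp_space_eq[OF s1(1)] sets_eq_imp_space_eq[OF s1(2)])
  interpret a1: finite_measure \<alpha>1 by (rule f1)
  have "absolutely_continuous \<beta> \<alpha>1"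
    unfolding absolutely_continuous_def
  proof
    fix A assume "A \<in> null_sets \<beta>"
    then have A [measurable]: "A \<in> sets borel" and A0: "emeasure \<beta> A = 0" by (auto simp: sets)
    have "(\<integral>\<^sup>+x. g x * indicator A x \<partial>\<mu>) = 0"
      using A0 unfolding dg[symmetric] by (subst (asm) emeasure_density) (auto simp: s\<mu>)
    then have "AE x in \<mu>. g x * indicator A x = 0"
      by (subst (asm) nn_integral_0_iff_AE) auto
    then have "AE x in \<mu>. x \<notin> A - N" by eventually_elim (auto simp: N_def indicator_def)
    then have "emeasure \<mu> (A - N) = 0"
      by (subst (asm) AE_iff_measurable[of "A - N"]) (auto simp: s\<mu> \<mu>_def sp)
    then have "emeasure \<alpha> (A - N) = 0" by (simp add: e\<mu>)
    then show "A \<in> null_sets \<alpha>1" using A by (auto simp: s1 e1)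
  qed
  moreover have "sets \<alpha>1 = sets \<beta>" by (simp add: s1 sets)
  ultimately have dh: "density \<beta> (RN_deriv \<beta> \<alpha>1) = \<alpha>1"
    and fin: "AE x in \<beta>. RN_deriv \<beta> \<alpha>1 x \<noteq> \<infinity>"
    using b.density_RN_deriv b.RN_deriv_finite[of \<alpha>1] a1.sigma_finite_measure_axioms by auto
  define f where "f = (\<lambda>x. enn2real (RN_deriv \<beta> \<alpha>1 x))"
  have f [measurable]: "f \<in> borel_measurable borel"
    unfolding f_def using borel_measurable_RN_deriv[of \<beta> \<alpha>1] by measurable
  have "density \<beta> (\<lambda>x. ennreal (f x)) = density \<beta> (RN_deriv \<beta> \<alpha>1)"
    using fin by (intro density_cong) (auto simp: f_def less_top)
  then have df: "density \<beta> (\<lambda>x. ennreal (f x)) = \<alpha>1" using dh by simp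
  have "\<alpha> = add_measure \<alpha>1 \<nu>"
  proof (rule measure_eqI)
    fix A assume "A \<in> sets \<alpha>"
    then have A: "A \<in> sets borel" by (simp add: sets)
    have "emeasure \<alpha> A = emeasure \<alpha> (A - N) + emeasure \<alpha> (A \<inter> N)"
      using A by (subst plus_emeasure) (auto simp: sets intro!: arg_cong[where f="emeasure \<alpha>"])
    then show "emeasure \<alpha> A = emeasure (add_measure \<alpha>1 \<nu>) A"
      using A by (simp add: emeasure_add_measure s1 e1 e\<nu>)
  qed (simp add: s1 sets)
  moreover have "singular_measures \<nu> \<beta>"
    unfolding singular_measures_def using bN N
    by (intro bexI[of _ N]) (auto simp: e\<nu> sets_eq_imp_space_eq[OF s1(1)] Int_commute)
  ultimately have "lebesgue_decomposition \<alpha> \<beta> f \<nu>"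
    unfolding lebesgue_decomposition_def using f s1 f1 df
    by (auto simp: pos_measures_def f_def)
  then show ?thesis by blast
qed

lemma lebesgue_decomposition_unique:
  fixes \<alpha> \<beta> :: "'a::topological_space measure"
  assumes \<beta>: "\<beta> \<in> pos_measures"
    and d1: "lebesgue_decomposition \<alpha> \<beta> f \<nu>" and d2: "lebesgue_decomposition \<alpha> \<beta> f' \<nu>'"
  shows "AE x in \<beta>. f x = f' x" and "\<nu> = \<nu>'"
proof -
  have s\<beta> [measurable_cong]: "sets \<beta> = sets borel" using \<beta> by (simp add: pos_measures_def)
  interpret b: finite_measure \<beta> using \<beta> by (simp add: pos_measures_def)
  obtain N N' where N: "N \<in> null_sets \<beta>" "emeasure \<nu> (space \<nu> - N) = 0"
    and N': "N' \<in> null_sets \<beta>" "emeasure \<nu>' (space \<nu>' - N') = 0"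
    using d1 d2 by (auto simp: lebesgue_decomposition_def singular_measures_def)
  define Z where "Z = N \<union> N'"
  have Z: "Z \<in> null_sets \<beta>" using N N' by (auto simp: Z_def)
  then have Zs [measurable]: "Z \<in> sets borel" by (auto simp: s\<beta>)
  have *: "emeasure \<tau> A = emeasure \<alpha> (A \<inter> Z) \<and>
      emeasure (density \<beta> (\<lambda>x. ennreal (h x))) A = emeasure \<alpha> (A - Z)"
    if d: "lebesgue_decomposition \<alpha> \<beta> h \<tau>" and M: "M \<in> null_sets \<beta>"
      "emeasure \<tau> (space \<tau> - M) = 0" "M \<subseteq> Z" and A: "A \<in> sets borel" for h \<tau> M A
  proof -
    let ?D = "density \<beta> (\<lambda>x. ennreal (h x))"
    have st: "sets \<tau> = sets borel" and h [measurable]: "h \<in> borel_measurable borel"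
      and eq: "\<alpha> = add_measure ?D \<tau>"
      using d by (auto simp: lebesgue_decomposition_def pos_measures_def)
    have ea: "emeasure \<alpha> B = emeasure ?D B + emeasure \<tau> B" if "B \<in> sets borel" for B
      unfolding eq using that st s\<beta> by (intro emeasure_add_measure) auto
    have D0: "emeasure ?D B = 0" if "B \<subseteq> Z" "B \<in> sets borel" for B
    proof -
      have "B \<in> null_sets \<beta>" using Z that s\<beta> by (auto intro: null_sets_subset)
      moreover have "absolutely_continuous \<beta> ?D"
        by (rule absolutely_continuousI_density) measurable
      ultimately show ?thesis by (auto simp: absolutely_continuous_def)
    qed
    have T0: "emeasure \<tau> (A - Z) = 0"
    proof -
      have "A - Z \<subseteq> space \<tau> - M" using M(3) sets_eq_imp_space_eq[OF st] by auto
      moreover have "space \<tau> - M \<in> sets \<tau>" using M(1) st s\<beta> by auto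
      ultimately have "emeasure \<tau> (A - Z) \<le> emeasure \<tau> (space \<tau> - M)" by (rule emeasure_mono)
      then show ?thesis using M(2) by simp
    qed
    have "emeasure \<tau> A = emeasure \<tau> (A - Z) + emeasure \<tau> (A \<inter> Z)"
      using A st by (subst plus_emeasure) (auto intro!: arg_cong[where f="emeasure \<tau>"])
    moreover have "emeasure ?D A = emeasure ?D (A - Z) + emeasure ?D (A \<inter> Z)"
      using A s\<beta> by (subst plus_emeasure) (auto intro!: arg_cong[where f="emeasure ?D"])
    ultimately show ?thesis
      using A ea[of "A - Z"] ea[of "A \<inter> Z"] D0[of "A \<inter> Z"] T0 by simp
  qed
  note eq1 = *[OF d1 N] and eq2 = *[OF d2 N']
  have Zsub: "N \<subseteq> Z" "N' \<subseteq> Z" by (auto simp: Z_def)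
  have f: "f \<in> borel_measurable borel" "f' \<in> borel_measurable borel"
    and nn: "\<And>x. 0 \<le> f x" "\<And>x. 0 \<le> f' x"
    and s: "sets \<nu> = sets borel" "sets \<nu>' = sets borel"
    using d1 d2 by (auto simp: lebesgue_decomposition_def pos_measures_def)
  show "\<nu> = \<nu>'"
    using eq1 eq2 Zsub s by (intro measure_eqI) auto
  have "density \<beta> (\<lambda>x. ennreal (f x)) = density \<beta> (\<lambda>x. ennreal (f' x))"
    using eq1 eq2 Zsub s\<beta> by (intro measure_eqI) auto
  then have "AE x in \<beta>. ennreal (f x) = ennreal (f' x)"
    using f by (subst (asm) b.density_unique_iff) (auto simp: s\<beta>)
  then show "AE x in \<beta>. f x = f' x" using nn by simp
qed

lemma csiszar_eq:
  fixes \<alpha> \<beta> :: "'a::topological_space measure"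
  assumes "\<beta> \<in> pos_measures" "lebesgue_decomposition \<alpha> \<beta> f \<nu>"
  shows "csiszar \<phi> \<alpha> \<beta> = csiszar_of \<phi> \<beta> f \<nu>"
  unfolding csiszar_def
proof (rule the_equality)
  show "\<exists>f' \<nu>'. lebesgue_decomposition \<alpha> \<beta> f' \<nu>' \<and> csiszar_of \<phi> \<beta> f \<nu> = csiszar_of \<phi> \<beta> f' \<nu>'"
    using assms(2) by blast
next
  fix d assume "\<exists>f' \<nu>'. lebesgue_decomposition \<alpha> \<beta> f' \<nu>' \<and> d = csiszar_of \<phi> \<beta> f' \<nu>'"
  then obtain f' \<nu>' where "lebesgue_decomposition \<alpha> \<beta> f' \<nu>'" and d: "d = csiszar_of \<phi> \<beta> f' \<nu>'"
    by blast
  note u = lebesgue_decomposition_unique[OF assms this(1)]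
  have "(\<integral>\<^sup>+x. e2ennreal (\<phi> (f x)) \<partial>\<beta>) = (\<integral>\<^sup>+x. e2ennreal (\<phi> (f' x)) \<partial>\<beta>)"
    using u(1) by (intro nn_integral_cong_AE) auto
  then show "d = csiszar_of \<phi> \<beta> f \<nu>" using u(2) d by (simp add: csiszar_of_def)
qed

text \<open>
  The integral \<open>\<integral> ln (d\<mu>/d\<nu>) d\<mu>\<close> may be \<open>+\<infinity>\<close>, whereas the Bochner integral of a non-integrable
  function is \<open>0\<close>.  Its negative part is finite for finite measures.
\<close>

definition extended_integral :: "'a measure \<Rightarrow> ('a \<Rightarrow> real) \<Rightarrow> ereal" where
  "extended_integral \<mu> g =
     enn2ereal (\<integral>\<^sup>+x. ennreal (g x) \<partial>\<mu>) - enn2ereal (\<integral>\<^sup>+x. ennreal (- g x) \<partial>\<mu>)"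

definition KL :: "'a measure \<Rightarrow> 'a measure \<Rightarrow> ereal" where
  "KL \<mu> \<nu> =
     (if absolutely_continuous \<nu> \<mu>
      then extended_integral \<mu> (\<lambda>x. ln (enn2real (RN_deriv \<nu> \<mu> x)))
             - ereal (measure \<mu> (space \<mu>)) + ereal (measure \<nu> (space \<nu>))
      else \<infinity>)"

definition OT ::
    "('a::topological_space \<Rightarrow> 'a \<Rightarrow> real) \<Rightarrow> (real \<Rightarrow> ereal) \<Rightarrow> real \<Rightarrow>
     'a measure \<Rightarrow> 'a measure \<Rightarrow> ereal" where
  "OT C \<phi> \<epsilon> \<alpha> \<beta> =
     (INF \<pi>\<in>pos_measures.
        ereal (\<integral>z. C (fst z) (snd z) \<partial>\<pi>)
        + csiszar \<phi> (distr \<pi> borel fst) \<alpha> + csiszar \<phi> (distr \<pi> borel snd) \<beta>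
        + ereal \<epsilon> * KL \<pi> (\<alpha> \<Otimes>\<^sub>M \<beta>))"

end

theory Submission
  imports Defs
begin

text \<open>
  A plan of finite cost has a density \<open>r\<close> with respect to \<open>\<alpha> \<otimes> \<beta>\<close>, so no singular part ever enters
  the divergences, and every term of the objective is jointly convex in the plan and in
  either of \<open>\<alpha>\<close>, \<open>\<beta>\<close>; taking the infimum over plans gives convexity in each argument.

  On Dirac masses the problem is scalar.  A jointly convex \<open>OT\<close> would be linear along the boundary
  \<open>\<beta> = 0\<close>, so its one-sided derivative there would have to be constant in \<open>\<alpha>\<close>; this forces
  \<open>\<phi> = 0\<close> and \<open>C = 0\<close>.

  For continuity, the Sinkhorn map is order preserving, and the assumption on subgradients yields
  constant sub- and supersolutions.  Monotone iteration therefore converges to continuous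
  potentials \<open>f\<close>, \<open>g\<close> satisfying the optimality conditions at every point of the space, not only
  on the supports.  With these fixed, the dual value of \<open>(f, g)\<close> bounds \<open>OT(\<alpha>', \<beta>')\<close> from
  below for all \<open>(\<alpha>', \<beta>')\<close>, and the plan \<open>exp ((f + g - C) / \<epsilon>) (\<alpha>' \<otimes> \<beta>')\<close> bounds it
  from above near \<open>(\<alpha>, \<beta>)\<close>.  Both bounds are weak* continuous and agree at \<open>(\<alpha>, \<beta>)\<close>.
\<close>

section \<open>Mixtures and densities\<close>

text \<open>Since \<alpha> \<otimes> \<beta> is linear in each factor but not in the pair, mixing is
  harmless in one argument and fails in both. Almost every estimate of the entropy is one
  inequality, \<open>kl_Young\<close>, used with a chosen slope: convexity, coercivity, weak
  duality, blow-up for vanishing mass. Potentials are wanted at every point because \<alpha>_n and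
  \<beta>_n may charge points away from the supports of their limits. Keeping the potentials of the
  limit pair along the whole sequence avoids any stability question for optimisers. The price is
  that the marginal densities of the Gibbs plan move with n and must stay where \<phi> is finite;
  this follows from the continuity of \<phi> into the extended reals, since the limit densities have
  compact range in the domain. The subgradient assumption acts through the domain of \<phi> alone:
  it is unbounded, or it accumulates at 0. Either alternative lets one side of the Sinkhorn map
  dominate the other for large constants.\<close>

lemma pos_measuresD:
  assumes "\<mu> \<in> pos_measures"
  shows "sets \<mu> = sets borel" "space \<mu> = UNIV" "finite_measure \<mu>" "sigma_finite_measure \<mu>"
  using assms sets_eq_imp_space_eq[of \<mu> borel]
  by (auto simp: pos_measures_def finite_measure.axioms)

lemma emeasure_mix_measure:
  assumes "sets \<mu>1 = sets \<mu>0" "A \<in> sets \<mu>0"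
  shows "emeasure (mix_measure t \<mu>0 \<mu>1) A = ennreal (1 - t) * emeasure \<mu>0 A + ennreal t * emeasure \<mu>1 A"
  using assms unfolding mix_measure_def by (subst emeasure_add_measure) auto

lemma sets_mix_measure [simp, measurable_cong]: "sets (mix_measure t \<mu>0 \<mu>1) = sets \<mu>0"
  and space_mix_measure [simp]: "space (mix_measure t \<mu>0 \<mu>1) = space \<mu>0"
  by (simp_all add: mix_measure_def space_scale_measure)

lemma nn_integral_mix_measure:
  assumes f: "f \<in> borel_measurable \<mu>0" and s: "sets \<mu>1 = sets \<mu>0"
  shows "(\<integral>\<^sup>+x. f x \<partial>mix_measure t \<mu>0 \<mu>1) =
    ennreal (1 - t) * (\<integral>\<^sup>+x. f x \<partial>\<mu>0) + ennreal t * (\<integral>\<^sup>+x. f x \<partial>\<mu>1)"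
  using f
proof (induction rule: borel_measurable_induct)
  case (cong f g)
  have "(\<integral>\<^sup>+x. f x \<partial>M) = (\<integral>\<^sup>+x. g x \<partial>M)" if "space M = space \<mu>0" for M
    using cong(3) that by (intro nn_integral_cong) auto
  then show ?case using cong(4) s sets_eq_imp_space_eq[OF s] by simp
next
  case (set A)
  then show ?case using s by (simp add: emeasure_mix_measure)
next
  case (mult u c)
  then show ?case using s measurable_cong_sets[OF s]
    by (simp add: nn_integral_cmult distrib_left mult.left_commute cong: measurable_cong_sets)
next
  case (add u v)
  then show ?case using s measurable_cong_sets[OF s]
    by (simp add: nn_integral_add distrib_left ac_simps cong: measurable_cong_sets)
next
  case (seq U)
  have U: "\<And>i. U i \<in> borel_measurable \<mu>1" "\<And>i. U i \<in> borel_measurable (mix_measure t \<mu>0 \<mu>1)"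
    using seq(1) by (auto cong: measurable_cong_sets simp: s)
  have "(\<integral>\<^sup>+x. (SUP i. U i) x \<partial>M) = (SUP i. \<integral>\<^sup>+x. U i x \<partial>M)" if "\<And>i. U i \<in> borel_measurable M" for M
    using nn_integral_monotone_convergence_SUP[of U M] seq(3) that by (simp add: image_comp)
  then have eq: "(\<integral>\<^sup>+x. (SUP i. U i) x \<partial>M) = (SUP i. \<integral>\<^sup>+x. U i x \<partial>M)"
    if "M \<in> {\<mu>0, \<mu>1, mix_measure t \<mu>0 \<mu>1}" for M using that U seq(1) by auto
  have inc: "incseq (\<lambda>i. \<integral>\<^sup>+x. U i x \<partial>M)" for M
    using seq(3) by (auto simp: mono_def le_fun_def intro!: nn_integral_mono)
  have inc2: "incseq (\<lambda>i. ennreal c * (\<integral>\<^sup>+x. U i x \<partial>M))" for M c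
    using inc[of M] by (auto simp: mono_def intro!: mult_left_mono)
  have "(\<integral>\<^sup>+x. (SUP i. U i) x \<partial>mix_measure t \<mu>0 \<mu>1) =
      (SUP i. ennreal (1 - t) * (\<integral>\<^sup>+x. U i x \<partial>\<mu>0) + ennreal t * (\<integral>\<^sup>+x. U i x \<partial>\<mu>1))"
    using eq[of "mix_measure t \<mu>0 \<mu>1"] seq.IH by (simp del: Sup_apply SUP_apply)
  also have "\<dots> = ennreal (1 - t) * (SUP i. \<integral>\<^sup>+x. U i x \<partial>\<mu>0) + ennreal t * (SUP i. \<integral>\<^sup>+x. U i x \<partial>\<mu>1)"
    using ennreal_SUP_add[OF inc2 inc2, of "1 - t" \<mu>0 t \<mu>1] by (simp add: SUP_mult_left_ennreal)
  also have "\<dots> = ennreal (1 - t) * (\<integral>\<^sup>+x. (SUP i. U i) x \<partial>\<mu>0) + ennreal t * (\<integral>\<^sup>+x. (SUP i. U i) x \<partial>\<mu>1)"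
    using eq[of \<mu>0] eq[of \<mu>1] by (simp del: Sup_apply SUP_apply)
  finally show ?case using seq(4) by simp
qed

lemma mix_measure_in_pos_measures:
  assumes "\<mu>0 \<in> pos_measures" "\<mu>1 \<in> pos_measures"
  shows "mix_measure t \<mu>0 \<mu>1 \<in> pos_measures"
proof -
  note a = pos_measuresD[OF assms(1)] and b = pos_measuresD[OF assms(2)]
  interpret a: finite_measure \<mu>0 by (rule a)
  interpret b: finite_measure \<mu>1 by (rule b)
  show ?thesis using a b a.emeasure_finite b.emeasure_finite
    by (auto simp: pos_measures_def emeasure_mix_measure ennreal_mult_eq_top_iff intro!: finite_measureI)
qed

lemma distr_mix_measure:
  assumes "sets \<mu>1 = sets \<mu>0" "T \<in> measurable \<mu>0 N"
  shows "distr (mix_measure t \<mu>0 \<mu>1) N T = mix_measure t (distr \<mu>0 N T) (distr \<mu>1 N T)"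
proof (rule measure_eqI)
  fix A assume "A \<in> sets (distr (mix_measure t \<mu>0 \<mu>1) N T)"
  then have A: "A \<in> sets N" by simp
  have T: "T \<in> measurable \<mu>1 N" "T \<in> measurable (mix_measure t \<mu>0 \<mu>1) N"
    using assms by (auto cong: measurable_cong_sets)
  show "emeasure (distr (mix_measure t \<mu>0 \<mu>1) N T) A = emeasure (mix_measure t (distr \<mu>0 N T) (distr \<mu>1 N T)) A"
    using A T assms measurable_sets[OF assms(2) A]
    by (simp add: emeasure_distr emeasure_mix_measure sets_eq_imp_space_eq[OF assms(1)])
qed simp

lemma mix_measure_0: "sets \<mu>1 = sets \<mu>0 \<Longrightarrow> mix_measure 0 \<mu>0 \<mu>1 = \<mu>0"
  and mix_measure_1: "sets \<mu>1 = sets \<mu>0 \<Longrightarrow> mix_measure 1 \<mu>0 \<mu>1 = \<mu>1"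
  by (rule measure_eqI; simp add: emeasure_mix_measure)+

lemma mix_measure_same:
  assumes "t \<in> {0..1}" shows "mix_measure t \<mu> \<mu> = \<mu>"
proof (rule measure_eqI)
  fix A assume "A \<in> sets (mix_measure t \<mu> \<mu>)"
  moreover have "ennreal (1 - t) + ennreal t = 1" using assms by (simp add: ennreal_plus[symmetric] del: ennreal_plus)
  ultimately show "emeasure (mix_measure t \<mu> \<mu>) A = emeasure \<mu> A"
    by (simp add: emeasure_mix_measure distrib_right[symmetric])
qed simp

lemma density_in_pos_measures:
  fixes \<nu> :: "'a::topological_space measure"
  assumes "\<nu> \<in> pos_measures" "r \<in> borel_measurable borel" "integrable \<nu> r"
  shows "density \<nu> (\<lambda>x. ennreal (r x)) \<in> pos_measures"
proof -
  note n = pos_measuresD[OF assms(1)]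
  have "(\<integral>\<^sup>+x. ennreal (r x) \<partial>\<nu>) < \<infinity>"
    using integrableD(2)[OF assms(3)] by (simp add: less_top)
  then show ?thesis using n assms(2)
    by (auto simp: pos_measures_def emeasure_density measurable_cong_sets[OF n(1) refl] intro!: finite_measureI)
qed

text \<open>The Radon-Nikodym derivative takes extended values. It is finite almost everywhere
  because \<mu> is finite, so a real representative exists, as \<open>\<phi>\<close> and
  \<open>kl\<close> require.\<close>

lemma density_of_absolutely_continuous:
  fixes \<nu> :: "'a::topological_space measure"
  assumes m: "\<mu> \<in> pos_measures" and n: "\<nu> \<in> pos_measures" and ac: "absolutely_continuous \<nu> \<mu>"
  obtains r :: "'a \<Rightarrow> real" where "r \<in> borel_measurable borel" "\<And>x. 0 \<le> r x"
    "integrable \<nu> r" "\<mu> = density \<nu> (\<lambda>x. ennreal (r x))"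
proof -
  note m = pos_measuresD[OF m] and n = pos_measuresD[OF n]
  interpret m: finite_measure \<mu> by (rule m)
  interpret n: finite_measure \<nu> by (rule n)
  have s: "sets \<mu> = sets \<nu>" using m n by simp
  let ?R = "RN_deriv \<nu> \<mu>"
  have fin: "AE x in \<nu>. ?R x \<noteq> \<infinity>"
    using n.RN_deriv_finite[OF _ ac s] m.sigma_finite_measure_axioms by auto
  define r where "r x = enn2real (?R x)" for x
  have rb: "r \<in> borel_measurable \<nu>" unfolding r_def by measurable
  have d: "\<mu> = density \<nu> (\<lambda>x. ennreal (r x))"
    using fin rb
    by (subst n.density_RN_deriv[OF ac s, symmetric], intro density_cong) (auto simp: r_def less_top)
  have "(\<integral>\<^sup>+x. ennreal (r x) \<partial>\<nu>) = emeasure \<mu> (space \<mu>)"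
    unfolding d using rb by (simp add: emeasure_density cong: nn_integral_cong)
  then have "integrable \<nu> r" using rb m.emeasure_finite[of "space \<mu>"]
    by (intro integrableI_nonneg) (auto simp: r_def less_top[symmetric])
  moreover have "r \<in> borel_measurable borel" using rb n by (simp cong: measurable_cong_sets)
  ultimately show ?thesis using d by (intro that[of r]) (simp_all add: r_def)
qed

text \<open>The singular part is the null measure, so \<open>recession \<phi>\<close> is multiplied
  by 0, which gives 0 even for an infinite recession constant.\<close>

lemma csiszar_density:
  fixes \<nu> :: "'a::topological_space measure"
  assumes n: "\<nu> \<in> pos_measures" and r: "r \<in> borel_measurable borel" "\<And>x. 0 \<le> r x"
  shows "csiszar \<phi> (density \<nu> (\<lambda>x. ennreal (r x))) \<nu> = enn2ereal (\<integral>\<^sup>+x. e2ennreal (\<phi> (r x)) \<partial>\<nu>)"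
proof -
  note n' = pos_measuresD[OF n]
  have "add_measure (density \<nu> (\<lambda>x. ennreal (r x))) (null_measure borel) = density \<nu> (\<lambda>x. ennreal (r x))"
    using n' by (intro measure_eqI) (auto simp: emeasure_add_measure)
  moreover have "finite_measure (null_measure borel)" by (auto intro!: finite_measureI)
  ultimately have "lebesgue_decomposition (density \<nu> (\<lambda>x. ennreal (r x))) \<nu> r (null_measure borel)"
    using r by (auto simp: lebesgue_decomposition_def pos_measures_def singular_measures_def)
  from csiszar_eq[OF n this] show ?thesis by (simp add: csiszar_of_def measure_def zero_ereal_def[symmetric])
qed

section \<open>The entropy integrand and the Kullback-Leibler divergence\<close>

text \<open>The terms - r + 1 are the mass terms of \<open>KL\<close> brought under the integral;
  they make the integrand nonnegative. At r = 0 the product vanishes, giving the limit value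
  1.\<close>

definition kl :: "real \<Rightarrow> real" where
  "kl r = r * ln r - r + 1"

text \<open>Fenchel-Young: exp u - 1 is the conjugate of \<open>kl\<close>, with equality at u = ln
  r. It is 1 + x \<le> exp x at x = u - ln r.\<close>

lemma kl_Young:
  assumes "0 \<le> r"
  shows "r * u + 1 - exp u \<le> kl r"
proof (cases "r = 0")
  case False
  then have r: "r > 0" using assms by simp
  have "1 + (u - ln r) \<le> exp (u - ln r)" by (rule exp_ge_add_one_self)
  also have "exp (u - ln r) = exp u / r" using r by (simp add: exp_diff)
  finally have "r * (1 + (u - ln r)) \<le> exp u" using r by (simp add: field_simps)
  then show ?thesis by (simp add: kl_def algebra_simps)
qed (simp add: kl_def)

lemma kl_nonneg: "0 \<le> r \<Longrightarrow> 0 \<le> kl r"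
  using kl_Young[of r 0] by simp

lemma kl_measurable [measurable]: "kl \<in> borel_measurable borel"
  unfolding kl_def[abs_def] by measurable

text \<open>Add two Young inequalities with the common slope \<open>ln (s * x + t * y)\<close>, the
  tangent of \<open>kl\<close> at the mixture point. At the mixture point 0 there is no tangent, so
  that case is computed.\<close>

lemma kl_convex:
  assumes "0 \<le> x" "0 \<le> y" "0 \<le> s" "0 \<le> t" "s + t = 1"
  shows "kl (s * x + t * y) \<le> s * kl x + t * kl y"
proof (cases "s * x + t * y = 0")
  case True
  have "0 \<le> s * x" "0 \<le> t * y" using assms by auto
  then have z: "s * x = 0" "t * y = 0" using True by linarith+
  have "s * kl x + t * kl y = (s * x) * ln x - s * x + s + ((t * y) * ln y - t * y + t)"
    by (simp add: kl_def algebra_simps)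
  then have "s * kl x + t * kl y = s + t" unfolding z by simp
  then show ?thesis using True assms by (simp add: kl_def)
next
  case False
  let ?m = "s * x + t * y"
  have m: "?m > 0" using False assms by (smt (verit) mult_nonneg_nonneg)
  have "x * ln ?m + 1 - ?m \<le> kl x" "y * ln ?m + 1 - ?m \<le> kl y"
    using kl_Young[of x "ln ?m"] kl_Young[of y "ln ?m"] assms m by simp_all
  then have "s * (x * ln ?m + 1 - ?m) + t * (y * ln ?m + 1 - ?m) \<le> s * kl x + t * kl y"
    using assms by (intro add_mono mult_left_mono) auto
  moreover have "s * (x * ln ?m + 1 - ?m) + t * (y * ln ?m + 1 - ?m) = ?m * ln ?m + (s + t) * (1 - ?m)"
    by algebra
  ultimately show ?thesis using assms by (simp add: kl_def)
qed

text \<open>The two halves of \<open>extended_integral\<close> become the positive and negative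
  parts of r ln r. The negative part is at most 1 pointwise, hence of finite integral, so no
  difference of infinities arises when the mass terms are absorbed.\<close>

lemma KL_density:
  fixes \<nu> :: "'a::topological_space measure"
  assumes n: "\<nu> \<in> pos_measures" and r: "r \<in> borel_measurable borel" "\<And>x. 0 \<le> r x" "integrable \<nu> r"
  shows "KL (density \<nu> (\<lambda>x. ennreal (r x))) \<nu> = enn2ereal (\<integral>\<^sup>+x. ennreal (kl (r x)) \<partial>\<nu>)"
proof -
  note n' = pos_measuresD[OF n]
  interpret finite_measure \<nu> by (rule n')
  let ?\<mu> = "density \<nu> (\<lambda>x. ennreal (r x))"
  have rm [measurable]: "r \<in> borel_measurable \<nu>" using r n' by (simp cong: measurable_cong_sets)
  have ac: "absolutely_continuous \<nu> ?\<mu>" by (rule absolutely_continuousI_density) measurable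
  have AE: "AE x in \<nu>. RN_deriv \<nu> ?\<mu> x = ennreal (r x)"
    using RN_deriv_unique[of "\<lambda>x. ennreal (r x)" ?\<mu>] by auto
  let ?L = "\<lambda>x. ln (enn2real (RN_deriv \<nu> ?\<mu> x))"
  define A where "A = (\<integral>\<^sup>+x. ennreal (r x * ln (r x)) \<partial>\<nu>)"
  define B where "B = (\<integral>\<^sup>+x. ennreal (- (r x * ln (r x))) \<partial>\<nu>)"
  define R where "R = (\<integral>\<^sup>+x. ennreal (r x) \<partial>\<nu>)"
  define K where "K = (\<integral>\<^sup>+x. ennreal (kl (r x)) \<partial>\<nu>)"
  have A: "(\<integral>\<^sup>+x. ennreal (?L x) \<partial>?\<mu>) = A"
    unfolding A_def using AE
    by (subst nn_integral_density) (auto intro!: nn_integral_cong_AE simp: r ennreal_mult'[symmetric])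
  have B: "(\<integral>\<^sup>+x. ennreal (- ?L x) \<partial>?\<mu>) = B"
    unfolding B_def using AE
    by (subst nn_integral_density) (auto intro!: nn_integral_cong_AE simp: r ennreal_mult'[symmetric])
  have Rf: "R < \<infinity>" using integrableD(2)[OF r(3)] by (simp add: R_def less_top)
  have "emeasure ?\<mu> (space ?\<mu>) = R" by (simp add: emeasure_density R_def cong: nn_integral_cong)
  then have R: "measure ?\<mu> (space ?\<mu>) = enn2real R" by (simp add: measure_def)
  have V: "emeasure \<nu> (space \<nu>) = ennreal (measure \<nu> (space \<nu>))" by (rule emeasure_eq_measure)
  have "- (r x * ln (r x)) \<le> 1" for x
    using kl_Young[of "r x" "0"] kl_nonneg[OF r(2), of x] kl_Young[of "r x" "1"] r(2)[of x]
    by (cases "r x \<ge> 1") (auto simp: kl_def not_le intro: order_trans[of _ 0])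
  then have "B \<le> (\<integral>\<^sup>+x. 1 \<partial>\<nu>)" unfolding B_def by (intro nn_integral_mono) (simp add: ennreal_le_1)
  then have Bf: "B < \<infinity>" using emeasure_finite[of "space \<nu>"] by (auto simp: less_top[symmetric] top_unique)
  \<comment> \<open>All negative terms are moved across the equation, because subtraction in
    \<open>ennreal\<close> is truncated.\<close>
  have p: "ennreal (a) + 1 = ennreal (a - c + 1) + (ennreal (- a) + ennreal c)"
    if "0 \<le> c" "0 \<le> a - c + 1" for a c :: real
    using that by (cases "0 \<le> a")
      (auto simp: ennreal_plus[symmetric] ennreal_neg ennreal_1[symmetric] simp del: ennreal_plus ennreal_1)
  have "A + emeasure \<nu> (space \<nu>) = (\<integral>\<^sup>+x. ennreal (r x * ln (r x)) + 1 \<partial>\<nu>)"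
    unfolding A_def by (simp add: nn_integral_add)
  also have "\<dots> = (\<integral>\<^sup>+x. ennreal (kl (r x)) + (ennreal (- (r x * ln (r x))) + ennreal (r x)) \<partial>\<nu>)"
    using kl_nonneg[OF r(2)] r(2) unfolding kl_def by (intro nn_integral_cong p) auto
  also have "\<dots> = K + (B + R)"
    unfolding K_def B_def R_def by (simp add: nn_integral_add)
  finally have eq: "A + ennreal (measure \<nu> (space \<nu>)) = K + (B + R)" by (simp add: V)
  have "enn2ereal A - enn2ereal B - ereal (enn2real R) + ereal (measure \<nu> (space \<nu>)) = enn2ereal K"
  proof -
    obtain b where b: "B = ennreal b" "0 \<le> b" using Bf by (cases B) auto
    obtain c where c: "R = ennreal c" "0 \<le> c" using Rf by (cases R) auto
    obtain v where v: "measure \<nu> (space \<nu>) = v" "0 \<le> v" by simp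
    show ?thesis using eq b c v
      by (cases A; cases K) (auto simp: ennreal_plus[symmetric] simp del: ennreal_plus)
  qed
  then show ?thesis using ac A B R unfolding KL_def extended_integral_def K_def by simp
qed

section \<open>Densities of mixtures\<close>

lemma nn_integral_scale:
  assumes "f \<in> borel_measurable M"
  shows "(\<integral>\<^sup>+x. f x \<partial>scale_measure c M) = c * (\<integral>\<^sup>+x. f x \<partial>M)"
proof -
  have "scale_measure c M = density M (\<lambda>_. c)"
    by (rule measure_eqI) (auto simp: emeasure_density_const)
  then show ?thesis using assms by (simp add: nn_integral_density nn_integral_cmult)
qed

lemma integrable_bounded:
  fixes f :: "'a::topological_space \<Rightarrow> real"
  assumes "\<mu> \<in> pos_measures" "f \<in> borel_measurable borel" "\<And>x. \<bar>f x\<bar> \<le> K"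
  shows "integrable \<mu> f"
proof -
  note m = pos_measuresD[OF assms(1)]
  interpret finite_measure \<mu> by (rule m)
  show ?thesis using assms m by (intro integrable_const_bound[of _ K]) (auto cong: measurable_cong_sets)
qed

lemma integral_mix_measure:
  fixes f :: "'a::topological_space \<Rightarrow> real"
  assumes m: "\<mu>0 \<in> pos_measures" "\<mu>1 \<in> pos_measures" "t \<in> {0..1}"
    and f: "f \<in> borel_measurable borel" "\<And>x. \<bar>f x\<bar> \<le> K"
  shows "(\<integral>x. f x \<partial>mix_measure t \<mu>0 \<mu>1) = (1 - t) * (\<integral>x. f x \<partial>\<mu>0) + t * (\<integral>x. f x \<partial>\<mu>1)"
proof -
  note a = pos_measuresD[OF m(1)] and b = pos_measuresD[OF m(2)]
  have i: "integrable \<mu>0 f" "integrable \<mu>1 f" "integrable (mix_measure t \<mu>0 \<mu>1) f"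
    using integrable_bounded[OF _ f] mix_measure_in_pos_measures m by auto
  have fm: "f \<in> borel_measurable \<mu>0" using f a by (simp cong: measurable_cong_sets)
  have *: "enn2real (\<integral>\<^sup>+x. ennreal (g x) \<partial>mix_measure t \<mu>0 \<mu>1) =
     (1 - t) * enn2real (\<integral>\<^sup>+x. ennreal (g x) \<partial>\<mu>0) + t * enn2real (\<integral>\<^sup>+x. ennreal (g x) \<partial>\<mu>1)"
    if "integrable \<mu>0 g" "integrable \<mu>1 g" for g
  proof -
    have "(\<integral>\<^sup>+x. ennreal (g x) \<partial>\<mu>0) < top" "(\<integral>\<^sup>+x. ennreal (g x) \<partial>\<mu>1) < top"
      using integrableD(2)[OF that(1)] integrableD(2)[OF that(2)] by (auto simp: less_top)
    then show ?thesis using that m(3) a b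
      by (subst nn_integral_mix_measure) (auto simp: enn2real_plus enn2real_mult ennreal_mult_less_top)
  qed
  show ?thesis unfolding real_lebesgue_integral_def[OF i(1)] real_lebesgue_integral_def[OF i(2)]
      real_lebesgue_integral_def[OF i(3)] *[OF i(1,2)]
    using *[of "\<lambda>x. - f x"] i by (simp add: algebra_simps)
qed

text \<open>The two weighted summands of the mixture \<open>N\<close> have densities
  \<open>w0\<close> and \<open>w1\<close> with respect to \<open>N\<close>, and these sum to 1
  almost everywhere. The mixed measure therefore has the density w0 r0 + w1 r1, a pointwise convex
  combination, to which the convexity of \<open>\<psi>\<close> applies under the integral.
  \<open>\<psi>\<close> is left free so that the marginal penalties and the entropy are covered
  alike.\<close>

lemma mix_density:
  fixes \<nu>0 \<nu>1 :: "'a::topological_space measure"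
  assumes n: "\<nu>0 \<in> pos_measures" "\<nu>1 \<in> pos_measures" and t: "0 < t" "t < 1"
    and r0: "r0 \<in> borel_measurable borel" "\<And>x. 0 \<le> r0 x" "integrable \<nu>0 r0"
    and r1: "r1 \<in> borel_measurable borel" "\<And>x. 0 \<le> r1 x" "integrable \<nu>1 r1"
  obtains r :: "'a \<Rightarrow> real" where "r \<in> borel_measurable borel" "\<And>x. 0 \<le> r x"
    "integrable (mix_measure t \<nu>0 \<nu>1) r"
    "mix_measure t (density \<nu>0 (\<lambda>x. ennreal (r0 x))) (density \<nu>1 (\<lambda>x. ennreal (r1 x))) =
       density (mix_measure t \<nu>0 \<nu>1) (\<lambda>x. ennreal (r x))"
    "\<And>\<psi> :: real \<Rightarrow> ennreal. \<psi> \<in> borel_measurable borel \<Longrightarrow>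
       (\<And>x y s u. 0 \<le> x \<Longrightarrow> 0 \<le> y \<Longrightarrow> 0 \<le> s \<Longrightarrow> 0 \<le> u \<Longrightarrow> s + u = 1 \<Longrightarrow>
          \<psi> (s * x + u * y) \<le> ennreal s * \<psi> x + ennreal u * \<psi> y) \<Longrightarrow>
       (\<integral>\<^sup>+x. \<psi> (r x) \<partial>mix_measure t \<nu>0 \<nu>1) \<le>
         ennreal (1 - t) * (\<integral>\<^sup>+x. \<psi> (r0 x) \<partial>\<nu>0) + ennreal t * (\<integral>\<^sup>+x. \<psi> (r1 x) \<partial>\<nu>1)"
proof -
  note n0 = pos_measuresD[OF n(1)] and n1 = pos_measuresD[OF n(2)]
  define N where "N = mix_measure t \<nu>0 \<nu>1"
  have Np: "N \<in> pos_measures" using n by (simp add: N_def mix_measure_in_pos_measures)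
  note N' = pos_measuresD[OF Np]
  interpret N: finite_measure N by (rule N')
  note [measurable_cong] = N'(1) n0(1) n1(1)
  have eN: "emeasure N A = ennreal (1 - t) * emeasure \<nu>0 A + ennreal t * emeasure \<nu>1 A"
    if "A \<in> sets borel" for A
    using that n0 n1 by (simp add: N_def emeasure_mix_measure)
  have sp: "scale_measure (ennreal c) \<nu> \<in> pos_measures" if "\<nu> \<in> pos_measures" for c and \<nu> :: "'a measure"
  proof -
    note m = pos_measuresD[OF that]
    interpret finite_measure \<nu> by (rule m)
    show ?thesis using m emeasure_finite
      by (auto simp: pos_measures_def space_scale_measure ennreal_mult_eq_top_iff intro!: finite_measureI)
  qed
  have "absolutely_continuous N (scale_measure (ennreal (1 - t)) \<nu>0)"
      "absolutely_continuous N (scale_measure (ennreal t) \<nu>1)"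
    using n0 n1 N' by (auto simp: absolutely_continuous_def null_sets_def eN)
  with sp[OF n(1)] sp[OF n(2)] Np obtain w0 w1 :: "'a \<Rightarrow> real"
    where w0: "w0 \<in> borel_measurable borel" "\<And>x. 0 \<le> w0 x" "integrable N w0"
      "scale_measure (ennreal (1 - t)) \<nu>0 = density N (\<lambda>x. ennreal (w0 x))"
    and w1: "w1 \<in> borel_measurable borel" "\<And>x. 0 \<le> w1 x" "integrable N w1"
      "scale_measure (ennreal t) \<nu>1 = density N (\<lambda>x. ennreal (w1 x))"
    by (metis density_of_absolutely_continuous)
  note [measurable] = w0(1) w1(1) r0(1) r1(1)
  have i0: "(\<integral>\<^sup>+x. ennreal (w0 x) * h x \<partial>N) = ennreal (1 - t) * (\<integral>\<^sup>+x. h x \<partial>\<nu>0)"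
    if [measurable]: "h \<in> borel_measurable borel" for h
    using nn_integral_scale[of h \<nu>0 "ennreal (1 - t)"] unfolding w0(4)
    by (simp add: nn_integral_density)
  have i1: "(\<integral>\<^sup>+x. ennreal (w1 x) * h x \<partial>N) = ennreal t * (\<integral>\<^sup>+x. h x \<partial>\<nu>1)"
    if [measurable]: "h \<in> borel_measurable borel" for h
    using nn_integral_scale[of h \<nu>1 "ennreal t"] unfolding w1(4)
    by (simp add: nn_integral_density)
  \<comment> \<open>Both summands together give back \<open>N\<close>; uniqueness of densities then
    turns this into w0 + w1 = 1 almost everywhere.\<close>
  have "density N (\<lambda>x. ennreal (w0 x) + ennreal (w1 x)) = density N (\<lambda>x. 1)"
  proof (rule measure_eqI)
    fix A assume "A \<in> sets (density N (\<lambda>x. ennreal (w0 x) + ennreal (w1 x)))"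
    then have A [measurable]: "A \<in> sets borel" using N' by simp
    have "emeasure (density N (\<lambda>x. ennreal (w0 x) + ennreal (w1 x))) A =
        (\<integral>\<^sup>+x. ennreal (w0 x) * indicator A x + ennreal (w1 x) * indicator A x \<partial>N)"
      by (subst emeasure_density) (auto simp: distrib_right N')
    also have "\<dots> = emeasure N A"
      using n0 n1 by (subst nn_integral_add) (auto simp: i0 i1 eN)
    finally show "emeasure (density N (\<lambda>x. ennreal (w0 x) + ennreal (w1 x))) A = emeasure (density N (\<lambda>x. 1)) A"
      by (simp add: density_1)
  qed simp
  then have "AE x in N. ennreal (w0 x) + ennreal (w1 x) = 1"
    by (subst (asm) N.density_unique_iff) auto
  then have w: "AE x in N. w0 x + w1 x = 1"
    using w0(2) w1(2) by (simp add: ennreal_plus[symmetric] del: ennreal_plus)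
  define r where "r x = w0 x * r0 x + w1 x * r1 x" for x
  have r [measurable]: "r \<in> borel_measurable borel" unfolding r_def by measurable
  have r': "\<And>x. 0 \<le> r x" using w0 w1 r0 r1 by (simp add: r_def)
  have er: "ennreal (r x) = ennreal (w0 x) * ennreal (r0 x) + ennreal (w1 x) * ennreal (r1 x)" for x
    using w0 w1 r0 r1 by (simp add: r_def ennreal_plus ennreal_mult'')
  have ir: "(\<integral>\<^sup>+x. ennreal (r x) * h x \<partial>N) =
      ennreal (1 - t) * (\<integral>\<^sup>+x. ennreal (r0 x) * h x \<partial>\<nu>0) + ennreal t * (\<integral>\<^sup>+x. ennreal (r1 x) * h x \<partial>\<nu>1)"
    if [measurable]: "h \<in> borel_measurable borel" for h
    unfolding er by (simp add: distrib_right mult.assoc nn_integral_add i0 i1)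
  show thesis
  proof (rule that[of r, folded N_def])
    show "integrable N r"
      using ir[of "\<lambda>_. 1"] integrableD(2)[OF r0(3)] integrableD(2)[OF r1(3)] r'
      by (intro integrableI_nonneg) (auto simp: less_top[symmetric] ennreal_mult_eq_top_iff)
    show "mix_measure t (density \<nu>0 (\<lambda>x. ennreal (r0 x))) (density \<nu>1 (\<lambda>x. ennreal (r1 x))) =
       density N (\<lambda>x. ennreal (r x))"
      using n0 n1 N' by (intro measure_eqI) (auto simp: emeasure_mix_measure emeasure_density ir)
  next
    fix \<psi> :: "real \<Rightarrow> ennreal" assume [measurable]: "\<psi> \<in> borel_measurable borel"
      and cv: "\<And>x y s u. 0 \<le> x \<Longrightarrow> 0 \<le> y \<Longrightarrow> 0 \<le> s \<Longrightarrow> 0 \<le> u \<Longrightarrow> s + u = 1 \<Longrightarrow>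
          \<psi> (s * x + u * y) \<le> ennreal s * \<psi> x + ennreal u * \<psi> y"
    have "(\<integral>\<^sup>+x. \<psi> (r x) \<partial>N) \<le> (\<integral>\<^sup>+x. ennreal (w0 x) * \<psi> (r0 x) + ennreal (w1 x) * \<psi> (r1 x) \<partial>N)"
      using w by (intro nn_integral_mono_AE) (auto simp: r_def cv w0 w1 r0 r1)
    also have "\<dots> = ennreal (1 - t) * (\<integral>\<^sup>+x. \<psi> (r0 x) \<partial>\<nu>0) + ennreal t * (\<integral>\<^sup>+x. \<psi> (r1 x) \<partial>\<nu>1)"
      by (subst nn_integral_add) (auto simp: i0 i1)
    finally show "(\<integral>\<^sup>+x. \<psi> (r x) \<partial>N) \<le>
         ennreal (1 - t) * (\<integral>\<^sup>+x. \<psi> (r0 x) \<partial>\<nu>0) + ennreal t * (\<integral>\<^sup>+x. \<psi> (r1 x) \<partial>\<nu>1)" .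
  qed (use r r' in auto)
qed

section \<open>Product measures and marginals\<close>

lemma pair_measure_in_pos_measures:
  fixes \<alpha> \<beta> :: "'a::second_countable_topology measure"
  assumes "\<alpha> \<in> pos_measures" "\<beta> \<in> pos_measures"
  shows "\<alpha> \<Otimes>\<^sub>M \<beta> \<in> pos_measures"
proof -
  note a = pos_measuresD[OF assms(1)] and b = pos_measuresD[OF assms(2)]
  interpret a: finite_measure \<alpha> by (rule a)
  interpret b: finite_measure \<beta> by (rule b)
  have "sets (\<alpha> \<Otimes>\<^sub>M \<beta>) = sets (borel \<Otimes>\<^sub>M borel)" using a b by (intro sets_pair_measure_cong) auto
  then have s: "sets (\<alpha> \<Otimes>\<^sub>M \<beta>) = sets borel" by (simp only: borel_prod)
  have "emeasure (\<alpha> \<Otimes>\<^sub>M \<beta>) (space (\<alpha> \<Otimes>\<^sub>M \<beta>)) = emeasure \<alpha> (space \<alpha>) * emeasure \<beta> (space \<beta>)"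
    by (simp add: space_pair_measure b.emeasure_pair_measure_Times)
  also have "\<dots> < top" using a.emeasure_finite b.emeasure_finite
    by (intro ennreal_mult_less_top[THEN iffD2]) (auto simp: less_top[symmetric])
  finally show ?thesis using s by (auto simp: pos_measures_def less_top[symmetric] intro!: finite_measureI)
qed

lemma fst_snd_measurable_borel [measurable]:
  "fst \<in> (borel :: ('a::second_countable_topology \<times> 'b::second_countable_topology) measure) \<rightarrow>\<^sub>M borel"
  "snd \<in> (borel :: ('a::second_countable_topology \<times> 'b::second_countable_topology) measure) \<rightarrow>\<^sub>M borel"
  by (intro borel_measurable_continuous_onI continuous_intros)+

lemma marginals_in_pos_measures:
  fixes \<pi> :: "('a::second_countable_topology \<times> 'a) measure"
  assumes "\<pi> \<in> pos_measures"
  shows "distr \<pi> borel fst \<in> pos_measures" "distr \<pi> borel snd \<in> pos_measures"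
proof -
  note p = pos_measuresD[OF assms]
  interpret finite_measure \<pi> by (rule p)
  have "finite_measure (distr \<pi> borel fst)" "finite_measure (distr \<pi> borel snd)"
    using p by (auto intro!: finite_measure_distr cong: measurable_cong_sets)
  then show "distr \<pi> borel fst \<in> pos_measures" "distr \<pi> borel snd \<in> pos_measures"
    by (auto simp: pos_measures_def)
qed

text \<open>A null set of one factor spans a null cylinder of the product, whatever the mass of the
  other factor.\<close>

lemma marginals_absolutely_continuous:
  fixes \<alpha> \<beta> :: "'a::second_countable_topology measure"
  assumes m: "\<alpha> \<in> pos_measures" "\<beta> \<in> pos_measures" "\<pi> \<in> pos_measures"
    and ac: "absolutely_continuous (\<alpha> \<Otimes>\<^sub>M \<beta>) \<pi>"
  shows "absolutely_continuous \<alpha> (distr \<pi> borel fst)" "absolutely_continuous \<beta> (distr \<pi> borel snd)"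
proof -
  note a = pos_measuresD[OF m(1)] and b = pos_measuresD[OF m(2)] and p = pos_measuresD[OF m(3)]
  interpret a: finite_measure \<alpha> by (rule a)
  interpret b: finite_measure \<beta> by (rule b)
  note [measurable_cong] = p(1)
  have *: "A \<times> B \<in> null_sets \<pi>" if "A \<in> sets \<alpha>" "B \<in> sets \<beta>" "emeasure \<alpha> A = 0 \<or> emeasure \<beta> B = 0" for A B
  proof -
    have "A \<times> B \<in> null_sets (\<alpha> \<Otimes>\<^sub>M \<beta>)" using that b.emeasure_pair_measure_Times[OF that(1,2)] by auto
    then show ?thesis using ac by (auto simp: absolutely_continuous_def)
  qed
  show "absolutely_continuous \<alpha> (distr \<pi> borel fst)" unfolding absolutely_continuous_def
  proof
    fix A assume A: "A \<in> null_sets \<alpha>"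
    then have "A \<times> UNIV \<in> null_sets \<pi>" using b by (intro *) auto
    moreover have "fst -` A \<inter> space \<pi> = A \<times> UNIV" using p by auto
    moreover have "A \<in> sets borel" using A a by auto
    ultimately show "A \<in> null_sets (distr \<pi> borel fst)" by (simp add: null_sets_def emeasure_distr)
  qed
  show "absolutely_continuous \<beta> (distr \<pi> borel snd)" unfolding absolutely_continuous_def
  proof
    fix A assume A: "A \<in> null_sets \<beta>"
    then have "UNIV \<times> A \<in> null_sets \<pi>" using a by (intro *) auto
    moreover have "snd -` A \<inter> space \<pi> = UNIV \<times> A" using p by auto
    moreover have "A \<in> sets borel" using A b by auto
    ultimately show "A \<in> null_sets (distr \<pi> borel snd)" by (simp add: null_sets_def emeasure_distr)
  qed
qed

lemma pair_measure_mix_left: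
  fixes \<alpha>0 \<alpha>1 \<beta> :: "'a::second_countable_topology measure"
  assumes m: "\<alpha>0 \<in> pos_measures" "\<alpha>1 \<in> pos_measures" "\<beta> \<in> pos_measures"
  shows "mix_measure t \<alpha>0 \<alpha>1 \<Otimes>\<^sub>M \<beta> = mix_measure t (\<alpha>0 \<Otimes>\<^sub>M \<beta>) (\<alpha>1 \<Otimes>\<^sub>M \<beta>)"
proof (rule measure_eqI)
  note a0 = pos_measuresD[OF m(1)] and a1 = pos_measuresD[OF m(2)] and b = pos_measuresD[OF m(3)]
  interpret b: finite_measure \<beta> by (rule b)
  have s: "sets (\<alpha>1 \<Otimes>\<^sub>M \<beta>) = sets (\<alpha>0 \<Otimes>\<^sub>M \<beta>)" "sets (mix_measure t \<alpha>0 \<alpha>1 \<Otimes>\<^sub>M \<beta>) = sets (\<alpha>0 \<Otimes>\<^sub>M \<beta>)"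
    using a0 a1 by (auto intro!: sets_pair_measure_cong)
  then show "sets (mix_measure t \<alpha>0 \<alpha>1 \<Otimes>\<^sub>M \<beta>) = sets (mix_measure t (\<alpha>0 \<Otimes>\<^sub>M \<beta>) (\<alpha>1 \<Otimes>\<^sub>M \<beta>))" by simp
  fix X assume "X \<in> sets (mix_measure t \<alpha>0 \<alpha>1 \<Otimes>\<^sub>M \<beta>)"
  then have X: "X \<in> sets (\<alpha>0 \<Otimes>\<^sub>M \<beta>)" using s by simp
  show "emeasure (mix_measure t \<alpha>0 \<alpha>1 \<Otimes>\<^sub>M \<beta>) X = emeasure (mix_measure t (\<alpha>0 \<Otimes>\<^sub>M \<beta>) (\<alpha>1 \<Otimes>\<^sub>M \<beta>)) X"
    using X s a0 a1 b.measurable_emeasure_Pair[OF X]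
    by (simp add: emeasure_mix_measure b.emeasure_pair_measure_alt nn_integral_mix_measure)
qed

lemma pair_measure_mix_right:
  fixes \<alpha> \<beta>0 \<beta>1 :: "'a::second_countable_topology measure"
  assumes m: "\<alpha> \<in> pos_measures" "\<beta>0 \<in> pos_measures" "\<beta>1 \<in> pos_measures"
  shows "\<alpha> \<Otimes>\<^sub>M mix_measure t \<beta>0 \<beta>1 = mix_measure t (\<alpha> \<Otimes>\<^sub>M \<beta>0) (\<alpha> \<Otimes>\<^sub>M \<beta>1)"
proof (rule measure_eqI)
  note a = pos_measuresD[OF m(1)] and b0 = pos_measuresD[OF m(2)] and b1 = pos_measuresD[OF m(3)]
  interpret b0: finite_measure \<beta>0 by (rule b0)
  interpret b1: finite_measure \<beta>1 by (rule b1)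
  interpret b: finite_measure "mix_measure t \<beta>0 \<beta>1"
    using mix_measure_in_pos_measures[OF m(2,3)] by (rule pos_measuresD)
  have s: "sets (\<alpha> \<Otimes>\<^sub>M \<beta>1) = sets (\<alpha> \<Otimes>\<^sub>M \<beta>0)" "sets (\<alpha> \<Otimes>\<^sub>M mix_measure t \<beta>0 \<beta>1) = sets (\<alpha> \<Otimes>\<^sub>M \<beta>0)"
    using b0 b1 by (auto intro!: sets_pair_measure_cong)
  then show "sets (\<alpha> \<Otimes>\<^sub>M mix_measure t \<beta>0 \<beta>1) = sets (mix_measure t (\<alpha> \<Otimes>\<^sub>M \<beta>0) (\<alpha> \<Otimes>\<^sub>M \<beta>1))" by simp
  fix X assume "X \<in> sets (\<alpha> \<Otimes>\<^sub>M mix_measure t \<beta>0 \<beta>1)"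
  then have X: "X \<in> sets (\<alpha> \<Otimes>\<^sub>M \<beta>0)" "X \<in> sets (\<alpha> \<Otimes>\<^sub>M \<beta>1)" using s by auto
  have "emeasure (\<alpha> \<Otimes>\<^sub>M mix_measure t \<beta>0 \<beta>1) X =
      (\<integral>\<^sup>+x. ennreal (1 - t) * emeasure \<beta>0 (Pair x -` X) + ennreal t * emeasure \<beta>1 (Pair x -` X) \<partial>\<alpha>)"
    using X s b0 b1 sets_Pair1[OF X(1)] by (simp add: b.emeasure_pair_measure_alt emeasure_mix_measure)
  also have "\<dots> = emeasure (mix_measure t (\<alpha> \<Otimes>\<^sub>M \<beta>0) (\<alpha> \<Otimes>\<^sub>M \<beta>1)) X"
    using X s b0.measurable_emeasure_Pair[OF X(1)] b1.measurable_emeasure_Pair[OF X(2)]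
    by (simp add: emeasure_mix_measure b0.emeasure_pair_measure_alt b1.emeasure_pair_measure_alt
        nn_integral_add nn_integral_cmult)
  finally show "emeasure (\<alpha> \<Otimes>\<^sub>M mix_measure t \<beta>0 \<beta>1) X = emeasure (mix_measure t (\<alpha> \<Otimes>\<^sub>M \<beta>0) (\<alpha> \<Otimes>\<^sub>M \<beta>1)) X" .
qed

text \<open>The building block of weak duality: an affine minorant h + q p of the integrand is
  integrated along the density r. Boundedness of q makes q r integrable although r may be
  unbounded.\<close>

lemma nn_integral_ge_affine:
  fixes \<nu> :: "'a::topological_space measure" and r h q :: "'a \<Rightarrow> real"
  assumes n: "\<nu> \<in> pos_measures" and r: "r \<in> borel_measurable borel" "\<And>x. 0 \<le> r x" "integrable \<nu> r"
    and h: "h \<in> borel_measurable borel" "\<And>x. \<bar>h x\<bar> \<le> H"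
    and q: "q \<in> borel_measurable borel" "\<And>x. \<bar>q x\<bar> \<le> Q"
    and le: "\<And>x. ereal (h x + q x * r x) \<le> enn2ereal (\<psi> x)"
  shows "ereal ((\<integral>x. h x \<partial>\<nu>) + (\<integral>x. q x \<partial>density \<nu> (\<lambda>x. ennreal (r x)))) \<le> enn2ereal (\<integral>\<^sup>+x. \<psi> x \<partial>\<nu>)"
proof -
  note [measurable] = r(1) h(1) q(1)
  note [measurable_cong] = pos_measuresD(1)[OF n]
  have h': "integrable \<nu> h" by (rule integrable_bounded[OF n h])
  have "integrable (density \<nu> (\<lambda>x. ennreal (r x))) q"
    by (rule integrable_bounded[OF density_in_pos_measures[OF n r(1,3)] q])
  then have q': "integrable \<nu> (\<lambda>x. r x * q x)"
    by (subst (asm) integrable_real_density) (auto simp: r)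
  have eq: "(\<integral>x. q x \<partial>density \<nu> (\<lambda>x. ennreal (r x))) = (\<integral>x. r x * q x \<partial>\<nu>)"
    by (subst integral_real_density) (auto simp: r)
  let ?w = "\<lambda>x. h x + r x * q x"
  have w: "integrable \<nu> ?w" using h' q' by simp
  \<comment> \<open>The minorant may be negative while the right side is a nonnegative integral,
    hence the detour through \<open>max 0\<close>.\<close>
  have "(\<integral>x. ?w x \<partial>\<nu>) \<le> (\<integral>x. max 0 (?w x) \<partial>\<nu>)" using w by (intro integral_mono) auto
  also have "ennreal \<dots> = (\<integral>\<^sup>+x. ennreal (max 0 (?w x)) \<partial>\<nu>)"
    using w by (intro nn_integral_eq_integral[symmetric]) auto
  also have "\<dots> \<le> (\<integral>\<^sup>+x. \<psi> x \<partial>\<nu>)"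
  proof (intro nn_integral_mono)
    fix x
    have "enn2ereal (ennreal (max 0 (?w x))) \<le> enn2ereal (\<psi> x)"
      using le[of x] by (simp add: max_def mult.commute zero_ereal_def[symmetric])
    then show "ennreal (max 0 (?w x)) \<le> \<psi> x" by (simp add: less_eq_ennreal.rep_eq)
  qed
  finally have "ennreal (\<integral>x. ?w x \<partial>\<nu>) \<le> (\<integral>\<^sup>+x. \<psi> x \<partial>\<nu>)" by (simp add: ennreal_leI)
  then have "enn2ereal (ennreal (\<integral>x. ?w x \<partial>\<nu>)) \<le> enn2ereal (\<integral>\<^sup>+x. \<psi> x \<partial>\<nu>)" by (simp add: less_eq_ennreal.rep_eq)
  moreover have "ereal (\<integral>x. ?w x \<partial>\<nu>) \<le> enn2ereal (ennreal (\<integral>x. ?w x \<partial>\<nu>))"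
    by (simp add: ennreal.rep_eq)
  ultimately show ?thesis using h' q' by (simp add: eq)
qed

section \<open>The transport objective\<close>

lemma entropy_functionD:
  assumes "entropy_function \<phi>"
  shows "x < 0 \<Longrightarrow> \<phi> x = \<infinity>" "0 \<le> \<phi> x" "\<phi> 1 = 0"
    "0 \<le> s \<Longrightarrow> 0 \<le> t \<Longrightarrow> s + t = 1 \<Longrightarrow> \<phi> (s * x + t * y) \<le> ereal s * \<phi> x + ereal t * \<phi> y"
proof -
  show "x < 0 \<Longrightarrow> \<phi> x = \<infinity>" "0 \<le> \<phi> x" "\<phi> 1 = 0" using assms by (auto simp: entropy_function_def)
  assume st: "0 \<le> s" "0 \<le> t" "s + t = 1"
  then have "t \<in> {0..1}" "s = 1 - t" by auto
  then show "\<phi> (s * x + t * y) \<le> ereal s * \<phi> x + ereal t * \<phi> y"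
    using assms unfolding entropy_function_def by blast
qed

lemma entropy_function_eventually_greater:
  assumes "entropy_function \<phi>" "c < \<phi> x"
  shows "eventually (\<lambda>y. c < \<phi> y) (nhds x)"
proof -
  have "c < Liminf (at x) \<phi>" using assms unfolding entropy_function_def by (metis less_le_trans)
  then have "eventually (\<lambda>y. c < \<phi> y) (at x)" by (rule less_LiminfD)
  then show ?thesis using assms(2) by (auto simp: eventually_at_filter elim: eventually_mono)
qed

lemma entropy_function_measurable:
  assumes "entropy_function \<phi>"
  shows "\<phi> \<in> borel_measurable borel"
proof (rule borel_measurableI_greater)
  fix c
  have "open {x. c < \<phi> x}"
  proof (subst open_subopen, intro ballI)
    fix x assume "x \<in> {x. c < \<phi> x}"
    then have "eventually (\<lambda>y. c < \<phi> y) (nhds x)"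
      using entropy_function_eventually_greater[OF assms] by simp
    then show "\<exists>T. open T \<and> x \<in> T \<and> T \<subseteq> {x. c < \<phi> x}" unfolding eventually_nhds by blast
  qed
  then show "{x \<in> space borel. c < \<phi> x} \<in> sets borel" by simp
qed

text \<open>\<open>\<phi>\<close> is nonnegative, so the passage to \<open>ennreal\<close> loses
  nothing and opens nonnegative integration, without integrability conditions.\<close>

definition ephi :: "(real \<Rightarrow> ereal) \<Rightarrow> real \<Rightarrow> ennreal" where
  "ephi \<phi> x = e2ennreal (\<phi> x)"

lemma ephi_measurable [measurable]: "entropy_function \<phi> \<Longrightarrow> ephi \<phi> \<in> borel_measurable borel"
  using measurable_compose[OF entropy_function_measurable measurable_e2ennreal, of \<phi>]
  by (simp add: ephi_def[abs_def])

lemma enn2ereal_ephi: "entropy_function \<phi> \<Longrightarrow> enn2ereal (ephi \<phi> x) = \<phi> x"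
  by (simp add: ephi_def enn2ereal_e2ennreal entropy_functionD)

lemma ephi_convex:
  assumes e: "entropy_function \<phi>" and st: "0 \<le> s" "0 \<le> t" "s + t = 1"
  shows "ephi \<phi> (s * x + t * y) \<le> ennreal s * ephi \<phi> x + ennreal t * ephi \<phi> y"
  using entropy_functionD(4)[OF e st, of x y] st
  by (simp add: less_eq_ennreal.rep_eq plus_ennreal.rep_eq times_ennreal.rep_eq enn2ereal_ephi[OF e])

definition objective ::
    "('a::topological_space \<Rightarrow> 'a \<Rightarrow> real) \<Rightarrow> (real \<Rightarrow> ereal) \<Rightarrow> real \<Rightarrow>
     'a measure \<Rightarrow> 'a measure \<Rightarrow> ('a \<times> 'a) measure \<Rightarrow> ereal" where
  "objective C \<phi> \<epsilon> \<alpha> \<beta> \<pi> =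
     ereal (\<integral>z. C (fst z) (snd z) \<partial>\<pi>)
        + csiszar \<phi> (distr \<pi> borel fst) \<alpha> + csiszar \<phi> (distr \<pi> borel snd) \<beta>
        + ereal \<epsilon> * KL \<pi> (\<alpha> \<Otimes>\<^sub>M \<beta>)"

lemma OT_objective: "OT C \<phi> \<epsilon> \<alpha> \<beta> = (INF \<pi>\<in>pos_measures. objective C \<phi> \<epsilon> \<alpha> \<beta> \<pi>)"
  by (simp add: OT_def objective_def)

lemma objective_not_absolutely_continuous:
  assumes "\<epsilon> > 0" "\<not> absolutely_continuous (\<alpha> \<Otimes>\<^sub>M \<beta>) \<pi>"
  shows "objective C \<phi> \<epsilon> \<alpha> \<beta> \<pi> = \<infinity>"
  using assms by (simp add: objective_def KL_def)

text \<open>The nonnegative part of the objective, kept in \<open>ennreal\<close>. Only the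
  transport term is signed, and it is a real number, so the full objective never adds opposite
  infinities.\<close>

definition penalty ::
    "(real \<Rightarrow> ereal) \<Rightarrow> real \<Rightarrow> 'a::topological_space measure \<Rightarrow> 'a measure \<Rightarrow>
     ('a \<Rightarrow> real) \<Rightarrow> ('a \<Rightarrow> real) \<Rightarrow> ('a \<times> 'a \<Rightarrow> real) \<Rightarrow> ennreal" where
  "penalty \<phi> \<epsilon> \<alpha> \<beta> a b r = (\<integral>\<^sup>+x. ephi \<phi> (a x) \<partial>\<alpha>) + (\<integral>\<^sup>+y. ephi \<phi> (b y) \<partial>\<beta>)
      + ennreal \<epsilon> * (\<integral>\<^sup>+z. ennreal (kl (r z)) \<partial>(\<alpha> \<Otimes>\<^sub>M \<beta>))"

lemma objective_penalty:
  fixes \<alpha> \<beta> :: "'a::second_countable_topology measure"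
  assumes m: "\<alpha> \<in> pos_measures" "\<beta> \<in> pos_measures" and "\<epsilon> > 0"
    and a: "a \<in> borel_measurable borel" "\<And>x. 0 \<le> a x" "distr \<pi> borel fst = density \<alpha> (\<lambda>x. ennreal (a x))"
    and b: "b \<in> borel_measurable borel" "\<And>x. 0 \<le> b x" "distr \<pi> borel snd = density \<beta> (\<lambda>x. ennreal (b x))"
    and r: "r \<in> borel_measurable borel" "\<And>z. 0 \<le> r z" "integrable (\<alpha> \<Otimes>\<^sub>M \<beta>) r"
      "\<pi> = density (\<alpha> \<Otimes>\<^sub>M \<beta>) (\<lambda>z. ennreal (r z))"
  shows "objective C \<phi> \<epsilon> \<alpha> \<beta> \<pi> = ereal (\<integral>z. C (fst z) (snd z) \<partial>\<pi>) + enn2ereal (penalty \<phi> \<epsilon> \<alpha> \<beta> a b r)"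
proof -
  have "csiszar \<phi> (distr \<pi> borel fst) \<alpha> = enn2ereal (\<integral>\<^sup>+x. ephi \<phi> (a x) \<partial>\<alpha>)"
    using csiszar_density[OF m(1) a(1,2)] by (simp add: a(3) ephi_def)
  moreover have "csiszar \<phi> (distr \<pi> borel snd) \<beta> = enn2ereal (\<integral>\<^sup>+y. ephi \<phi> (b y) \<partial>\<beta>)"
    using csiszar_density[OF m(2) b(1,2)] by (simp add: b(3) ephi_def)
  moreover have "KL \<pi> (\<alpha> \<Otimes>\<^sub>M \<beta>) = enn2ereal (\<integral>\<^sup>+z. ennreal (kl (r z)) \<partial>(\<alpha> \<Otimes>\<^sub>M \<beta>))"
    unfolding r(4) by (rule KL_density[OF pair_measure_in_pos_measures[OF m] r(1-3)])
  ultimately show ?thesis using \<open>\<epsilon> > 0\<close>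
    by (simp add: objective_def penalty_def plus_ennreal.rep_eq times_ennreal.rep_eq add.assoc)
qed

lemma coupling_densities:
  fixes \<alpha> \<beta> :: "'a::second_countable_topology measure"
  assumes m: "\<alpha> \<in> pos_measures" "\<beta> \<in> pos_measures" "\<pi> \<in> pos_measures"
    and ac: "absolutely_continuous (\<alpha> \<Otimes>\<^sub>M \<beta>) \<pi>"
  obtains a b :: "'a \<Rightarrow> real" and r :: "'a \<times> 'a \<Rightarrow> real" where
    "a \<in> borel_measurable borel" "\<And>x. 0 \<le> a x" "integrable \<alpha> a" "distr \<pi> borel fst = density \<alpha> (\<lambda>x. ennreal (a x))"
    "b \<in> borel_measurable borel" "\<And>x. 0 \<le> b x" "integrable \<beta> b" "distr \<pi> borel snd = density \<beta> (\<lambda>x. ennreal (b x))"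
    "r \<in> borel_measurable borel" "\<And>z. 0 \<le> r z" "integrable (\<alpha> \<Otimes>\<^sub>M \<beta>) r"
      "\<pi> = density (\<alpha> \<Otimes>\<^sub>M \<beta>) (\<lambda>z. ennreal (r z))"
  using density_of_absolutely_continuous[OF marginals_in_pos_measures(1)[OF m(3)] m(1) marginals_absolutely_continuous(1)[OF m ac]]
    density_of_absolutely_continuous[OF marginals_in_pos_measures(2)[OF m(3)] m(2) marginals_absolutely_continuous(2)[OF m ac]]
    density_of_absolutely_continuous[OF m(3) pair_measure_in_pos_measures[OF m(1,2)] ac]
  by metis

text \<open>Weak duality. \<open>h1\<close> and \<open>h2\<close> stand in for minus the conjugate
  of \<phi> at -f and -g; any minorant will do, so the conjugate is never evaluated. Three affine
  minorants are integrated: those of \<phi> with slopes -f and -g, and the Young minorant of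
  \<open>kl\<close> with slope u.\<close>

lemma objective_ge:
  fixes \<alpha> \<beta> :: "'a::second_countable_topology measure"
  assumes m: "\<alpha> \<in> pos_measures" "\<beta> \<in> pos_measures" "\<pi> \<in> pos_measures" and e: "entropy_function \<phi>" "\<epsilon> > 0"
    and C: "(\<lambda>z. C (fst z) (snd z)) \<in> borel_measurable borel" "\<And>x y. \<bar>C x y\<bar> \<le> K"
    and f: "f \<in> borel_measurable borel" "\<And>x. \<bar>f x\<bar> \<le> F"
    and g: "g \<in> borel_measurable borel" "\<And>x. \<bar>g x\<bar> \<le> G"
    and h1: "h1 \<in> borel_measurable borel" "\<And>x. \<bar>h1 x\<bar> \<le> H1"
    and h2: "h2 \<in> borel_measurable borel" "\<And>x. \<bar>h2 x\<bar> \<le> H2"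
    and le1: "\<And>x p. 0 \<le> p \<Longrightarrow> ereal (h1 x - f x * p) \<le> \<phi> p"
    and le2: "\<And>x p. 0 \<le> p \<Longrightarrow> ereal (h2 x - g x * p) \<le> \<phi> p"
  shows "ereal ((\<integral>x. h1 x \<partial>\<alpha>) + (\<integral>y. h2 y \<partial>\<beta>)
      + \<epsilon> * (\<integral>z. 1 - exp ((f (fst z) + g (snd z) - C (fst z) (snd z)) / \<epsilon>) \<partial>(\<alpha> \<Otimes>\<^sub>M \<beta>)))
    \<le> objective C \<phi> \<epsilon> \<alpha> \<beta> \<pi>"
proof (cases "absolutely_continuous (\<alpha> \<Otimes>\<^sub>M \<beta>) \<pi>")
  case True
  obtain a b r where
    a: "a \<in> borel_measurable borel" "\<And>x. 0 \<le> a x" "integrable \<alpha> a" "distr \<pi> borel fst = density \<alpha> (\<lambda>x. ennreal (a x))"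
    and b: "b \<in> borel_measurable borel" "\<And>x. 0 \<le> b x" "integrable \<beta> b" "distr \<pi> borel snd = density \<beta> (\<lambda>x. ennreal (b x))"
    and r: "r \<in> borel_measurable borel" "\<And>z. 0 \<le> r z" "integrable (\<alpha> \<Otimes>\<^sub>M \<beta>) r"
      "\<pi> = density (\<alpha> \<Otimes>\<^sub>M \<beta>) (\<lambda>z. ennreal (r z))"
    using coupling_densities[OF m True] by metis
  note [measurable] = C(1) f(1) g(1)
  define u where "u z = (f (fst z) + g (snd z) - C (fst z) (snd z)) / \<epsilon>" for z
  have u [measurable]: "u \<in> borel_measurable borel" unfolding u_def[abs_def] by measurable
  have ub: "\<bar>u z\<bar> \<le> (F + G + K) / \<epsilon>" for z
  proof -
    have "\<bar>f (fst z) + g (snd z) - C (fst z) (snd z)\<bar> \<le> F + G + K"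
      using f(2)[of "fst z"] g(2)[of "snd z"] C(2)[of "fst z" "snd z"] by linarith
    then show ?thesis using e by (simp add: u_def divide_right_mono abs_divide)
  qed
  let ?K = "\<integral>\<^sup>+z. ennreal (kl (r z)) \<partial>(\<alpha> \<Otimes>\<^sub>M \<beta>)"
  have A: "ereal ((\<integral>x. h1 x \<partial>\<alpha>) + (\<integral>x. - f x \<partial>distr \<pi> borel fst)) \<le> enn2ereal (\<integral>\<^sup>+x. ephi \<phi> (a x) \<partial>\<alpha>)"
    unfolding a(4) using f a(2) le1
    by (intro nn_integral_ge_affine[OF m(1) a(1-3) h1, where Q=F]) (auto simp: enn2ereal_ephi[OF e(1)])
  have B: "ereal ((\<integral>x. h2 x \<partial>\<beta>) + (\<integral>x. - g x \<partial>distr \<pi> borel snd)) \<le> enn2ereal (\<integral>\<^sup>+x. ephi \<phi> (b x) \<partial>\<beta>)"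
    unfolding b(4) using g b(2) le2
    by (intro nn_integral_ge_affine[OF m(2) b(1-3) h2, where Q=G]) (auto simp: enn2ereal_ephi[OF e(1)])
  have D: "ereal ((\<integral>z. 1 - exp (u z) \<partial>(\<alpha> \<Otimes>\<^sub>M \<beta>)) + (\<integral>z. u z \<partial>\<pi>)) \<le> enn2ereal ?K"
    unfolding r(4)
  proof (rule nn_integral_ge_affine[OF pair_measure_in_pos_measures[OF m(1,2)] r(1-3) _ _ u ub])
    show "\<bar>1 - exp (u z)\<bar> \<le> 1 + exp ((F + G + K) / \<epsilon>)" for z using ub[of z]
      by (smt (verit) exp_gt_zero exp_le_cancel_iff)
    show "ereal (1 - exp (u x) + u x * r x) \<le> enn2ereal (ennreal (kl (r x)))" for x
      using kl_Young[OF r(2), of x "u x"] kl_nonneg[OF r(2), of x] by (simp add: mult.commute)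
  qed measurable
  note [measurable_cong] = pos_measuresD(1)[OF m(3)]
  have i1: "(\<integral>x. f x \<partial>distr \<pi> borel fst) = (\<integral>z. f (fst z) \<partial>\<pi>)"
    by (subst integral_distr) auto
  have i2: "(\<integral>x. g x \<partial>distr \<pi> borel snd) = (\<integral>z. g (snd z) \<partial>\<pi>)"
    by (subst integral_distr) auto
  have i: "integrable \<pi> (\<lambda>z. f (fst z))" "integrable \<pi> (\<lambda>z. g (snd z))" "integrable \<pi> (\<lambda>z. C (fst z) (snd z))"
    using f g C by (auto intro!: integrable_bounded[OF m(3)])
  then have "\<epsilon> * (\<integral>z. u z \<partial>\<pi>) = (\<integral>z. f (fst z) \<partial>\<pi>) + (\<integral>z. g (snd z) \<partial>\<pi>) - (\<integral>z. C (fst z) (snd z) \<partial>\<pi>)"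
    using e(2) by (simp add: u_def)
  \<comment> \<open>Because \<epsilon> u = f + g - C, all integrals against the plan cancel and the
    bound no longer depends on \<pi>.\<close>
  then have "(\<integral>x. h1 x \<partial>\<alpha>) + (\<integral>y. h2 y \<partial>\<beta>) + \<epsilon> * (\<integral>z. 1 - exp (u z) \<partial>(\<alpha> \<Otimes>\<^sub>M \<beta>))
    = (\<integral>z. C (fst z) (snd z) \<partial>\<pi>) + ((\<integral>x. h1 x \<partial>\<alpha>) + (\<integral>x. - f x \<partial>distr \<pi> borel fst))
     + ((\<integral>x. h2 x \<partial>\<beta>) + (\<integral>x. - g x \<partial>distr \<pi> borel snd))
     + \<epsilon> * ((\<integral>z. 1 - exp (u z) \<partial>(\<alpha> \<Otimes>\<^sub>M \<beta>)) + (\<integral>z. u z \<partial>\<pi>))"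
    by (simp add: i1 i2 distrib_left)
  also have "ereal \<dots> \<le> ereal (\<integral>z. C (fst z) (snd z) \<partial>\<pi>) + (enn2ereal (\<integral>\<^sup>+x. ephi \<phi> (a x) \<partial>\<alpha>)
      + enn2ereal (\<integral>\<^sup>+x. ephi \<phi> (b x) \<partial>\<beta>) + ereal \<epsilon> * enn2ereal ?K)"
  proof -
    have *: "ereal (c + x + y + \<epsilon> * z) \<le> ereal c + (X + Y + ereal \<epsilon> * Z)"
      if "ereal x \<le> X" "ereal y \<le> Y" "ereal z \<le> Z" for c x y z :: real and X Y Z
      using that e(2) add_mono[OF that(1,2)] add_mono[OF add_mono[OF that(1,2)] ereal_mult_left_mono[OF that(3), of "ereal \<epsilon>"]]
        add_left_mono[of "ereal x + ereal y + ereal \<epsilon> * ereal z" _ "ereal c"] by (simp add: add.assoc)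
    show ?thesis by (rule *[OF A B D])
  qed
  also have "\<dots> = objective C \<phi> \<epsilon> \<alpha> \<beta> \<pi>"
    using e by (simp add: objective_penalty[OF m(1,2) e(2) a(1,2,4) b(1,2,4) r] penalty_def
        plus_ennreal.rep_eq times_ennreal.rep_eq)
  finally show ?thesis by (simp add: u_def)
qed (simp add: objective_not_absolutely_continuous e)

text \<open>Marginals of a mixed plan are mixed marginals, so \<open>mix_density\<close> handles all
  three penalties, and the transport term is linear in the plan. The hypothesis \<open>lin\<close>
  isolates the one point where both arguments cannot be mixed freely.\<close>

lemma objective_mix:
  fixes \<alpha>0 \<alpha>1 \<beta>0 \<beta>1 :: "'a::second_countable_topology measure"
  assumes m: "\<alpha>0 \<in> pos_measures" "\<alpha>1 \<in> pos_measures" "\<beta>0 \<in> pos_measures" "\<beta>1 \<in> pos_measures"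
    and p: "\<pi>0 \<in> pos_measures" "\<pi>1 \<in> pos_measures" and t: "0 < t" "t < 1"
    and e: "entropy_function \<phi>" "\<epsilon> > 0"
    and C: "(\<lambda>z. C (fst z) (snd z)) \<in> borel_measurable borel" "\<And>x y. \<bar>C x y\<bar> \<le> K"
    and lin: "mix_measure t \<alpha>0 \<alpha>1 \<Otimes>\<^sub>M mix_measure t \<beta>0 \<beta>1 = mix_measure t (\<alpha>0 \<Otimes>\<^sub>M \<beta>0) (\<alpha>1 \<Otimes>\<^sub>M \<beta>1)"
  shows "objective C \<phi> \<epsilon> (mix_measure t \<alpha>0 \<alpha>1) (mix_measure t \<beta>0 \<beta>1) (mix_measure t \<pi>0 \<pi>1)
    \<le> ereal (1 - t) * objective C \<phi> \<epsilon> \<alpha>0 \<beta>0 \<pi>0 + ereal t * objective C \<phi> \<epsilon> \<alpha>1 \<beta>1 \<pi>1"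
proof (cases "absolutely_continuous (\<alpha>0 \<Otimes>\<^sub>M \<beta>0) \<pi>0 \<and> absolutely_continuous (\<alpha>1 \<Otimes>\<^sub>M \<beta>1) \<pi>1")
  case False
  then have "objective C \<phi> \<epsilon> \<alpha>0 \<beta>0 \<pi>0 = \<infinity> \<or> objective C \<phi> \<epsilon> \<alpha>1 \<beta>1 \<pi>1 = \<infinity>"
    using objective_not_absolutely_continuous[OF e(2)] by blast
  then show ?thesis using t by auto
next
  case True
  let ?\<alpha> = "mix_measure t \<alpha>0 \<alpha>1" and ?\<beta> = "mix_measure t \<beta>0 \<beta>1" and ?\<pi> = "mix_measure t \<pi>0 \<pi>1"
  obtain a0 b0 r0 where
    a0: "a0 \<in> borel_measurable borel" "\<And>x. 0 \<le> a0 x" "integrable \<alpha>0 a0" "distr \<pi>0 borel fst = density \<alpha>0 (\<lambda>x. ennreal (a0 x))"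
    and b0: "b0 \<in> borel_measurable borel" "\<And>x. 0 \<le> b0 x" "integrable \<beta>0 b0" "distr \<pi>0 borel snd = density \<beta>0 (\<lambda>x. ennreal (b0 x))"
    and r0: "r0 \<in> borel_measurable borel" "\<And>z. 0 \<le> r0 z" "integrable (\<alpha>0 \<Otimes>\<^sub>M \<beta>0) r0"
      "\<pi>0 = density (\<alpha>0 \<Otimes>\<^sub>M \<beta>0) (\<lambda>z. ennreal (r0 z))"
    using coupling_densities[OF m(1,3) p(1)] True by metis
  obtain a1 b1 r1 where
    a1: "a1 \<in> borel_measurable borel" "\<And>x. 0 \<le> a1 x" "integrable \<alpha>1 a1" "distr \<pi>1 borel fst = density \<alpha>1 (\<lambda>x. ennreal (a1 x))"
    and b1: "b1 \<in> borel_measurable borel" "\<And>x. 0 \<le> b1 x" "integrable \<beta>1 b1" "distr \<pi>1 borel snd = density \<beta>1 (\<lambda>x. ennreal (b1 x))"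
    and r1: "r1 \<in> borel_measurable borel" "\<And>z. 0 \<le> r1 z" "integrable (\<alpha>1 \<Otimes>\<^sub>M \<beta>1) r1"
      "\<pi>1 = density (\<alpha>1 \<Otimes>\<^sub>M \<beta>1) (\<lambda>z. ennreal (r1 z))"
    using coupling_densities[OF m(2,4) p(2)] True by metis
  let ?cv = "\<lambda>\<psi> :: real \<Rightarrow> ennreal. \<forall>x y s u. 0 \<le> x \<longrightarrow> 0 \<le> y \<longrightarrow> 0 \<le> s \<longrightarrow> 0 \<le> u \<longrightarrow> s + u = 1 \<longrightarrow>
          \<psi> (s * x + u * y) \<le> ennreal s * \<psi> x + ennreal u * \<psi> y"
  have cphi: "?cv (ephi \<phi>)" using ephi_convex[OF e(1)] by blast
  define \<kappa> where "\<kappa> r = ennreal (kl r)" for r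
  have ckl: "?cv \<kappa>" unfolding \<kappa>_def
  proof (intro allI impI)
    fix x y s u :: real assume h: "0 \<le> x" "0 \<le> y" "0 \<le> s" "0 \<le> u" "s + u = 1"
    then show "ennreal (kl (s * x + u * y)) \<le> ennreal s * ennreal (kl x) + ennreal u * ennreal (kl y)"
      using kl_convex[OF h] kl_nonneg[of x] kl_nonneg[of y]
      by (simp add: ennreal_mult'[symmetric] ennreal_plus[symmetric] ennreal_leI del: ennreal_plus)
  qed
  obtain a where a: "a \<in> borel_measurable borel" "\<And>x. 0 \<le> a x"
      "mix_measure t (distr \<pi>0 borel fst) (distr \<pi>1 borel fst) = density ?\<alpha> (\<lambda>x. ennreal (a x))"
    and ac: "(\<integral>\<^sup>+x. ephi \<phi> (a x) \<partial>?\<alpha>) \<le>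
         ennreal (1 - t) * (\<integral>\<^sup>+x. ephi \<phi> (a0 x) \<partial>\<alpha>0) + ennreal t * (\<integral>\<^sup>+x. ephi \<phi> (a1 x) \<partial>\<alpha>1)"
    unfolding a0(4) a1(4)
    using mix_density[OF m(1,2) t a0(1-3) a1(1-3)] cphi ephi_measurable[OF e(1)] by metis
  obtain b where b: "b \<in> borel_measurable borel" "\<And>x. 0 \<le> b x"
      "mix_measure t (distr \<pi>0 borel snd) (distr \<pi>1 borel snd) = density ?\<beta> (\<lambda>x. ennreal (b x))"
    and bc: "(\<integral>\<^sup>+x. ephi \<phi> (b x) \<partial>?\<beta>) \<le>
         ennreal (1 - t) * (\<integral>\<^sup>+x. ephi \<phi> (b0 x) \<partial>\<beta>0) + ennreal t * (\<integral>\<^sup>+x. ephi \<phi> (b1 x) \<partial>\<beta>1)"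
    unfolding b0(4) b1(4)
    using mix_density[OF m(3,4) t b0(1-3) b1(1-3)] cphi ephi_measurable[OF e(1)] by metis
  have klm: "\<kappa> \<in> borel_measurable borel" unfolding \<kappa>_def[abs_def] by measurable
  obtain r where r: "r \<in> borel_measurable borel" "\<And>x. 0 \<le> r x"
      "integrable (?\<alpha> \<Otimes>\<^sub>M ?\<beta>) r"
      "?\<pi> = density (?\<alpha> \<Otimes>\<^sub>M ?\<beta>) (\<lambda>x. ennreal (r x))"
    and rc: "(\<integral>\<^sup>+x. ennreal (kl (r x)) \<partial>(?\<alpha> \<Otimes>\<^sub>M ?\<beta>)) \<le>
         ennreal (1 - t) * (\<integral>\<^sup>+x. ennreal (kl (r0 x)) \<partial>(\<alpha>0 \<Otimes>\<^sub>M \<beta>0)) + ennreal t * (\<integral>\<^sup>+x. ennreal (kl (r1 x)) \<partial>(\<alpha>1 \<Otimes>\<^sub>M \<beta>1))"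
    unfolding r0(4) r1(4) lin \<kappa>_def[symmetric]
    using mix_density[OF pair_measure_in_pos_measures[OF m(1,3)] pair_measure_in_pos_measures[OF m(2,4)] t r0(1-3) r1(1-3)]
      ckl klm by metis
  note q = pos_measuresD(1)[OF p(1)] pos_measuresD(1)[OF p(2)]
  note [measurable_cong] = q
  have mf: "distr ?\<pi> borel fst = density ?\<alpha> (\<lambda>x. ennreal (a x))"
    using q by (subst distr_mix_measure) (auto simp: a(3))
  have ms: "distr ?\<pi> borel snd = density ?\<beta> (\<lambda>x. ennreal (b x))"
    using q by (subst distr_mix_measure) (auto simp: b(3))
  define S where "S = penalty \<phi> \<epsilon> ?\<alpha> ?\<beta> a b r"
  define S0 where "S0 = penalty \<phi> \<epsilon> \<alpha>0 \<beta>0 a0 b0 r0"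
  define S1 where "S1 = penalty \<phi> \<epsilon> \<alpha>1 \<beta>1 a1 b1 r1"
  have "S \<le> ennreal (1 - t) * (\<integral>\<^sup>+x. ephi \<phi> (a0 x) \<partial>\<alpha>0) + ennreal t * (\<integral>\<^sup>+x. ephi \<phi> (a1 x) \<partial>\<alpha>1)
     + (ennreal (1 - t) * (\<integral>\<^sup>+x. ephi \<phi> (b0 x) \<partial>\<beta>0) + ennreal t * (\<integral>\<^sup>+x. ephi \<phi> (b1 x) \<partial>\<beta>1))
     + ennreal \<epsilon> * (ennreal (1 - t) * (\<integral>\<^sup>+x. ennreal (kl (r0 x)) \<partial>(\<alpha>0 \<Otimes>\<^sub>M \<beta>0)) + ennreal t * (\<integral>\<^sup>+x. ennreal (kl (r1 x)) \<partial>(\<alpha>1 \<Otimes>\<^sub>M \<beta>1)))"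
    unfolding S_def penalty_def by (intro add_mono ac bc rc mult_left_mono) auto
  also have "\<dots> = ennreal (1 - t) * S0 + ennreal t * S1"
    unfolding S0_def S1_def penalty_def by (simp add: distrib_left ac_simps)
  finally have "enn2ereal S \<le> ereal (1 - t) * enn2ereal S0 + ereal t * enn2ereal S1"
    using t by (simp add: less_eq_ennreal.rep_eq plus_ennreal.rep_eq times_ennreal.rep_eq)
  moreover have "(\<integral>z. C (fst z) (snd z) \<partial>?\<pi>) =
      (1 - t) * (\<integral>z. C (fst z) (snd z) \<partial>\<pi>0) + t * (\<integral>z. C (fst z) (snd z) \<partial>\<pi>1)"
    using t C by (intro integral_mix_measure[OF p]) auto
  moreover have "objective C \<phi> \<epsilon> ?\<alpha> ?\<beta> ?\<pi> =
      ereal (\<integral>z. C (fst z) (snd z) \<partial>?\<pi>) + enn2ereal S"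
    unfolding S_def using m by (intro objective_penalty[OF _ _ e(2) a(1,2) mf b(1,2) ms r] mix_measure_in_pos_measures)
  moreover have "objective C \<phi> \<epsilon> \<alpha>0 \<beta>0 \<pi>0 = ereal (\<integral>z. C (fst z) (snd z) \<partial>\<pi>0) + enn2ereal S0"
    unfolding S0_def by (rule objective_penalty[OF m(1,3) e(2) a0(1,2,4) b0(1,2,4) r0])
  moreover have "objective C \<phi> \<epsilon> \<alpha>1 \<beta>1 \<pi>1 = ereal (\<integral>z. C (fst z) (snd z) \<partial>\<pi>1) + enn2ereal S1"
    unfolding S1_def by (rule objective_penalty[OF m(2,4) e(2) a1(1,2,4) b1(1,2,4) r1])
  ultimately show ?thesis using t
    by (cases "enn2ereal S"; cases "enn2ereal S0"; cases "enn2ereal S1") (auto simp: algebra_simps)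
qed

section \<open>Convexity in each argument and failure of joint convexity\<close>

lemma cost_bounded:
  fixes C :: "'a::compact_metric_space \<Rightarrow> 'a \<Rightarrow> real"
  assumes "continuous_on UNIV (\<lambda>z. C (fst z) (snd z))"
  obtains K where "0 \<le> K" "\<And>x y. \<bar>C x y\<bar> \<le> K"
proof -
  have "compact (UNIV :: ('a \<times> 'a) set)"
    using compact_Times[OF compact_UNIV compact_UNIV] by simp
  then have "bounded (range (\<lambda>z. C (fst z) (snd z)))"
    using assms by (intro compact_imp_bounded compact_continuous_image)
  then obtain K where K: "\<And>z. \<bar>C (fst z) (snd z)\<bar> \<le> K" by (auto simp: bounded_iff)
  have "\<bar>C x y\<bar> \<le> K" for x y using K[of "(x, y)"] by simp
  then show ?thesis using that[of K] by (meson abs_ge_zero order_trans)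
qed

text \<open>The finite bounds \<open>L\<close> and \<open>L'\<close> exclude the value -\<infinity>.
  Then either some infimum is \<infinity> and the right side is infinite, or both are real and
  near-minimisers can be combined.\<close>

lemma le_INF_combination:
  fixes f :: "'b \<Rightarrow> ereal" and g :: "'c \<Rightarrow> ereal" and s u L L' :: real
  assumes su: "0 < s" "0 < u" and L: "\<And>a. a \<in> A \<Longrightarrow> ereal L \<le> f a" "\<And>b. b \<in> B \<Longrightarrow> ereal L' \<le> g b"
    and le: "\<And>a b. a \<in> A \<Longrightarrow> b \<in> B \<Longrightarrow> X \<le> ereal s * f a + ereal u * g b"
  shows "X \<le> ereal s * (INF a\<in>A. f a) + ereal u * (INF b\<in>B. g b)"
proof -
  have L': "ereal L \<le> (INF a\<in>A. f a)" "ereal L' \<le> (INF b\<in>B. g b)" using L by (auto intro: INF_greatest)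
  show ?thesis
  proof (cases "(INF a\<in>A. f a) = \<infinity> \<or> (INF b\<in>B. g b) = \<infinity>")
    case True then show ?thesis using su L' by auto
  next
    case False
    then obtain F G where F: "(INF a\<in>A. f a) = ereal F" and G: "(INF b\<in>B. g b) = ereal G"
      using L' by (cases "INF a\<in>A. f a"; cases "INF b\<in>B. g b") auto
    show ?thesis
    proof (rule ereal_le_epsilon2)
      fix e :: real assume e: "0 < e"
      define d where "d = e / (s + u)"
      have d: "d > 0" using e su by (simp add: d_def)
      have "(INF a\<in>A. f a) < ereal (F + d)" "(INF b\<in>B. g b) < ereal (G + d)" using F G d by auto
      then obtain a b where ab: "a \<in> A" "f a < ereal (F + d)" "b \<in> B" "g b < ereal (G + d)"
        unfolding INF_less_iff by blast
      have "X \<le> ereal s * f a + ereal u * g b" by (rule le[OF ab(1,3)])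
      also have "\<dots> \<le> ereal s * ereal (F + d) + ereal u * ereal (G + d)"
        using su ab by (intro add_mono ereal_mult_left_mono) auto
      also have "\<dots> = ereal s * ereal F + ereal u * ereal G + ereal ((s + u) * d)" by (simp add: algebra_simps)
      also have "(s + u) * d = e" using su by (simp add: d_def)
      finally show "X \<le> ereal s * (INF a\<in>A. f a) + ereal u * (INF b\<in>B. g b) + ereal e" by (simp add: F G)
    qed
  qed
qed

lemma OT_mix:
  fixes \<alpha>0 \<alpha>1 \<beta>0 \<beta>1 :: "'a::second_countable_topology measure"
  assumes m: "\<alpha>0 \<in> pos_measures" "\<alpha>1 \<in> pos_measures" "\<beta>0 \<in> pos_measures" "\<beta>1 \<in> pos_measures"
    and t: "t \<in> {0..1}"
    and e: "entropy_function \<phi>" "\<epsilon> > 0"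
    and C: "(\<lambda>z. C (fst z) (snd z)) \<in> borel_measurable borel" "\<And>x y. \<bar>C x y\<bar> \<le> K"
    and lin: "mix_measure t \<alpha>0 \<alpha>1 \<Otimes>\<^sub>M mix_measure t \<beta>0 \<beta>1 = mix_measure t (\<alpha>0 \<Otimes>\<^sub>M \<beta>0) (\<alpha>1 \<Otimes>\<^sub>M \<beta>1)"
  shows "OT C \<phi> \<epsilon> (mix_measure t \<alpha>0 \<alpha>1) (mix_measure t \<beta>0 \<beta>1)
    \<le> ereal (1 - t) * OT C \<phi> \<epsilon> \<alpha>0 \<beta>0 + ereal t * OT C \<phi> \<epsilon> \<alpha>1 \<beta>1"
proof -
  have s: "sets \<alpha>1 = sets \<alpha>0" "sets \<beta>1 = sets \<beta>0" using m[THEN pos_measuresD(1)] by auto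
  consider "t = 0" | "t = 1" | "0 < t" "t < 1" using t by fastforce
  then show ?thesis
  proof cases
    case 1 then show ?thesis using s by (simp add: mix_measure_0 zero_ereal_def[symmetric] one_ereal_def[symmetric])
  next
    case 2 then show ?thesis using s by (simp add: mix_measure_1 zero_ereal_def[symmetric] one_ereal_def[symmetric])
  next
    case 3
    \<comment> \<open>Weak duality with zero potentials bounds every objective from below by a
      finite number, since \<phi> is nonnegative.\<close>
    have L: "ereal (\<epsilon> * (\<integral>z. 1 - exp (- C (fst z) (snd z) / \<epsilon>) \<partial>(\<alpha> \<Otimes>\<^sub>M \<beta>))) \<le> objective C \<phi> \<epsilon> \<alpha> \<beta> \<pi>"
      if "\<alpha> \<in> pos_measures" "\<beta> \<in> pos_measures" "\<pi> \<in> pos_measures" for \<alpha> \<beta> \<pi>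
      using objective_ge[OF that e C, of "\<lambda>_. 0" 0 "\<lambda>_. 0" 0 "\<lambda>_. 0" 0 "\<lambda>_. 0" 0] entropy_functionD(2)[OF e(1)]
      by (simp add: zero_ereal_def[symmetric])
    show ?thesis unfolding OT_objective
    proof (rule le_INF_combination)
      fix \<pi>0 \<pi>1 :: "('a \<times> 'a) measure" assume p: "\<pi>0 \<in> pos_measures" "\<pi>1 \<in> pos_measures"
      have "(INF \<pi>\<in>pos_measures. objective C \<phi> \<epsilon> (mix_measure t \<alpha>0 \<alpha>1) (mix_measure t \<beta>0 \<beta>1) \<pi>)
        \<le> objective C \<phi> \<epsilon> (mix_measure t \<alpha>0 \<alpha>1) (mix_measure t \<beta>0 \<beta>1) (mix_measure t \<pi>0 \<pi>1)"
        by (intro INF_lower mix_measure_in_pos_measures p)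
      also have "\<dots> \<le> ereal (1 - t) * objective C \<phi> \<epsilon> \<alpha>0 \<beta>0 \<pi>0 + ereal t * objective C \<phi> \<epsilon> \<alpha>1 \<beta>1 \<pi>1"
        by (rule objective_mix[OF m p 3 e C lin])
      finally show "(INF \<pi>\<in>pos_measures. objective C \<phi> \<epsilon> (mix_measure t \<alpha>0 \<alpha>1) (mix_measure t \<beta>0 \<beta>1) \<pi>)
        \<le> ereal (1 - t) * objective C \<phi> \<epsilon> \<alpha>0 \<beta>0 \<pi>0 + ereal t * objective C \<phi> \<epsilon> \<alpha>1 \<beta>1 \<pi>1" .
    qed (use 3 L m in auto)
  qed
qed

section \<open>The two-variable problem behind Dirac masses\<close>

text \<open>As a tends to 0, a kl(r / a) explodes at every r away from 0 and outweighs the signed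
  term c r. Only r near 0 can compete, and there lower semicontinuity of \<phi> keeps the value
  close to K \<phi>(0) or above.\<close>

lemma penalised_liminf_at_0:
  assumes e: "entropy_function \<phi>" "\<epsilon> > 0" and K: "(K::real) > 0" and M: "ereal M < ereal K * \<phi> 0"
  obtains a0 where "a0 > 0"
    "\<And>a r v. 0 < a \<Longrightarrow> a \<le> a0 \<Longrightarrow> 0 \<le> r \<Longrightarrow> \<phi> r = ereal v \<Longrightarrow> M \<le> c * r + K * v + \<epsilon> * (a * kl (r / a))"
proof -
  obtain M' where M': "ereal M < ereal M'" "ereal M' < ereal K * \<phi> 0" using M ereal_dense2 by blast
  have "ereal (M' / K) < \<phi> 0" using M'(2) K by (cases "\<phi> 0") (auto simp: field_simps)
  from entropy_function_eventually_greater[OF e(1) this] obtain \<eta>0 where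
    \<eta>0: "\<eta>0 > 0" "\<And>r. \<bar>r\<bar> < \<eta>0 \<Longrightarrow> ereal (M' / K) < \<phi> r"
    unfolding eventually_nhds_metric by (auto simp: dist_real_def)
  \<comment> \<open>Below \<eta>, \<phi> stays above M' / K, and the term c r costs at most M' -
    M.\<close>
  define \<eta> where "\<eta> = min (\<eta>0 / 2) ((M' - M) / (\<bar>c\<bar> + 1))"
  have MM: "M' - M > 0" using M' by simp
  have "\<eta> > 0" using \<eta>0(1) MM by (simp add: \<eta>_def)
  moreover have "\<eta> \<le> \<eta>0 / 2" unfolding \<eta>_def by (rule min.cobounded1)
  ultimately have \<eta>: "\<eta> > 0" "\<eta> < \<eta>0" using \<eta>0(1) by linarith+
  have "\<eta> \<le> (M' - M) / (\<bar>c\<bar> + 1)" by (simp add: \<eta>_def)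
  then have "(\<bar>c\<bar> + 1) * \<eta> \<le> M' - M" by (simp add: field_simps)
  then have c\<eta>: "\<bar>c\<bar> * \<eta> \<le> M' - M" using \<eta> by (simp add: algebra_simps)
  \<comment> \<open>As a slope in \<open>kl_Young\<close>, \<open>u\<close> pays for |c| r and, once
    r \<ge> \<eta>, for |M| + 1 as well. The choice of \<open>a0\<close> keeps the loss \<epsilon> a
    exp u at most 1.\<close>
  define u where "u = (\<bar>c\<bar> + (\<bar>M\<bar> + 1) / \<eta>) / \<epsilon>"
  define a0 where "a0 = 1 / (\<epsilon> * exp u)"
  show thesis
  proof (rule that[of a0])
    show "a0 > 0" using e by (simp add: a0_def)
    fix a r v assume a: "0 < a" "a \<le> a0" and r: "0 \<le> r" and v: "\<phi> r = ereal v"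
    show "M \<le> c * r + K * v + \<epsilon> * (a * kl (r / a))"
    proof (cases "r < \<eta>")
      case True
      then have "ereal (M' / K) < \<phi> r" using \<eta> r by (intro \<eta>0) auto
      then have "M' \<le> K * v" using K v by (simp add: field_simps)
      moreover have "\<bar>c * r\<bar> \<le> \<bar>c\<bar> * \<eta>" using True r by (simp add: abs_mult mult_left_mono)
      moreover have "0 \<le> \<epsilon> * (a * kl (r / a))" using e a r kl_nonneg[of "r / a"] by simp
      ultimately show ?thesis using c\<eta> by linarith
    next
      case False
      have "r * u + a * (1 - exp u) = a * (r / a * u + 1 - exp u)" using a by (simp add: field_simps)
      also have "\<dots> \<le> a * kl (r / a)" using a r by (intro mult_left_mono kl_Young) auto
      finally have le: "\<epsilon> * (r * u + a * (1 - exp u)) \<le> \<epsilon> * (a * kl (r / a))" using e by simp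
      have "\<epsilon> * (r * u + a * (1 - exp u)) = r * \<bar>c\<bar> + r / \<eta> * (\<bar>M\<bar> + 1) + \<epsilon> * a - \<epsilon> * exp u * a"
        using e \<eta> by (simp add: u_def field_simps)
      then have "r * \<bar>c\<bar> + r / \<eta> * (\<bar>M\<bar> + 1) + \<epsilon> * a - \<epsilon> * exp u * a \<le> \<epsilon> * (a * kl (r / a))"
        using le by simp
      moreover have "\<epsilon> * exp u * a \<le> 1" using a(2) e by (simp add: a0_def field_simps)
      moreover have "1 * (\<bar>M\<bar> + 1) \<le> r / \<eta> * (\<bar>M\<bar> + 1)" using False \<eta> by (intro mult_right_mono) auto
      moreover have "- (c * r) \<le> r * \<bar>c\<bar>" using r by (metis abs_ge_minus_self mult.commute mult_left_mono mult_minus_left)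
      moreover have "0 \<le> K * v" using entropy_functionD(2)[OF e(1), of r] v K by simp
      moreover have "0 \<le> \<epsilon> * a" using e a by simp
      moreover have "M \<le> \<bar>M\<bar>" by (rule abs_ge_self)
      ultimately show ?thesis by argo
    qed
  qed
qed

lemma entropy_function_cases:
  assumes "entropy_function \<phi>" obtains "\<phi> x = \<infinity>" | v where "\<phi> x = ereal v" "0 \<le> v"
  using entropy_functionD(2)[OF assms, of x] by (cases "\<phi> x") auto

text \<open>
  The function \<open>f\<close> is the transport cost between two Dirac masses at a fixed pair of
  points with cost \<open>c\<close>.  Convexity on the ray through \<open>(1, 1)\<close> bounds the slope of \<open>\<phi>\<close> at \<open>0\<close>
  from below.  The boundary derivative of \<open>f\<close> in its second argument at \<open>b = 0\<close> is
  \<open>D a = inf\<^sub>\<sigma> (\<kappa> \<sigma> + \<phi> \<sigma> + \<epsilon> a kl (\<sigma> / a))\<close>; as \<open>f\<close> is linear on \<open>b = 0\<close>, joint convexity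
  forces \<open>D\<close> to be constant, which only happens for \<open>\<phi> = 0\<close> and \<open>c = 0\<close>.
\<close>

lemma dirac_cost_convex_imp_trivial:
  fixes f :: "real \<Rightarrow> real \<Rightarrow> ereal"
  assumes e: "entropy_function \<phi>" "\<epsilon> > 0"
    and le: "\<And>a b p u v. 0 < a \<Longrightarrow> 0 < b \<Longrightarrow> 0 \<le> p \<Longrightarrow> \<phi> (p / a) = ereal u \<Longrightarrow> \<phi> (p / b) = ereal v \<Longrightarrow>
      f a b \<le> ereal (c * p + a * u + b * v + \<epsilon> * (a * b * kl (p / (a * b))))"
    and ge: "\<And>a b M. 0 < a \<Longrightarrow> 0 < b \<Longrightarrow> (\<And>p u v. 0 \<le> p \<Longrightarrow> \<phi> (p / a) = ereal u \<Longrightarrow> \<phi> (p / b) = ereal v \<Longrightarrow>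
      M \<le> c * p + a * u + b * v + \<epsilon> * (a * b * kl (p / (a * b)))) \<Longrightarrow> ereal M \<le> f a b"
    and f00: "f 0 0 = 0" and fa0: "\<And>a v. 0 \<le> a \<Longrightarrow> \<phi> 0 = ereal v \<Longrightarrow> f a 0 = ereal (a * v)"
    and cv: "\<And>a b a' b' t. 0 \<le> a \<Longrightarrow> 0 \<le> b \<Longrightarrow> 0 \<le> a' \<Longrightarrow> 0 \<le> b' \<Longrightarrow> 0 < t \<Longrightarrow> t < 1 \<Longrightarrow>
      f ((1 - t) * a + t * a') ((1 - t) * b + t * b') \<le> ereal (1 - t) * f a b + ereal t * f a' b'"
  shows "c = 0 \<and> (\<forall>p\<ge>0. \<phi> p = 0)"
proof -
  have kl1: "kl 1 = 0" "kl 0 = 1" by (simp_all add: kl_def)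
  \<comment> \<open>Convexity between (0, 0) and (r, r) bounds f(a, a) / a by f(r, r) / r. A plan of
    mass p at (a, a) has the value a (c q + 2 \<phi>(q) + \<epsilon> a kl(q / a)) with q = p / a, so
    by \<open>penalised_liminf_at_0\<close> with K = 2 the left quotient comes as close to 2
    \<phi>(0) as desired, or exceeds it, for small a. At r = 1 this also shows that \<phi>(0) is
    finite.\<close>
  have slope: "ereal 2 * \<phi> 0 \<le> ereal (c * r + 2 * v)" if r: "0 \<le> r" "\<phi> r = ereal v" for r v
  proof (rule ccontr)
    assume neg: "\<not> ?thesis"
    then have "ereal (c * r + 2 * v) < ereal 2 * \<phi> 0" by simp
    then obtain M where M: "c * r + 2 * v < M" "ereal M < ereal 2 * \<phi> 0"
      using ereal_dense2 by (metis ereal_less_eq(3) less_ereal.simps(1))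
    have "r \<noteq> 0" using neg r by auto
    then have r0: "r > 0" using r by simp
    obtain a0 where a0: "a0 > 0" "\<And>a r v. 0 < a \<Longrightarrow> a \<le> a0 \<Longrightarrow> 0 \<le> r \<Longrightarrow> \<phi> r = ereal v \<Longrightarrow>
        M \<le> c * r + 2 * v + \<epsilon> * (a * kl (r / a))"
      using penalised_liminf_at_0[OF e _ M(2)] by auto
    define a where "a = min a0 (r / 2)"
    have a: "0 < a" "a \<le> a0" "a < r" using a0 r0 by (auto simp: a_def min_def)
    have "ereal (a * M) \<le> f a a"
    proof (rule ge)
      fix p u v assume p: "0 \<le> p" "\<phi> (p / a) = ereal u" "\<phi> (p / a) = ereal v"
      have "a * M \<le> a * (c * (p / a) + 2 * u + \<epsilon> * (a * kl (p / a / a)))"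
        using a p by (intro mult_left_mono a0(2)) auto
      then show "a * M \<le> c * p + a * u + a * v + \<epsilon> * (a * a * kl (p / (a * a)))"
        using a p by (simp add: algebra_simps)
    qed (use a in auto)
    also have "f a a \<le> ereal (1 - a / r) * f 0 0 + ereal (a / r) * f r r"
      using cv[of 0 0 r r "a / r"] a r0 by simp
    \<comment> \<open>Mass r r is the product plan between masses r and r: its entropy term vanishes
      and both marginal densities equal r.\<close>
    also have "\<dots> \<le> ereal (a / r) * ereal (c * (r * r) + r * v + r * v + \<epsilon> * (r * r * kl (r * r / (r * r))))"
      using ereal_mult_left_mono[OF le[of r r "r * r" v v], of "ereal (a / r)"] r0 a r by (simp add: f00)
    also have "\<dots> = ereal (a * (c * r + 2 * v))" using r0 by (simp add: kl1 field_simps)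
    finally show False using M(1) a by simp
  qed
  obtain v0 where v0: "\<phi> 0 = ereal v0" "0 \<le> v0"
    using slope[of 1 0] entropy_functionD(3)[OF e(1)] by (cases rule: entropy_function_cases[OF e(1), of 0]) (auto simp: zero_ereal_def)
  have slope': "v0 - c / 2 * r \<le> v" if "0 \<le> r" "\<phi> r = ereal v" for r v
    using slope[OF that] v0 by simp
  \<comment> \<open>Slopes of the chords of \<phi> from 0. Their infimum \<kappa>0 is the right
    derivative at 0; the chord to 1 shows that \<open>S\<close> is nonempty, and
    \<open>slope'\<close> bounds it below by - c / 2.\<close>
  define S where "S = {(v - v0) / r | r v. 0 < r \<and> \<phi> r = ereal v}"
  have "(0 - v0) / 1 \<in> S" unfolding S_def
    by (intro CollectI exI[of _ 1] exI[of _ 0]) (simp add: entropy_functionD(3)[OF e(1)] zero_ereal_def)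
  then have Sne: "S \<noteq> {}" by blast
  have Sb: "bdd_below S"
  proof (rule bdd_belowI)
    fix s assume "s \<in> S"
    then obtain r v where "s = (v - v0) / r" "0 < r" "\<phi> r = ereal v" by (auto simp: S_def)
    moreover from this have "v0 - c / 2 * r \<le> v" by (intro slope') auto
    ultimately show "- (c / 2) \<le> s" by (simp add: pos_le_divide_eq)
  qed
  define \<kappa>0 where "\<kappa>0 = Inf S"
  define \<kappa> where "\<kappa> = c + \<kappa>0"
  have \<kappa>0: "v0 + \<kappa>0 * r \<le> v" if "0 \<le> r" "\<phi> r = ereal v" for r v
  proof (cases "r = 0")
    case True then show ?thesis using that v0 by simp
  next
    case False
    then have "(v - v0) / r \<in> S" using that unfolding S_def by (intro CollectI exI[of _ r] exI[of _ v]) auto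
    then have "\<kappa>0 \<le> (v - v0) / r" unfolding \<kappa>0_def using Sb by (rule cInf_lower)
    then show ?thesis using that False by (simp add: field_simps)
  qed
  have cvx: "\<phi> (s * r) \<le> ereal ((1 - s) * v0 + s * v)" if "0 \<le> s" "s \<le> 1" "\<phi> r = ereal v" for s r v
    using entropy_functionD(4)[OF e(1), of "1 - s" s 0 r] that v0 by simp
  \<comment> \<open>By convexity, a chord to r0 with nearly minimal slope dominates \<phi> on all of
    [0, r0], which also makes \<phi> finite there.\<close>
  have \<kappa>0_approx: "\<exists>r0>0. \<forall>r. 0 \<le> r \<and> r \<le> r0 \<longrightarrow> (\<exists>v. \<phi> r = ereal v \<and> v \<le> v0 + (\<kappa>0 + d) * r)" if d: "d > 0" for d
  proof -
    have "\<exists>s\<in>S. s < \<kappa>0 + d" unfolding \<kappa>0_def using Sne d by (intro cInf_lessD) auto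
    then obtain r0 w where w: "(w - v0) / r0 < \<kappa>0 + d" "0 < r0" "\<phi> r0 = ereal w" by (auto simp: S_def)
    have "\<exists>v. \<phi> r = ereal v \<and> v \<le> v0 + (\<kappa>0 + d) * r" if r: "0 \<le> r" "r \<le> r0" for r
    proof -
      have "\<phi> (r / r0 * r0) \<le> ereal ((1 - r / r0) * v0 + r / r0 * w)" using r w by (intro cvx) auto
      then have le: "\<phi> r \<le> ereal (v0 + r * ((w - v0) / r0))" using w by (simp add: field_simps)
      then obtain v where v: "\<phi> r = ereal v" by (cases rule: entropy_function_cases[OF e(1), of r]) auto
      have "r * ((w - v0) / r0) \<le> r * (\<kappa>0 + d)" using w r by (intro mult_left_mono) auto
      then show ?thesis using v le by (auto simp: mult.commute)
    qed
    then show ?thesis using w(2) by blast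
  qed
  \<comment> \<open>Any lower bound N of D at a'' is also one at a'. Joint convexity is used on the
    segment from the boundary point (a, 0) to (a', b), which passes through (a'', t b): the terms
    with \<phi>(0) cancel and the coefficients of b are compared. The behaviour of \<phi> near 0 is
    known only up to the slope error d, hence the slack \<delta>.\<close>
  have const: "N \<le> \<kappa> * \<sigma> + v + \<epsilon> * (a' * kl (\<sigma> / a'))"
    if N: "\<And>\<sigma> v. 0 \<le> \<sigma> \<Longrightarrow> \<phi> \<sigma> = ereal v \<Longrightarrow> N \<le> \<kappa> * \<sigma> + v + \<epsilon> * (a'' * kl (\<sigma> / a''))"
      and a: "0 < a''" "0 < a'" and \<sigma>: "0 \<le> \<sigma>" "\<phi> \<sigma> = ereal v" for N a'' a' \<sigma> v
  proof (rule field_le_epsilon)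
    fix \<delta> :: real assume \<delta>: "\<delta> > 0"
    define d where "d = \<delta> / (\<sigma> + 1)"
    have d: "d > 0" "d * \<sigma> \<le> \<delta>" using \<delta> \<sigma> by (auto simp: d_def field_simps)
    obtain r0 where r0: "r0 > 0" "\<And>r. 0 \<le> r \<Longrightarrow> r \<le> r0 \<Longrightarrow> \<exists>v. \<phi> r = ereal v \<and> v \<le> v0 + (\<kappa>0 + d) * r"
      using \<kappa>0_approx[OF d(1)] by blast
    \<comment> \<open>The plan of mass \<sigma> b has first marginal density \<sigma> b / a', which
      this b keeps within [0, r0], the range of the first-order bound on \<phi>.\<close>
    define b where "b = r0 * a' / (\<sigma> + 1)"
    have b: "b > 0" using r0 a \<sigma> by (simp add: b_def)
    have "\<sigma> * b / a' = r0 * (\<sigma> / (\<sigma> + 1))" using a \<sigma> by (simp add: b_def)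
    also have "\<dots> \<le> r0 * 1" using r0 \<sigma> by (intro mult_left_mono) auto
    finally have sb: "\<sigma> * b / a' \<le> r0" by simp
    obtain w where w: "\<phi> (\<sigma> * b / a') = ereal w" "w \<le> v0 + (\<kappa>0 + d) * (\<sigma> * b / a')"
      using r0(2)[of "\<sigma> * b / a'"] sb a b \<sigma> by auto
    \<comment> \<open>Since t < a'' / a', there is a nonnegative a with (1 - t) a + t a' = a''; it
      is the one defined next.\<close>
    define t where "t = a'' / (a' + a'')"
    define a where "a = a'' * a'' / a'"
    have t: "0 < t" "t < 1" using a by (auto simp: t_def)
    have s0: "a' + a'' \<noteq> 0" using a(1,2) by linarith
    have t1: "1 - t = a' / (a' + a'')" using s0 by (simp add: t_def field_simps)
    have "(1 - t) * a + t * a' = (a'' * a'' + a'' * a') / (a' + a'')"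
      using a s0 unfolding t1 a_def by (simp add: t_def add_divide_distrib)
    also have "\<dots> = a''" using s0 by (simp add: field_simps)
    finally have conv: "(1 - t) * a + t * a' = a''" .
    have an: "0 \<le> a" using a(1,2) by (simp add: a_def)
    have tb: "0 < t * b" using t b by simp
    \<comment> \<open>The first marginal term is bounded below by the line through (0, \<phi>(0)) of
      slope \<kappa>0, which turns c p into \<kappa> p. What remains is t b times the expression
      bounded by N, at \<sigma> = p / (t b).\<close>
    have "ereal (a'' * v0 + t * b * N) \<le> f a'' (t * b)"
    proof (rule ge[OF \<open>0 < a''\<close> tb])
      fix p u v assume p: "0 \<le> p" "\<phi> (p / a'') = ereal u" "\<phi> (p / (t * b)) = ereal v"
      have "t * b * N \<le> t * b * (\<kappa> * (p / (t * b)) + v + \<epsilon> * (a'' * kl (p / (t * b) / a'')))"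
        using p tb by (intro mult_left_mono N) auto
      also have "\<dots> = \<kappa> * p + t * b * v + \<epsilon> * (a'' * (t * b) * kl (p / (a'' * (t * b))))"
        using t b by (simp add: algebra_simps)
      finally have A: "t * b * N \<le> \<kappa> * p + t * b * v + \<epsilon> * (a'' * (t * b) * kl (p / (a'' * (t * b))))" .
      have "a'' * (v0 + \<kappa>0 * (p / a'')) \<le> a'' * u" using \<open>0 < a''\<close> p by (intro mult_left_mono \<kappa>0) auto
      then have B: "a'' * v0 + \<kappa>0 * p \<le> a'' * u" using \<open>0 < a''\<close> by (simp add: algebra_simps)
      show "a'' * v0 + t * b * N \<le> c * p + a'' * u + t * b * v + \<epsilon> * (a'' * (t * b) * kl (p / (a'' * (t * b))))"
        using A B by (simp add: \<kappa>_def algebra_simps)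
    qed
    also have "f a'' (t * b) \<le> ereal (1 - t) * f a 0 + ereal t * f a' b"
      using cv[of a 0 a' b t] an \<open>0 < a'\<close> b t by (simp add: conv)
    also have "\<dots> \<le> ereal (1 - t) * ereal (a * v0) +
        ereal t * ereal (c * (\<sigma> * b) + a' * w + b * v + \<epsilon> * (a' * b * kl (\<sigma> * b / (a' * b))))"
      using t b \<sigma> \<open>0 < a'\<close> w(1) by (intro add_mono ereal_mult_left_mono le) (auto simp: fa0[OF an v0(1)])
    also have "\<dots> = ereal ((1 - t) * a * v0 + t * (c * (\<sigma> * b) + a' * w + b * v + \<epsilon> * (a' * b * kl (\<sigma> / a'))))"
      using b by simp
    finally have "a'' * v0 + t * b * N \<le> (1 - t) * a * v0 + t * (c * (\<sigma> * b) + a' * w + b * v + \<epsilon> * (a' * b * kl (\<sigma> / a')))"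
      by simp
    \<comment> \<open>Writing a'' as the convex combination cancels the boundary contribution (1 -
      t) a v0 on both sides.\<close>
    then have "t * (a' * v0 + b * N) \<le> t * (c * (\<sigma> * b) + a' * w + b * v + \<epsilon> * (a' * b * kl (\<sigma> / a')))"
      unfolding conv[symmetric] by (simp add: algebra_simps)
    then have 1: "a' * v0 + b * N \<le> c * (\<sigma> * b) + a' * w + b * v + \<epsilon> * (a' * b * kl (\<sigma> / a'))" using t by simp
    have "a' * w \<le> a' * (v0 + (\<kappa>0 + d) * (\<sigma> * b / a'))" using w \<open>0 < a'\<close> by (intro mult_left_mono) auto
    also have "\<dots> = a' * v0 + (\<kappa>0 + d) * (\<sigma> * b)" using \<open>0 < a'\<close> by (simp add: distrib_left)
    finally have "b * N \<le> b * (\<kappa> * \<sigma> + v + \<epsilon> * (a' * kl (\<sigma> / a')) + d * \<sigma>)" using 1 by (simp add: \<kappa>_def algebra_simps)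
    then have "N \<le> \<kappa> * \<sigma> + v + \<epsilon> * (a' * kl (\<sigma> / a')) + d * \<sigma>" using b by simp
    then show "N \<le> \<kappa> * \<sigma> + v + \<epsilon> * (a' * kl (\<sigma> / a')) + \<delta>" using d(2) by linarith
  qed
  \<comment> \<open>As a tends to 0, D(a) eventually exceeds every N < \<phi>(0). By constancy this
    holds at a = \<sigma> too, where the plan \<sigma> has no entropy cost because
    \<open>kl 1 = 0\<close>.\<close>
  have w_nonneg: "v0 \<le> \<kappa> * \<sigma> + v" if \<sigma>: "0 < \<sigma>" "\<phi> \<sigma> = ereal v" for \<sigma> v
  proof (rule dense_le)
    fix N assume "N < v0"
    then have "ereal N < ereal 1 * \<phi> 0" using v0 by simp
    from penalised_liminf_at_0[OF e _ this, of \<kappa>] obtain a0 where a0: "a0 > 0"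
      "\<And>a r v. 0 < a \<Longrightarrow> a \<le> a0 \<Longrightarrow> 0 \<le> r \<Longrightarrow> \<phi> r = ereal v \<Longrightarrow> N \<le> \<kappa> * r + v + \<epsilon> * (a * kl (r / a))"
      by auto
    have "N \<le> \<kappa> * \<sigma> + v + \<epsilon> * (\<sigma> * kl (\<sigma> / \<sigma>))"
      by (rule const[OF a0(2)[OF a0(1) order_refl] a0(1) \<sigma>(1) less_imp_le[OF \<sigma>(1)] \<sigma>(2)])
    then show "N \<le> \<kappa> * \<sigma> + v" using \<sigma> by (simp add: kl1)
  qed
  \<comment> \<open>A gap in the previous inequality at \<sigma> would lift D(2 \<sigma>) strictly
    above \<phi>(0), while the zero plan shows that D(a') is at most \<phi>(0) + \<epsilon> a'.
    Constancy of D rules this out.\<close>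
  have w_zero: "\<phi> \<sigma> = ereal (v0 - \<kappa> * \<sigma>)" if \<sigma>: "0 < \<sigma>" for \<sigma>
  proof (rule ccontr)
    assume neg: "\<phi> \<sigma> \<noteq> ereal (v0 - \<kappa> * \<sigma>)"
    have "\<exists>\<omega>>0. \<forall>v. \<phi> \<sigma> = ereal v \<longrightarrow> v0 + \<omega> \<le> \<kappa> * \<sigma> + v"
    proof (cases rule: entropy_function_cases[OF e(1), of \<sigma>])
      case 1 then show ?thesis by (auto intro: exI[of _ 1])
    next
      case (2 v)
      then have "v0 < \<kappa> * \<sigma> + v" using w_nonneg[OF \<sigma> 2(1)] neg by auto
      then show ?thesis using 2 by (intro exI[of _ "\<kappa> * \<sigma> + v - v0"]) auto
    qed
    then obtain \<omega> where \<omega>: "\<omega> > 0" "\<And>v. \<phi> \<sigma> = ereal v \<Longrightarrow> v0 + \<omega> \<le> \<kappa> * \<sigma> + v" by blast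
    \<comment> \<open>For s \<ge> \<sigma> convexity preserves the gap \<omega>. For s < \<sigma>
      the ratio s / (2 \<sigma>) is at most 1/2, and Young with slope - ln 2 gives an entropy of at
      least (1 - ln 2) / 2.\<close>
    define \<theta> where "\<theta> = min \<omega> (\<epsilon> * (2 * \<sigma> * ((1 - ln 2) / 2)))"
    have "ln 2 < (1::real)" using ln_2_less_1 .
    then have \<theta>: "\<theta> > 0" using \<omega> \<sigma> e by (simp add: \<theta>_def)
    have N: "v0 + \<theta> \<le> \<kappa> * s + v + \<epsilon> * (2 * \<sigma> * kl (s / (2 * \<sigma>)))" if s: "0 \<le> s" "\<phi> s = ereal v" for s v
    proof (cases "s \<ge> \<sigma>")
      case True
      then have s0: "s > 0" using \<sigma> by simp
      define q where "q = \<sigma> / s"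
      have q: "0 < q" "q \<le> 1" "q * s = \<sigma>" using True \<sigma> s0 by (auto simp: q_def)
      have le: "\<phi> \<sigma> \<le> ereal ((1 - q) * v0 + q * v)" using cvx[of q s v] q s by auto
      then obtain v' where v': "\<phi> \<sigma> = ereal v'" by (cases rule: entropy_function_cases[OF e(1), of \<sigma>]) auto
      have "v0 + \<omega> \<le> \<kappa> * (q * s) + ((1 - q) * v0 + q * v)" using \<omega>(2)[OF v'] le v' q(3) by simp
      then have "\<omega> \<le> q * (\<kappa> * s + v - v0)" by (simp add: algebra_simps)
      also have "\<dots> \<le> 1 * (\<kappa> * s + v - v0)" using q w_nonneg[OF s0 s(2)] by (intro mult_right_mono) auto
      finally have "v0 + \<theta> \<le> \<kappa> * s + v" by (simp add: \<theta>_def)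
      moreover have "0 \<le> \<epsilon> * (2 * \<sigma> * kl (s / (2 * \<sigma>)))" using e \<sigma> s kl_nonneg[of "s / (2 * \<sigma>)"] by simp
      ultimately show ?thesis by linarith
    next
      case False
      have x: "0 \<le> s / (2 * \<sigma>)" "s / (2 * \<sigma>) \<le> 1 / 2" using False s \<sigma> by (auto simp: field_simps)
      have "(1 - ln 2) / 2 \<le> s / (2 * \<sigma>) * (- ln 2) + 1 - exp (- ln 2)"
      proof -
        have *: "(1 - ln 2) / 2 \<le> y * (- ln 2) + 1 - exp (- ln 2)" if "y \<le> 1 / 2" for y :: real
        proof -
          have "exp (- ln 2) = (1 / 2 :: real)" by (simp add: exp_minus)
          moreover have "y * ln 2 \<le> 1 / 2 * ln 2" using that by (intro mult_right_mono) auto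
          ultimately show ?thesis by simp
        qed
        show ?thesis by (rule *[OF x(2)])
      qed
      also have "\<dots> \<le> kl (s / (2 * \<sigma>))" using x by (intro kl_Young)
      finally have "\<epsilon> * (2 * \<sigma> * ((1 - ln 2) / 2)) \<le> \<epsilon> * (2 * \<sigma> * kl (s / (2 * \<sigma>)))"
        using e \<sigma> by (intro mult_left_mono) auto
      moreover have "v0 \<le> \<kappa> * s + v" using w_nonneg[of s v] s v0 by (cases "s = 0") auto
      ultimately show ?thesis by (simp add: \<theta>_def)
    qed
    \<comment> \<open>The zero plan at this a' has entropy cost \<theta> / 2, less than the gain
      \<theta>.\<close>
    define a' where "a' = \<theta> / (2 * \<epsilon>)"
    have a': "a' > 0" using \<theta> e by (simp add: a'_def)
    have "v0 + \<theta> \<le> \<kappa> * 0 + v0 + \<epsilon> * (a' * kl (0 / a'))"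
      using \<sigma> a' v0(1) by (intro const[OF N]) auto
    then show False using \<theta> e by (simp add: kl1 a'_def)
  qed
  \<comment> \<open>\<phi> is now affine on (0, \<infinity>). Being nonnegative on both sides of its
    zero at 1, it vanishes; then \<kappa>0 = 0, and \<kappa> = c + \<kappa>0 = 0 forces c =
    0.\<close>
  have k: "v0 = \<kappa>" using w_zero[of 1] entropy_functionD(3)[OF e(1)] by (simp add: zero_ereal_def)
  have "0 \<le> v0 - \<kappa> * (1/2)" "0 \<le> v0 - \<kappa> * 2"
    using w_zero[of "1/2"] w_zero[of 2] entropy_functionD(2)[OF e(1), of "1/2"] entropy_functionD(2)[OF e(1), of 2] by auto
  then have z: "v0 = 0" "\<kappa> = 0" using k by auto
  have all0: "\<phi> p = 0" if "p \<ge> 0" for p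
    using w_zero[of p] v0 z that by (cases "p = 0") (auto simp: zero_ereal_def)
  have "S \<subseteq> {0}" unfolding S_def using all0 z by (auto simp: zero_ereal_def)
  then have "S = {0}" using Sne by blast
  then have "\<kappa>0 = 0" by (simp add: \<kappa>0_def)
  then show ?thesis using z all0 by (simp add: \<kappa>_def)
qed

section \<open>Transport between weighted Dirac masses\<close>

text \<open>The push-forward only moves the mass from the one-point space of
  \<open>point_measure\<close> to the Borel sigma-algebra of the whole space.\<close>

definition dirac :: "real \<Rightarrow> 'a::topological_space \<Rightarrow> 'a measure" where
  "dirac a x = distr (point_measure {x} (\<lambda>_. ennreal a)) borel (\<lambda>y. y)"

lemma sets_dirac [simp, measurable_cong]: "sets (dirac a x) = sets borel"
  and space_dirac [simp]: "space (dirac a x) = UNIV"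
  by (simp_all add: dirac_def)

lemma nn_integral_dirac:
  "f \<in> borel_measurable borel \<Longrightarrow> (\<integral>\<^sup>+y. f y \<partial>dirac a x) = ennreal a * f x"
  unfolding dirac_def
  by (subst nn_integral_distr) (auto simp: nn_integral_point_measure_finite measurable_point_measure_eq1)

lemma emeasure_dirac: "A \<in> sets borel \<Longrightarrow> emeasure (dirac a x) A = ennreal a * indicator A x"
  using nn_integral_dirac[of "indicator A" a x] by simp

lemma dirac_in_pos_measures: "dirac a x \<in> pos_measures"
  by (auto simp: pos_measures_def emeasure_dirac ennreal_mult_eq_top_iff intro!: finite_measureI)

lemma integral_dirac:
  fixes f :: "'a::topological_space \<Rightarrow> real"
  assumes "0 \<le> a" "f \<in> borel_measurable borel" "\<And>x. \<bar>f x\<bar> \<le> K"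
  shows "(\<integral>y. f y \<partial>dirac a x) = a * f x"
proof -
  have "integrable (dirac a x) f" by (rule integrable_bounded[OF dirac_in_pos_measures assms(2,3)])
  then show ?thesis using assms
    by (cases "0 \<le> f x"; subst real_lebesgue_integral_def) (auto simp: nn_integral_dirac enn2real_mult right_diff_distrib[symmetric] enn2real_ennreal max_def ennreal_neg)
qed

lemma mix_dirac:
  assumes "0 \<le> a" "0 \<le> b" "t \<in> {0..1}"
  shows "mix_measure t (dirac a x) (dirac b x) = dirac ((1 - t) * a + t * b) x"
  using assms by (intro measure_eqI)
    (auto simp: emeasure_mix_measure emeasure_dirac ennreal_mult'' ennreal_plus distrib_right mult.assoc)

lemma pair_dirac:
  fixes x y :: "'a::second_countable_topology"
  assumes "0 \<le> a" "0 \<le> b"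
  shows "dirac a x \<Otimes>\<^sub>M dirac b y = dirac (a * b) (x, y)"
proof (rule measure_eqI)
  interpret b: finite_measure "dirac b y" by (rule pos_measuresD[OF dirac_in_pos_measures])
  show s: "sets (dirac a x \<Otimes>\<^sub>M dirac b y) = sets (dirac (a * b) (x, y))"
    using pos_measuresD(1)[OF pair_measure_in_pos_measures[OF dirac_in_pos_measures dirac_in_pos_measures, of a x b y]] by simp
  fix X assume X: "X \<in> sets (dirac a x \<Otimes>\<^sub>M dirac b y)"
  have m: "(\<lambda>u. emeasure (dirac b y) (Pair u -` X)) \<in> borel_measurable borel"
    using b.measurable_emeasure_Pair[OF X] by (simp cong: measurable_cong_sets)
  have P: "Pair x -` X \<in> sets borel" using sets_Pair1[OF X, of x] by simp
  have X': "X \<in> sets borel" using X s by simp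
  have "emeasure (dirac a x \<Otimes>\<^sub>M dirac b y) X = ennreal a * emeasure (dirac b y) (Pair x -` X)"
    unfolding b.emeasure_pair_measure_alt[OF X] by (rule nn_integral_dirac[OF m])
  also have "\<dots> = ennreal a * (ennreal b * indicator X (x, y))"
    unfolding emeasure_dirac[OF P] by (simp add: indicator_def)
  also have "\<dots> = emeasure (dirac (a * b) (x, y)) X"
    unfolding emeasure_dirac[OF X'] using assms by (simp add: ennreal_mult mult.assoc)
  finally show "emeasure (dirac a x \<Otimes>\<^sub>M dirac b y) X = emeasure (dirac (a * b) (x, y)) X" .
qed

lemma density_dirac:
  assumes "r \<in> borel_measurable borel" "0 \<le> a"
  shows "density (dirac a x) (\<lambda>x. ennreal (r x)) = dirac (a * r x) x"
  using assms by (intro measure_eqI)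
    (auto simp: emeasure_density nn_integral_dirac emeasure_dirac ennreal_mult' mult.assoc)

lemma distr_dirac:
  assumes "T \<in> borel \<rightarrow>\<^sub>M borel"
  shows "distr (dirac a x) borel T = dirac a (T x)"
  using assms by (intro measure_eqI)
    (auto simp: emeasure_distr emeasure_dirac measurable_sets_borel indicator_def)

context
  fixes C :: "'a::second_countable_topology \<Rightarrow> 'a \<Rightarrow> real" and \<phi> and \<epsilon> K :: real
  assumes e: "entropy_function \<phi>" "\<epsilon> > 0"
    and C: "(\<lambda>z. C (fst z) (snd z)) \<in> borel_measurable borel" "\<And>x y. \<bar>C x y\<bar> \<le> K"
begin

text \<open>Masses may vanish: division by 0 yields 0, and p = 0 whenever a b = 0, so p / a, p / b
  and p / (a b) are correct densities in every case.\<close>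

lemma objective_dirac:
  assumes ab: "0 \<le> a" "0 \<le> b" "0 \<le> p" and p: "a * b = 0 \<Longrightarrow> p = 0"
  shows "objective C \<phi> \<epsilon> (dirac a x) (dirac b y) (dirac p (x, y)) =
    ereal (C x y * p) + enn2ereal (ennreal a * ephi \<phi> (p / a) + ennreal b * ephi \<phi> (p / b)
      + ennreal \<epsilon> * (ennreal (a * b) * ennreal (kl (p / (a * b)))))"
proof -
  have "a * (p / a) = p" "b * (p / b) = p" "(a * b) * (p / (a * b)) = p" using p by auto
  then have d: "distr (dirac p (x, y)) borel fst = density (dirac a x) (\<lambda>_. ennreal (p / a))"
    "distr (dirac p (x, y)) borel snd = density (dirac b y) (\<lambda>_. ennreal (p / b))"
    "dirac p (x, y) = density (dirac a x \<Otimes>\<^sub>M dirac b y) (\<lambda>_. ennreal (p / (a * b)))"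
    using ab by (simp_all add: density_dirac[of "\<lambda>_. _"] distr_dirac pair_dirac)
  have i: "integrable (dirac a x \<Otimes>\<^sub>M dirac b y) (\<lambda>_. p / (a * b))"
    by (rule integrable_bounded[OF pair_measure_in_pos_measures[OF dirac_in_pos_measures dirac_in_pos_measures], where K="\<bar>p / (a * b)\<bar>"]) auto
  have "objective C \<phi> \<epsilon> (dirac a x) (dirac b y) (dirac p (x, y)) = ereal (\<integral>z. C (fst z) (snd z) \<partial>dirac p (x, y))
     + enn2ereal (penalty \<phi> \<epsilon> (dirac a x) (dirac b y) (\<lambda>_. p / a) (\<lambda>_. p / b) (\<lambda>_. p / (a * b)))"
    using ab by (intro objective_penalty[OF dirac_in_pos_measures dirac_in_pos_measures e(2) _ _ d(1) _ _ d(2) _ _ i d(3)]) auto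
  also have "(\<integral>z. C (fst z) (snd z) \<partial>dirac p (x, y)) = C x y * p"
    using integral_dirac[OF ab(3) C(1), of K "(x, y)"] C(2) by simp
  finally show ?thesis using ab
    by (simp add: penalty_def pair_dirac emeasure_dirac mult.commute)
qed

lemma coupling_dirac:
  fixes x y :: 'a
  assumes ab: "0 \<le> a" "0 \<le> b" and \<pi>: "\<pi> \<in> pos_measures" "absolutely_continuous (dirac a x \<Otimes>\<^sub>M dirac b y) \<pi>"
  obtains p where "0 \<le> p" "a * b = 0 \<Longrightarrow> p = 0" "\<pi> = dirac p (x, y)"
proof -
  obtain r where r: "r \<in> borel_measurable borel" "\<And>z. 0 \<le> r z"
     "\<pi> = density (dirac a x \<Otimes>\<^sub>M dirac b y) (\<lambda>z. ennreal (r z))"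
    using density_of_absolutely_continuous[OF \<pi>(1) pair_measure_in_pos_measures[OF dirac_in_pos_measures dirac_in_pos_measures] \<pi>(2)] by metis
  then have "\<pi> = dirac (a * b * r (x, y)) (x, y)" using ab by (simp add: pair_dirac density_dirac)
  then show ?thesis using ab r(2)[of "(x, y)"] by (intro that[of "a * b * r (x, y)"]) auto
qed

lemma OT_dirac_ge:
  assumes ab: "0 \<le> a" "0 \<le> b"
    and M: "\<And>p. 0 \<le> p \<Longrightarrow> (a * b = 0 \<Longrightarrow> p = 0) \<Longrightarrow> M \<le> objective C \<phi> \<epsilon> (dirac a x) (dirac b y) (dirac p (x, y))"
  shows "M \<le> OT C \<phi> \<epsilon> (dirac a x) (dirac b y)"
  unfolding OT_objective
proof (rule INF_greatest)
  fix \<pi> :: "('a \<times> 'a) measure" assume \<pi>: "\<pi> \<in> pos_measures"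
  show "M \<le> objective C \<phi> \<epsilon> (dirac a x) (dirac b y) \<pi>"
  proof (cases "absolutely_continuous (dirac a x \<Otimes>\<^sub>M dirac b y) \<pi>")
    case True
    from coupling_dirac[OF ab \<pi> True] show ?thesis using M by metis
  qed (simp add: objective_not_absolutely_continuous e)
qed

lemma OT_dirac_le:
  assumes "0 \<le> p" "a * b = 0 \<Longrightarrow> p = 0"
  shows "OT C \<phi> \<epsilon> (dirac a x) (dirac b y) \<le> objective C \<phi> \<epsilon> (dirac a x) (dirac b y) (dirac p (x, y))"
  unfolding OT_objective by (intro INF_lower dirac_in_pos_measures)

text \<open>On multiples of two fixed Dirac masses every plan of finite cost is a multiple of the
  Dirac mass at (x, y), so joint convexity becomes convexity of a function on the quadrant.\<close>

lemma jointly_convex_imp_trivial: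
  assumes jc: "jointly_convex_on_measures (OT C \<phi> \<epsilon>)"
  shows "C x y = 0 \<and> (\<forall>p\<ge>0. \<phi> p = 0)"
proof (rule dirac_cost_convex_imp_trivial[OF e, of "\<lambda>a b. OT C \<phi> \<epsilon> (dirac a x) (dirac b y)"])
  have ephi: "ephi \<phi> q = ennreal v" if "\<phi> q = ereal v" for q v
    using that by (simp add: ephi_def)
  have pos: "0 \<le> v" if "\<phi> q = ereal v" for q v using entropy_functionD(2)[OF e(1), of q] that by simp
  have val: "objective C \<phi> \<epsilon> (dirac a x) (dirac b y) (dirac p (x, y)) =
      ereal (C x y * p + a * u + b * v + \<epsilon> * (a * b * kl (p / (a * b))))"
    if "0 \<le> a" "0 \<le> b" "0 \<le> p" "a * b = 0 \<Longrightarrow> p = 0" "\<phi> (p / a) = ereal u" "\<phi> (p / b) = ereal v" for a b p u v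
  proof -
    have "0 \<le> kl (p / (a * b))" using that by (intro kl_nonneg) simp
    then have "ennreal a * ennreal u + ennreal b * ennreal v + ennreal \<epsilon> * (ennreal (a * b) * ennreal (kl (p / (a * b)))) =
        ennreal (a * u + b * v + \<epsilon> * (a * b * kl (p / (a * b))))"
      "0 \<le> a * u + b * v + \<epsilon> * (a * b * kl (p / (a * b)))"
      using that(1,2) pos[OF that(5)] pos[OF that(6)] e(2) by (simp_all add: ennreal_mult)
    then show ?thesis
      by (simp only: objective_dirac[OF that(1-4)] ephi[OF that(5)] ephi[OF that(6)]) (simp add: add.assoc)
  qed
  {
    fix a b p u v assume h: "0 < a" "0 < b" "0 \<le> p" "\<phi> (p / a) = ereal u" "\<phi> (p / b) = ereal v"
    then show "OT C \<phi> \<epsilon> (dirac a x) (dirac b y) \<le> ereal (C x y * p + a * u + b * v + \<epsilon> * (a * b * kl (p / (a * b))))"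
      using OT_dirac_le[of p a b x y] val[of a b p u v] by simp
  next
    fix a b M assume ab: "0 < a" "0 < b" and M: "\<And>p u v. 0 \<le> p \<Longrightarrow> \<phi> (p / a) = ereal u \<Longrightarrow> \<phi> (p / b) = ereal v \<Longrightarrow>
      M \<le> C x y * p + a * u + b * v + \<epsilon> * (a * b * kl (p / (a * b)))"
    show "ereal M \<le> OT C \<phi> \<epsilon> (dirac a x) (dirac b y)"
    proof (rule OT_dirac_ge)
      fix p :: real assume p: "0 \<le> p"
      have inf: "ephi \<phi> q = top" if "\<phi> q = \<infinity>" for q using that by (simp add: ephi_def)
      show "ereal M \<le> objective C \<phi> \<epsilon> (dirac a x) (dirac b y) (dirac p (x, y))"
      proof (cases "\<phi> (p / a) = \<infinity> \<or> \<phi> (p / b) = \<infinity>")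
        case True
        then have "ennreal a * ephi \<phi> (p / a) + ennreal b * ephi \<phi> (p / b)
          + ennreal \<epsilon> * (ennreal (a * b) * ennreal (kl (p / (a * b)))) = top"
          using ab inf by (auto simp: ennreal_mult_top ennreal_top_mult)
        moreover have "a * b \<noteq> 0" using ab by simp
        ultimately show ?thesis using ab p by (subst objective_dirac) (simp_all only:, auto)
      next
        case False
        then obtain u v where "\<phi> (p / a) = ereal u" "\<phi> (p / b) = ereal v"
          using entropy_function_cases[OF e(1)] by metis
        then show ?thesis using M[OF p, of u v] ab p by (subst val) auto
      qed
    qed (use ab in auto)
  next
    \<comment> \<open>On the boundary b = 0 only the zero plan is absolutely continuous, and it
      costs a \<phi>(0).\<close>
    have "OT C \<phi> \<epsilon> (dirac a x) (dirac 0 y) = enn2ereal (ennreal a * ephi \<phi> 0)" if a: "0 \<le> a" for a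
    proof -
      have o: "objective C \<phi> \<epsilon> (dirac a x) (dirac 0 y) (dirac 0 (x, y)) = enn2ereal (ennreal a * ephi \<phi> 0)"
        using a by (subst objective_dirac) (auto simp: zero_ereal_def[symmetric])
      show ?thesis
      proof (rule antisym)
        show "OT C \<phi> \<epsilon> (dirac a x) (dirac 0 y) \<le> enn2ereal (ennreal a * ephi \<phi> 0)"
          using OT_dirac_le[of 0 a 0 x y] o by simp
        show "enn2ereal (ennreal a * ephi \<phi> 0) \<le> OT C \<phi> \<epsilon> (dirac a x) (dirac 0 y)"
          using a by (intro OT_dirac_ge) (auto simp: o)
      qed
    qed note z = this
    show "OT C \<phi> \<epsilon> (dirac 0 x) (dirac 0 y) = 0" by (simp add: z zero_ennreal.rep_eq)
    fix a v :: real assume "0 \<le> a" "\<phi> 0 = ereal v"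
    then show "OT C \<phi> \<epsilon> (dirac a x) (dirac 0 y) = ereal (a * v)"
      using pos[of 0 v] by (simp add: z ephi ennreal_mult[symmetric])
  next
    fix a b a' b' t :: real assume h: "0 \<le> a" "0 \<le> b" "0 \<le> a'" "0 \<le> b'" "0 < t" "t < 1"
    have "OT C \<phi> \<epsilon> (mix_measure t (dirac a x) (dirac a' x)) (mix_measure t (dirac b y) (dirac b' y))
      \<le> ereal (1 - t) * OT C \<phi> \<epsilon> (dirac a x) (dirac b y) + ereal t * OT C \<phi> \<epsilon> (dirac a' x) (dirac b' y)"
      using jc h unfolding jointly_convex_on_measures_def by (simp add: dirac_in_pos_measures)
    then show "OT C \<phi> \<epsilon> (dirac ((1 - t) * a + t * a') x) (dirac ((1 - t) * b + t * b') y)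
      \<le> ereal (1 - t) * OT C \<phi> \<epsilon> (dirac a x) (dirac b y) + ereal t * OT C \<phi> \<epsilon> (dirac a' x) (dirac b' y)"
      using h by (simp add: mix_dirac)
  }
qed

end

section \<open>The scalar problem defining the potentials\<close>

text \<open>If the domain of \<phi> lay in some [u, v] with u > 0, every slope of its conjugate
  would lie in [u, v], and subgradients could tend neither to 0 nor to infinity.\<close>

lemma subgradients_domain:
  assumes e: "entropy_function \<phi>" and A2: "subgradients_reach_zero_or_infinity (legendre \<phi>)"
  shows "(\<forall>v. \<exists>p>v. \<phi> p < \<infinity>) \<or> (\<forall>u>0. \<exists>p\<ge>0. p < u \<and> \<phi> p < \<infinity>)"
proof (rule ccontr)
  assume "\<not> ?thesis"
  then have "\<exists>u>0. \<forall>p\<ge>0. p < u \<longrightarrow> \<phi> p = \<infinity>" "\<exists>v. \<forall>p>v. \<phi> p = \<infinity>" by auto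
  then obtain u v where u: "u > 0" "\<And>p. 0 \<le> p \<Longrightarrow> p < u \<Longrightarrow> \<phi> p = \<infinity>" and v: "\<And>p. p > v \<Longrightarrow> \<phi> p = \<infinity>"
    by blast
  obtain x s where xs: "\<And>n. legendre \<phi> (x n) < \<infinity>" "\<And>n. s n \<in> subdifferential (legendre \<phi>) (x n)"
    and lim: "s \<longlonglongrightarrow> 0 \<or> filterlim s at_top sequentially"
    using A2 unfolding subgradients_reach_zero_or_infinity_def eff_dom_def by auto
  have b: "u \<le> s n \<and> s n \<le> v" for n
  proof -
    have le: "ereal (p * x n) - \<phi> p \<le> legendre \<phi> (x n)" if "p \<ge> 0" for p
      unfolding legendre_def using that by (intro SUP_upper) auto
    have "ereal (x n) \<le> legendre \<phi> (x n)" using le[of 1] entropy_functionD(3)[OF e] by simp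
    then obtain L where L: "legendre \<phi> (x n) = ereal L" using xs(1)[of n] by (cases "legendre \<phi> (x n)") auto
    \<comment> \<open>Shifting the argument by d changes each competitor p by p d. The shifts 1 and
      -1 then bound the subgradient by v from above and by u from below.\<close>
    have shift: "legendre \<phi> (x n + d) \<le> ereal (L + m)" if m: "\<And>p. u \<le> p \<Longrightarrow> p \<le> v \<Longrightarrow> p * d \<le> m" for d m
      unfolding legendre_def
    proof (rule SUP_least)
      fix p :: real assume "p \<in> {0..}"
      then have p: "p \<ge> 0" by simp
      show "ereal (p * (x n + d)) - \<phi> p \<le> ereal (L + m)"
      proof (cases rule: entropy_function_cases[OF e, of p])
        case (2 w)
        then have "u \<le> p" "p \<le> v" using u(2)[OF p] v[of p] by (auto simp: not_less[symmetric])
        then have "p * d \<le> m" by (rule m)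
        moreover have "p * x n - w \<le> L" using le[OF p] 2 L by simp
        ultimately show ?thesis using 2 by (simp add: distrib_left)
      qed simp
    qed
    have sub: "ereal L + ereal (s n * (y - x n)) \<le> legendre \<phi> y" for y
      using xs(2)[of n] by (simp add: subdifferential_def L del: plus_ereal.simps)
    have "ereal L + ereal (s n * (x n + 1 - x n)) \<le> ereal (L + v)"
      by (rule order_trans[OF sub shift]) simp
    moreover have "ereal L + ereal (s n * (x n + - 1 - x n)) \<le> ereal (L + - u)"
      by (rule order_trans[OF sub shift]) simp
    ultimately show ?thesis by simp
  qed
  from lim show False
  proof
    assume "s \<longlonglongrightarrow> 0"
    then have "u \<le> 0" using b by (intro LIMSEQ_le_const) auto
    then show False using u by simp
  next
    assume "filterlim s at_top sequentially"
    then have "eventually (\<lambda>n. v + 1 \<le> s n) sequentially" by (simp add: filterlim_at_top)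
    then obtain n where "v + 1 \<le> s n" by (auto simp: eventually_sequentially)
    then show False using b[of n] by simp
  qed
qed

lemma continuous_on_kl: "continuous_on {0..} kl"
proof -
  have "(kl \<longlongrightarrow> kl x) (at x within {0..})" if "x \<ge> 0" for x
  proof (cases "x = 0")
    case False
    then have "isCont kl x" unfolding kl_def[abs_def] using that by (intro continuous_intros) auto
    then show ?thesis unfolding isCont_def by (rule tendsto_within_subset) simp
  next
    case True
    have "((\<lambda>p. p * (- M) + 1 - exp (- M)) \<longlongrightarrow> 0 * (- M) + 1 - exp (- M)) (at 0 within {0..})" for M :: real
      by (intro tendsto_intros)
    show ?thesis unfolding True
    proof (rule order_tendstoI)
      fix c :: real assume "c < kl 0"
      then have c: "c < 1" by (simp add: kl_def)
      \<comment> \<open>Then exp (- M) = (1 - c) / 2, so the Young minorant with slope - M has the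
        value (1 + c) / 2 > c at 0.\<close>
      define M where "M = - ln ((1 - c) / 2)"
      have M: "c < 0 * (- M) + 1 - exp (- M)" using c by (simp add: M_def field_simps)
      have "((\<lambda>p. p * (- M) + 1 - exp (- M)) \<longlongrightarrow> 0 * (- M) + 1 - exp (- M)) (at 0 within {0..})"
        by (intro tendsto_intros)
      from order_tendstoD(1)[OF this M]
      have "eventually (\<lambda>p. c < p * (- M) + 1 - exp (- M)) (at 0 within {0..})" .
      then show "eventually (\<lambda>p. c < kl p) (at 0 within {0..})"
        unfolding eventually_at_filter
      proof eventually_elim
        case (elim p)
        then show ?case using kl_Young[of p "- M"] by (auto intro: less_le_trans)
      qed
    next
      fix c :: real assume c: "kl 0 < c"
      have "kl p < c" if "0 < p" "p < 1" for p
      proof -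
        have "p * ln p \<le> 0" using that by (simp add: mult_nonneg_nonpos)
        then have "kl p \<le> 1" unfolding kl_def using that by linarith
        then show ?thesis using c by (simp add: kl_def)
      qed
      moreover have "eventually (\<lambda>p. p < 1) (nhds (0::real))"
        by (rule eventually_nhds_in_open[of "{..<1}" "0::real", simplified])
      ultimately show "eventually (\<lambda>p. kl p < c) (at 0 within {0..})"
        unfolding eventually_at_filter by (auto elim: eventually_mono)
    qed
  qed
  then show ?thesis by (simp add: continuous_on_def)
qed

lemma scalar_minimiser:
  assumes e: "entropy_function \<phi>" "\<epsilon> > 0" and cont: "continuous_on {0..} \<phi>"
  obtains s w where "0 \<le> s" "\<phi> s = ereal w"
    "\<And>p v. 0 \<le> p \<Longrightarrow> \<phi> p = ereal v \<Longrightarrow> w + \<epsilon> * kl s - s * E \<le> v + \<epsilon> * kl p - p * E"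
proof -
  \<comment> \<open>Young with this slope bounds the objective below by p + \<epsilon> - \<epsilon>
    exp u. Beyond \<open>P\<close> this exceeds - E, the value at p = 1, so minimising over the
    compact interval suffices.\<close>
  define u where "u = (E + 1) / \<epsilon>"
  define P where "P = max 1 (\<epsilon> * exp u + \<bar>E\<bar>)"
  define F where "F p = \<phi> p + ereal (\<epsilon> * kl p - p * E)" for p
  have "continuous_on {0..P} F"
    unfolding continuous_on_def
  proof
    fix x assume "x \<in> {0..P}"
    then have x: "x \<in> {0..}" by simp
    have "(\<phi> \<longlongrightarrow> \<phi> x) (at x within {0..P})"
      using cont x by (auto simp: continuous_on_def intro: tendsto_within_subset)
    moreover have "(kl \<longlongrightarrow> kl x) (at x within {0..P})"
      using continuous_on_kl x by (auto simp: continuous_on_def intro: tendsto_within_subset)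
    then have "((\<lambda>p. ereal (\<epsilon> * kl p - p * E)) \<longlongrightarrow> ereal (\<epsilon> * kl x - x * E)) (at x within {0..P})"
      by (intro tendsto_intros)
    ultimately show "(F \<longlongrightarrow> F x) (at x within {0..P})"
      unfolding F_def by (intro tendsto_add_ereal_general) auto
  qed
  moreover have "{0..P} \<noteq> {}" by (auto simp: P_def)
  ultimately obtain s where s: "s \<in> {0..P}" "\<And>p. p \<in> {0..P} \<Longrightarrow> F s \<le> F p"
    using continuous_attains_inf[of "{0..P}" F] by auto
  have "F s \<le> F 1" using s by (intro s(2)) (auto simp: P_def)
  also have F1: "F 1 = ereal (- E)" using entropy_functionD(3)[OF e(1)] by (simp add: F_def kl_def)
  finally have Fs: "F s \<le> ereal (- E)" .
  then obtain w where w: "\<phi> s = ereal w" by (cases rule: entropy_function_cases[OF e(1), of s]) (auto simp: F_def)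
  have "w + \<epsilon> * kl s - s * E \<le> v + \<epsilon> * kl p - p * E" if p: "0 \<le> p" "\<phi> p = ereal v" for p v
  proof (cases "p \<le> P")
    case True
    then show ?thesis using s(2)[of p] p w by (simp add: F_def)
  next
    case False
    have "0 \<le> v" using entropy_functionD(2)[OF e(1), of p] p by simp
    moreover have "\<epsilon> * (p * u + 1 - exp u) \<le> \<epsilon> * kl p" using e p by (intro mult_left_mono kl_Young) auto
    moreover have "\<epsilon> * (p * u + 1 - exp u) = p * E + p + \<epsilon> - \<epsilon> * exp u" using e by (simp add: u_def field_simps)
    moreover have "\<epsilon> * exp u + \<bar>E\<bar> < p" using False by (simp add: P_def)
    moreover have "w + \<epsilon> * kl s - s * E \<le> - E" using Fs w by (simp add: F_def)
    ultimately show ?thesis using e by linarith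
  qed
  then show ?thesis using that[of s w] s w by simp
qed

text \<open>The first-order condition says that E - \<epsilon> ln s is a subgradient of \<phi> at
  the minimiser. As \<phi> may have kinks, it is derived from variations along segments. The
  minimiser is positive because \<open>kl\<close> has slope -\<infinity> at 0.\<close>

lemma scalar_optimality:
  assumes e: "entropy_function \<phi>" "\<epsilon> > 0" and cont: "continuous_on {0..} \<phi>"
  obtains s w where "0 < s" "\<phi> s = ereal w"
    "\<And>p v. 0 \<le> p \<Longrightarrow> \<phi> p = ereal v \<Longrightarrow> w + (E - \<epsilon> * ln s) * (p - s) \<le> v"
proof -
  obtain s w where s: "0 \<le> s" and w: "\<phi> s = ereal w"
    and min: "\<And>p v. 0 \<le> p \<Longrightarrow> \<phi> p = ereal v \<Longrightarrow> w + \<epsilon> * kl s - s * E \<le> v + \<epsilon> * kl p - p * E"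
    using scalar_minimiser[OF e cont, of E] by metis
  have segment: "w + \<epsilon> * kl s - s * E \<le> (1 - t) * w + t * v + \<epsilon> * kl ((1 - t) * s + t * p) - ((1 - t) * s + t * p) * E"
    if t: "0 \<le> t" "t \<le> 1" and p: "0 \<le> p" "\<phi> p = ereal v" for t p v
  proof -
    have le: "\<phi> ((1 - t) * s + t * p) \<le> ereal ((1 - t) * w + t * v)"
      using entropy_functionD(4)[OF e(1), of "1 - t" t s p] t p w by simp
    then obtain v' where v': "\<phi> ((1 - t) * s + t * p) = ereal v'" "v' \<le> (1 - t) * w + t * v"
      by (cases rule: entropy_function_cases[OF e(1), of "(1 - t) * s + t * p"]) auto
    have "0 \<le> (1 - t) * s + t * p" using t s p by simp
    from min[OF this v'(1)] v'(2) show ?thesis by linarith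
  qed
  have s0: "0 < s"
  proof (rule ccontr)
    assume "\<not> 0 < s"
    then have s: "s = 0" using s by simp
    \<comment> \<open>Moving from 0 to t gains \<epsilon> t ln t, of larger order than the linear
      terms; this t makes the gain outweigh |E|.\<close>
    define t where "t = exp (- (\<bar>E\<bar> / \<epsilon>))"
    have t: "0 < t" "t \<le> 1" using e by (auto simp: t_def)
    have "w + \<epsilon> \<le> (1 - t) * w + \<epsilon> * (t * ln t - t + 1) - t * E"
      using segment[of t 1 0] t entropy_functionD(3)[OF e(1)] by (simp add: s kl_def zero_ereal_def)
    then have "t * w \<le> t * (\<epsilon> * (ln t - 1) - E)" by (simp add: algebra_simps)
    then have "w \<le> \<epsilon> * (ln t - 1) - E" using t by simp
    also have "\<dots> = - \<bar>E\<bar> - \<epsilon> - E" using e by (simp add: t_def field_simps)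
    also have "\<dots> < 0" using e by linarith
    finally show False using entropy_functionD(2)[OF e(1), of s] w by simp
  qed
  show thesis
  proof (rule that[OF s0 w])
    fix p v assume p: "0 \<le> p" "\<phi> p = ereal v"
    \<comment> \<open>The increment of \<open>kl\<close> is bounded by its tangent at the moved
      point q. After division by t, q tends to s.\<close>
    have *: "w + (E - \<epsilon> * ln ((1 - t) * s + t * p)) * (p - s) \<le> v" if t: "0 < t" "t < 1" for t
    proof -
      define q where "q = (1 - t) * s + t * p"
      have "0 < (1 - t) * s" "0 \<le> t * p" using t s0 p by auto
      then have q: "0 < q" "q - s = t * (p - s)" unfolding q_def by (linarith, simp add: algebra_simps)
      have "kl q - kl s \<le> (q - s) * ln q" using kl_Young[of s "ln q"] s q by (simp add: kl_def algebra_simps)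
      then have "\<epsilon> * (kl q - kl s) \<le> \<epsilon> * ((q - s) * ln q)" using e by simp
      moreover have "w + \<epsilon> * kl s - s * E \<le> (1 - t) * w + t * v + \<epsilon> * kl q - q * E"
        using segment[of t p v] t p by (simp add: q_def)
      ultimately have "t * w - t * v \<le> \<epsilon> * ((q - s) * ln q) - (q - s) * E" by (simp add: algebra_simps)
      also have "\<dots> = t * ((\<epsilon> * ln q - E) * (p - s))" unfolding q(2) by (simp add: algebra_simps)
      finally have "t * (w - v) \<le> t * ((\<epsilon> * ln q - E) * (p - s))" by (simp add: algebra_simps)
      then have "w - v \<le> (\<epsilon> * ln q - E) * (p - s)" using t by simp
      then show ?thesis by (simp add: q_def algebra_simps)
    qed
    have "((\<lambda>t. w + (E - \<epsilon> * ln ((1 - t) * s + t * p)) * (p - s)) \<longlongrightarrow>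
        w + (E - \<epsilon> * ln ((1 - 0) * s + 0 * p)) * (p - s)) (at_right 0)"
      using s0 by (intro tendsto_intros) auto
    then have "w + (E - \<epsilon> * ln ((1 - 0) * s + 0 * p)) * (p - s) \<le> v"
    proof (rule tendsto_upperbound)
      show "eventually (\<lambda>t. w + (E - \<epsilon> * ln ((1 - t) * s + t * p)) * (p - s) \<le> v) (at_right 0)"
        unfolding eventually_at_right_field using * by (intro exI[of _ 1]) auto
    qed simp
    then show "w + (E - \<epsilon> * ln s) * (p - s) \<le> v" by simp
  qed
qed

text \<open>
  The map \<open>a\<close> plays the role of the \<open>aprox\<close> operator and \<open>exp ((E + a E) / \<epsilon>)\<close> is the marginal
  density which it produces.
\<close>

lemma aprox_exists:
  assumes e: "entropy_function \<phi>" "\<epsilon> > 0" and cont: "continuous_on {0..} \<phi>"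
  obtains a :: "real \<Rightarrow> real" and w :: "real \<Rightarrow> real" where
    "\<And>E. \<phi> (exp ((E + a E) / \<epsilon>)) = ereal (w E)"
    "\<And>E p v. 0 \<le> p \<Longrightarrow> \<phi> p = ereal v \<Longrightarrow> w E - a E * (p - exp ((E + a E) / \<epsilon>)) \<le> v"
    "\<And>E E'. E \<le> E' \<Longrightarrow> a E' \<le> a E \<and> E + a E \<le> E' + a E'"
proof -
  have "\<exists>s w. 0 < s \<and> \<phi> s = ereal w \<and> (\<forall>p v. 0 \<le> p \<longrightarrow> \<phi> p = ereal v \<longrightarrow> w + (E - \<epsilon> * ln s) * (p - s) \<le> v)" for E
    using scalar_optimality[OF e cont, of E] by metis
  then obtain s w where s: "\<And>E. 0 < s E" "\<And>E. \<phi> (s E) = ereal (w E)"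
    and opt: "\<And>E p v. 0 \<le> p \<Longrightarrow> \<phi> p = ereal v \<Longrightarrow> w E + (E - \<epsilon> * ln (s E)) * (p - s E) \<le> v"
    by metis
  \<comment> \<open>Thus - a E is the subgradient of \<phi> at s E, and s E is recovered as exp((E +
    a E) / \<epsilon>).\<close>
  define a where "a E = \<epsilon> * ln (s E) - E" for E
  have ex: "exp ((E + a E) / \<epsilon>) = s E" for E using e s(1)[of E] by (simp add: a_def)
  have "a E' \<le> a E \<and> E + a E \<le> E' + a E'" if E: "E \<le> E'" for E E'
  proof -
    \<comment> \<open>Adding the two subgradient inequalities expresses monotonicity of the
      subdifferential.\<close>
    have "w E + (E - \<epsilon> * ln (s E)) * (s E' - s E) \<le> w E'" "w E' + (E' - \<epsilon> * ln (s E')) * (s E - s E') \<le> w E"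
      using s by (auto intro: opt less_imp_le)
    then have m: "0 \<le> (a E - a E') * (s E' - s E)" by (simp add: a_def algebra_simps)
    have "s E \<le> s E'"
    proof (rule ccontr)
      assume "\<not> s E \<le> s E'"
      then have l: "s E' < s E" by simp
      then have "ln (s E') < ln (s E)" using s(1) by simp
      then have "\<epsilon> * ln (s E') < \<epsilon> * ln (s E)" using e by simp
      then have "0 < a E - a E'" using E by (simp add: a_def)
      then have "(a E - a E') * (s E' - s E) < 0" using l by (simp add: mult_pos_neg)
      then show False using m by simp
    qed
    moreover have "a E' \<le> a E"
    proof (cases "s E = s E'")
      case True then show ?thesis using E by (simp add: a_def)
    next
      case False
      then have "0 < s E' - s E" using \<open>s E \<le> s E'\<close> by simp
      then show ?thesis using m by (simp add: zero_le_mult_iff)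
    qed
    moreover have "ln (s E) \<le> ln (s E')" using \<open>s E \<le> s E'\<close> s(1) by simp
    then have "E + a E \<le> E' + a E'" using e by (simp add: a_def)
    ultimately show ?thesis by simp
  qed
  moreover have "w E - a E * (p - s E) \<le> v" if "0 \<le> p" "\<phi> p = ereal v" for E p v
    using opt[OF that, of E] by (simp add: a_def algebra_simps)
  ultimately show thesis using s by (intro that[of a w]) (simp_all add: ex)
qed

section \<open>Softmin and the Sinkhorn fixed point\<close>

text \<open>The density \<open>s\<close> explores the whole domain of \<phi>. If it stayed low for
  large E, the subgradient E - \<epsilon> ln(s E) would become too steep for a finite value of
  \<phi> further right; symmetrically for E towards -\<infinity>. The bounds in the other cases hold
  because s E lies in the domain.\<close>

lemma aprox_density_at_infinity:
  fixes \<phi> :: "real \<Rightarrow> ereal" and \<epsilon> :: real and a w :: "real \<Rightarrow> real"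
  defines "s \<equiv> \<lambda>E. exp ((E + a E) / \<epsilon>)"
  assumes e: "entropy_function \<phi>" "\<epsilon> > 0"
    and w: "\<And>E. \<phi> (s E) = ereal (w E)"
    and opt: "\<And>E p v. 0 \<le> p \<Longrightarrow> \<phi> p = ereal v \<Longrightarrow> w E - a E * (p - s E) \<le> v"
    and mono: "\<And>E E'. E \<le> E' \<Longrightarrow> a E' \<le> a E \<and> E + a E \<le> E' + a E'"
  shows "(\<forall>v. \<exists>p>v. \<phi> p < \<infinity>) \<Longrightarrow> \<exists>E0. \<forall>E\<ge>E0. S \<le> s E"
    and "(\<forall>u>0. \<exists>p\<ge>0. p < u \<and> \<phi> p < \<infinity>) \<Longrightarrow> 0 < \<delta> \<Longrightarrow> \<exists>E0. \<forall>E\<le>E0. s E \<le> \<delta>"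
    and "\<not> (\<forall>v. \<exists>p>v. \<phi> p < \<infinity>) \<Longrightarrow> \<exists>v>0. \<forall>E. s E \<le> v"
    and "\<not> (\<forall>u>0. \<exists>p\<ge>0. p < u \<and> \<phi> p < \<infinity>) \<Longrightarrow> \<exists>u>0. \<forall>E. u \<le> s E"
    and "\<And>E E'. E \<le> E' \<Longrightarrow> s E \<le> s E'"
proof -
  have smono: "s E \<le> s E'" if "E \<le> E'" for E E'
    using mono[OF that] e by (simp add: s_def divide_right_mono)
  then show "\<And>E E'. E \<le> E' \<Longrightarrow> s E \<le> s E'" .
  have spos: "0 < s E" for E by (simp add: s_def)
  have w0: "0 \<le> w E" for E using entropy_functionD(2)[OF e(1), of "s E"] w by simp
  have aE: "a E = \<epsilon> * ln (s E) - E" for E using e by (simp add: s_def)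
  show "\<exists>E0. \<forall>E\<ge>E0. S \<le> s E" if dom: "\<forall>v. \<exists>p>v. \<phi> p < \<infinity>"
  proof -
    define S' where "S' = max S 1"
    obtain p where p: "p > S'" "\<phi> p < \<infinity>" using dom by blast
    then obtain v where v: "\<phi> p = ereal v" by (cases rule: entropy_function_cases[OF e(1), of p]) auto
    have p0: "0 \<le> p" using p by (simp add: S'_def)
    \<comment> \<open>If s E0 were below S', the supporting line at s E0 would rise by at least |v|
      + 1 up to p and exceed \<phi>(p) = v.\<close>
    define E0 where "E0 = \<epsilon> * ln S' + (\<bar>v\<bar> + 1) / (p - S')"
    have "S' \<le> s E0"
    proof (rule ccontr)
      assume l: "\<not> S' \<le> s E0"
      then have "ln (s E0) \<le> ln S'" using spos[of E0] by simp
      then have "\<epsilon> * ln (s E0) \<le> \<epsilon> * ln S'" using e by simp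
      then have a: "(\<bar>v\<bar> + 1) / (p - S') \<le> - a E0" by (simp add: aE E0_def)
      have "0 \<le> - a E0" by (rule order_trans[OF _ a]) (use p in simp)
      then have "(\<bar>v\<bar> + 1) / (p - S') * (p - S') \<le> - a E0 * (p - s E0)"
        using l p by (intro mult_mono a) auto
      then have "\<bar>v\<bar> + 1 \<le> - a E0 * (p - s E0)" using p by simp
      then show False using opt[OF p0 v, of E0] w0[of E0] by linarith
    qed
    then show ?thesis using smono by (intro exI[of _ E0]) (auto simp: S'_def intro: order_trans)
  qed
  show "\<exists>E0. \<forall>E\<le>E0. s E \<le> \<delta>" if dom: "\<forall>u>0. \<exists>p\<ge>0. p < u \<and> \<phi> p < \<infinity>" and \<delta>: "0 < \<delta>"
  proof -
    obtain p where p: "0 \<le> p" "p < \<delta>" "\<phi> p < \<infinity>" using dom \<delta> by blast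
    then obtain v where v: "\<phi> p = ereal v" by (cases rule: entropy_function_cases[OF e(1), of p]) auto
    define E0 where "E0 = \<epsilon> * ln \<delta> - (\<bar>v\<bar> + 1) / (\<delta> - p)"
    have "s E0 \<le> \<delta>"
    proof (rule ccontr)
      assume l: "\<not> s E0 \<le> \<delta>"
      then have "ln \<delta> \<le> ln (s E0)" using \<delta> by simp
      then have "\<epsilon> * ln \<delta> \<le> \<epsilon> * ln (s E0)" using e by simp
      then have a: "(\<bar>v\<bar> + 1) / (\<delta> - p) \<le> a E0" by (simp add: aE E0_def)
      then have "(\<bar>v\<bar> + 1) / (\<delta> - p) * (\<delta> - p) \<le> a E0 * (s E0 - p)"
        using l p by (intro mult_mono a) (auto intro: order_trans[OF _ a])
      then have "\<bar>v\<bar> + 1 \<le> a E0 * (s E0 - p)" using p by simp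
      moreover have "a E0 * (s E0 - p) = - (a E0 * (p - s E0))" by (simp add: algebra_simps)
      ultimately show False using opt[OF p(1) v, of E0] w0[of E0] by linarith
    qed
    then show ?thesis using smono by (intro exI[of _ E0]) (auto intro: order_trans)
  qed
  show "\<exists>v>0. \<forall>E. s E \<le> v" if nd: "\<not> (\<forall>v. \<exists>p>v. \<phi> p < \<infinity>)"
  proof -
    obtain v where "\<forall>p>v. \<not> \<phi> p < \<infinity>" using nd by blast
    then have "s E \<le> v" for E using w[of E] by (metis PInfty_neq_ereal(1) less_ereal.simps(4) not_le)
    then show ?thesis using spos by (intro exI[of _ v]) (meson less_le_trans)
  qed
  show "\<exists>u>0. \<forall>E. u \<le> s E" if nd: "\<not> (\<forall>u>0. \<exists>p\<ge>0. p < u \<and> \<phi> p < \<infinity>)"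
  proof -
    obtain u where u: "u > 0" "\<forall>p\<ge>0. p < u \<longrightarrow> \<not> \<phi> p < \<infinity>" using nd by blast
    have "u \<le> s E" for E
    proof (rule ccontr)
      assume "\<not> u \<le> s E"
      then show False using u(2) w[of E] spos[of E] by (auto dest!: spec[of _ "s E"])
    qed
    then show ?thesis using u by blast
  qed
qed

text \<open>
  Provides constant sub- and supersolutions for the Sinkhorn map, which trap its iterates.
\<close>

lemma aprox_trap:
  fixes \<phi> :: "real \<Rightarrow> ereal" and \<epsilon> :: real and a w :: "real \<Rightarrow> real"
  assumes e: "entropy_function \<phi>" "\<epsilon> > 0"
    and A2: "subgradients_reach_zero_or_infinity (legendre \<phi>)"
    and w: "\<And>E. \<phi> (exp ((E + a E) / \<epsilon>)) = ereal (w E)"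
    and opt: "\<And>E p v. 0 \<le> p \<Longrightarrow> \<phi> p = ereal v \<Longrightarrow> w E - a E * (p - exp ((E + a E) / \<epsilon>)) \<le> v"
    and mono: "\<And>E E'. E \<le> E' \<Longrightarrow> a E' \<le> a E \<and> E + a E \<le> E' + a E'"
  obtains R where "0 \<le> R" "a (c - k + a (R + k + d)) \<le> R" "- R \<le> a (c + k + a (- R - k + d))"
proof -
  define s where "s E = exp ((E + a E) / \<epsilon>)" for E
  note dens = aprox_density_at_infinity[OF e w opt mono, folded s_def]
  define D where "D \<longleftrightarrow> (\<forall>v. \<exists>p>v. \<phi> p < \<infinity>)"
  define Z where "Z \<longleftrightarrow> (\<forall>u>0. \<exists>p\<ge>0. p < u \<and> \<phi> p < \<infinity>)"
  have DZ: "D \<or> Z" unfolding D_def Z_def by (rule subgradients_domain[OF e(1) A2])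
  have spos: "0 < s E" for E by (simp add: s_def)
  have aE: "a E = \<epsilon> * ln (s E) - E" for E using e by (simp add: s_def)
  have smono: "s E \<le> s E'" if "E \<le> E'" for E E' by (rule dens(5)) (use that in auto)
  \<comment> \<open>On an unbounded domain s E grows without bound, while s(c + a E) stays bounded
    since a is antitone. On a bounded domain a E = \<epsilon> ln(s E) - E tends to -\<infinity>; the
    domain then accumulates at 0, so s(c + a E) tends to 0 while s E is at least s 0.\<close>
  have up: "\<exists>E0. \<forall>E\<ge>E0. B * s (c + a E) \<le> s E" if B: "0 < B" for B c
  proof (cases D)
    case True
    then obtain E0 where E0: "\<And>E. E0 \<le> E \<Longrightarrow> B * s (c + a 0) \<le> s E" unfolding D_def using dens(1) by blast
    have "B * s (c + a E) \<le> s E" if "max 0 E0 \<le> E" for E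
    proof -
      have "s (c + a E) \<le> s (c + a 0)" using mono[of 0 E] that by (intro smono) auto
      then have "B * s (c + a E) \<le> B * s (c + a 0)" using B by simp
      also have "\<dots> \<le> s E" using that by (intro E0) auto
      finally show ?thesis .
    qed
    then show ?thesis by blast
  next
    case False
    then obtain v where v: "0 < v" "\<And>E. s E \<le> v" unfolding D_def using dens(3) by blast
    have Z using DZ False by simp
    moreover have "0 < s 0 / B" using B spos by simp
    ultimately obtain E0 where E0: "\<And>E. E \<le> E0 \<Longrightarrow> s E \<le> s 0 / B" unfolding Z_def using dens(2) by blast
    have "B * s (c + a E) \<le> s E" if E: "max 0 (c + \<epsilon> * ln v - E0) \<le> E" for E
    proof -
      have "\<epsilon> * ln (s E) \<le> \<epsilon> * ln v" using v(2)[of E] v(1) spos[of E] e by simp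
      then have "c + a E \<le> E0" using E by (simp add: aE)
      then have "B * s (c + a E) \<le> s 0" using E0 B by (simp add: field_simps)
      also have "\<dots> \<le> s E" using E by (intro smono) simp
      finally show ?thesis .
    qed
    then show ?thesis by blast
  qed
  \<comment> \<open>The mirror image: either s E tends to 0 with s(c + a E) bounded away from 0, or
    s is bounded away from 0, a E tends to \<infinity>, and s(c + a E) grows without bound.\<close>
  have down: "\<exists>E0. \<forall>E\<le>E0. B * s E \<le> s (c + a E)" if B: "0 < B" for B c
  proof (cases Z)
    case True
    moreover have "0 < s (c + a 0) / B" using B spos by simp
    ultimately obtain E0 where E0: "\<And>E. E \<le> E0 \<Longrightarrow> s E \<le> s (c + a 0) / B" unfolding Z_def using dens(2) by blast
    have "B * s E \<le> s (c + a E)" if "E \<le> min 0 E0" for E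
    proof -
      have "B * s E \<le> s (c + a 0)" using E0[of E] that B by (simp add: field_simps)
      also have "\<dots> \<le> s (c + a E)" using mono[of E 0] that by (intro smono) auto
      finally show ?thesis .
    qed
    then show ?thesis by blast
  next
    case False
    then obtain u where u: "0 < u" "\<And>E. u \<le> s E" unfolding Z_def using dens(4) by blast
    have D using DZ False by simp
    then obtain E0 where E0: "\<And>E. E0 \<le> E \<Longrightarrow> B * s 0 \<le> s E" unfolding D_def using dens(1) by blast
    have "B * s E \<le> s (c + a E)" if E: "E \<le> min 0 (c + \<epsilon> * ln u - E0)" for E
    proof -
      have "\<epsilon> * ln u \<le> \<epsilon> * ln (s E)" using u(2)[of E] u(1) spos[of E] e by simp
      then have "E0 \<le> c + a E" using E by (simp add: aE)
      then have "B * s 0 \<le> s (c + a E)" by (rule E0)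
      moreover have "s E \<le> s 0" using E by (intro smono) simp
      then have "B * s E \<le> B * s 0" using B by simp
      ultimately show ?thesis by linarith
    qed
    then show ?thesis by blast
  qed
  \<comment> \<open>Inserting a E = \<epsilon> ln(s E) - E twice, with E = R + k + d, turns the
    upper trap inequality into exactly this comparison of densities; the lower one uses E = - R - k
    + d. In the application k bounds the cost, and c, d are \<epsilon> times the logarithms of the
    two masses.\<close>
  obtain E1 where E1: "\<And>E. E1 \<le> E \<Longrightarrow> exp ((2 * k + d - c) / \<epsilon>) * s (c - k + a E) \<le> s E"
    using up[of "exp ((2 * k + d - c) / \<epsilon>)" "c - k"] by auto
  obtain E2 where E2: "\<And>E. E \<le> E2 \<Longrightarrow> exp ((2 * k - d + c) / \<epsilon>) * s E \<le> s (c + k + a E)"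
    using down[of "exp ((2 * k - d + c) / \<epsilon>)" "c + k"] by auto
  have lg: "x + \<epsilon> * ln (s E) \<le> \<epsilon> * ln (s E')" if "exp (x / \<epsilon>) * s E \<le> s E'" for x E E'
  proof -
    have "ln (exp (x / \<epsilon>) * s E) \<le> ln (s E')" using that spos by (simp add: mult_pos_pos)
    then have "x / \<epsilon> + ln (s E) \<le> ln (s E')" using spos[of E] by (simp add: ln_mult)
    then have "\<epsilon> * (x / \<epsilon> + ln (s E)) \<le> \<epsilon> * ln (s E')" using e by simp
    then show ?thesis using e by (simp add: distrib_left)
  qed
  define R where "R = max 0 (max (E1 - k - d) (- E2 - k + d))"
  show thesis
  proof (rule that[of R])
    show "0 \<le> R" by (simp add: R_def)
    have "E1 \<le> R + k + d" by (simp add: R_def)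
    from lg[OF E1[OF this]] show "a (c - k + a (R + k + d)) \<le> R"
      unfolding aE[of "c - k + a (R + k + d)"] by (subst aE[of "R + k + d"]) simp
    have "- R - k + d \<le> E2" by (simp add: R_def)
    from lg[OF E2[OF this]] show "- R \<le> a (c + k + a (- R - k + d))"
      unfolding aE[of "c + k + a (- R - k + d)"] by (subst aE[of "- R - k + d"]) simp
  qed
qed

section \<open>The softmin operator\<close>

text \<open>This is the negative of the usual softmin of C(x, .) - g, hence increasing in g.\<close>

definition softmin :: "('a \<Rightarrow> 'a \<Rightarrow> real) \<Rightarrow> real \<Rightarrow> 'a measure \<Rightarrow> ('a \<Rightarrow> real) \<Rightarrow> 'a \<Rightarrow> real" where
  "softmin C \<epsilon> \<beta> g x = \<epsilon> * ln (\<integral>y. exp ((g y - C x y) / \<epsilon>) \<partial>\<beta>)"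

lemma nonzero_measuresD:
  assumes "\<mu> \<in> nonzero_measures"
  shows "\<mu> \<in> pos_measures" "0 < measure \<mu> UNIV"
proof -
  show p: "\<mu> \<in> pos_measures" using assms by (simp add: nonzero_measures_def)
  note m = pos_measuresD[OF p]
  interpret finite_measure \<mu> by (rule m)
  show "0 < measure \<mu> UNIV"
  proof (rule ccontr)
    assume "\<not> 0 < measure \<mu> UNIV"
    then have "measure \<mu> UNIV = 0" using measure_nonneg[of \<mu> UNIV] by linarith
    then have z: "emeasure \<mu> UNIV = 0" by (simp add: emeasure_eq_measure)
    have "\<mu> = null_measure borel"
    proof (rule measure_eqI)
      fix A assume "A \<in> sets \<mu>"
      have "emeasure \<mu> A \<le> emeasure \<mu> UNIV" using m by (intro emeasure_mono) auto
      then show "emeasure \<mu> A = emeasure (null_measure borel) A" using z by simp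
    qed (use m in simp)
    then show False using assms by (simp add: nonzero_measures_def)
  qed
qed

context
  fixes C :: "'a::compact_metric_space \<Rightarrow> 'a \<Rightarrow> real" and \<epsilon> \<gamma> K :: real and \<beta> :: "'a measure"
  assumes Cb: "\<And>x y. \<bar>C x y\<bar> \<le> K" and Cc: "continuous_on UNIV (\<lambda>z. C (fst z) (snd z))"
    and CL: "\<And>x y z. \<bar>C x z - C y z\<bar> \<le> \<gamma> * dist x y" and \<epsilon>: "\<epsilon> > 0"
    and \<beta>: "\<beta> \<in> nonzero_measures"
begin

lemma softmin_integrable:
  assumes g: "g \<in> borel_measurable borel" "\<And>y. \<bar>g y\<bar> \<le> R"
  shows "integrable \<beta> (\<lambda>y. exp ((g y - C x y) / \<epsilon>))"
proof (rule integrable_bounded[OF nonzero_measuresD(1)[OF \<beta>]])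
  have "continuous_on UNIV (\<lambda>y. C x y)"
    using continuous_on_compose2[OF Cc continuous_on_Pair[OF continuous_on_const continuous_on_id], of x UNIV] by simp
  then have "(\<lambda>y. C x y) \<in> borel_measurable borel" by (rule borel_measurable_continuous_onI)
  then show "(\<lambda>y. exp ((g y - C x y) / \<epsilon>)) \<in> borel_measurable borel" using g by measurable
  show "\<bar>exp ((g y - C x y) / \<epsilon>)\<bar> \<le> exp ((R + K) / \<epsilon>)" for y
    using g(2)[of y] Cb[of x y] \<epsilon> by (simp add: divide_right_mono)
qed

lemma exp_softmin_pos:
  assumes g: "g \<in> borel_measurable borel" "\<And>y. \<bar>g y\<bar> \<le> R"
  shows "exp (- (R + K) / \<epsilon>) * measure \<beta> UNIV \<le> (\<integral>y. exp ((g y - C x y) / \<epsilon>) \<partial>\<beta>)"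
    "0 < (\<integral>y. exp ((g y - C x y) / \<epsilon>) \<partial>\<beta>)"
proof -
  note m = pos_measuresD[OF nonzero_measuresD(1)[OF \<beta>]]
  interpret finite_measure \<beta> by (rule m)
  have "(\<integral>y. exp (- (R + K) / \<epsilon>) \<partial>\<beta>) \<le> (\<integral>y. exp ((g y - C x y) / \<epsilon>) \<partial>\<beta>)"
  proof (rule integral_mono)
    fix y
    have "- (R + K) \<le> g y - C x y" using g(2)[of y] Cb[of x y] by linarith
    then show "exp (- (R + K) / \<epsilon>) \<le> exp ((g y - C x y) / \<epsilon>)" using \<epsilon> by (simp add: divide_right_mono)
  qed (use softmin_integrable[OF g] in auto)
  then show "exp (- (R + K) / \<epsilon>) * measure \<beta> UNIV \<le> (\<integral>y. exp ((g y - C x y) / \<epsilon>) \<partial>\<beta>)"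
    using m by (simp add: mult.commute)
  then show "0 < (\<integral>y. exp ((g y - C x y) / \<epsilon>) \<partial>\<beta>)"
    using nonzero_measuresD(2)[OF \<beta>] by (smt (verit) exp_gt_zero mult_pos_pos)
qed

lemma exp_softmin:
  assumes g: "g \<in> borel_measurable borel" "\<And>y. \<bar>g y\<bar> \<le> R"
  shows "exp (softmin C \<epsilon> \<beta> g x / \<epsilon>) = (\<integral>y. exp ((g y - C x y) / \<epsilon>) \<partial>\<beta>)"
  using exp_softmin_pos(2)[OF g] \<epsilon> by (simp add: softmin_def)

text \<open>One comparison serves twice: with x = x' and t = 0 it is monotonicity in g, with g = h
  it hands the Lipschitz bound of the cost to the softmin.\<close>

lemma softmin_shift:
  assumes g: "g \<in> borel_measurable borel" "\<And>y. \<bar>g y\<bar> \<le> R"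
    and h: "h \<in> borel_measurable borel" "\<And>y. \<bar>h y\<bar> \<le> R"
    and le: "\<And>y. g y - C x y \<le> h y - C x' y + t"
  shows "softmin C \<epsilon> \<beta> g x \<le> softmin C \<epsilon> \<beta> h x' + t"
proof -
  have "(\<integral>y. exp ((g y - C x y) / \<epsilon>) \<partial>\<beta>) \<le> (\<integral>y. exp (t / \<epsilon>) * exp ((h y - C x' y) / \<epsilon>) \<partial>\<beta>)"
  proof (rule integral_mono)
    fix y
    have "(g y - C x y) / \<epsilon> \<le> (t + (h y - C x' y)) / \<epsilon>" using le[of y] \<epsilon> by (intro divide_right_mono) auto
    then show "exp ((g y - C x y) / \<epsilon>) \<le> exp (t / \<epsilon>) * exp ((h y - C x' y) / \<epsilon>)"
      by (simp add: exp_add[symmetric] add_divide_distrib[symmetric])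
  qed (use softmin_integrable[OF g] softmin_integrable[OF h] in auto)
  then have "exp (softmin C \<epsilon> \<beta> g x / \<epsilon>) \<le> exp ((softmin C \<epsilon> \<beta> h x' + t) / \<epsilon>)"
    by (simp add: exp_softmin[OF g] exp_softmin[OF h] add_divide_distrib exp_add mult.commute)
  then show ?thesis using \<epsilon> by (simp add: divide_le_cancel)
qed

lemma softmin_const:
  assumes "\<bar>R\<bar> \<le> B"
  shows "softmin C \<epsilon> \<beta> (\<lambda>_. R) x \<le> R + K + \<epsilon> * ln (measure \<beta> UNIV)"
    "R - K + \<epsilon> * ln (measure \<beta> UNIV) \<le> softmin C \<epsilon> \<beta> (\<lambda>_. R) x"
proof -
  note m = pos_measuresD[OF nonzero_measuresD(1)[OF \<beta>]]
  interpret finite_measure \<beta> by (rule m)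
  have i: "integrable \<beta> (\<lambda>y. exp ((R - C x y) / \<epsilon>))" by (rule softmin_integrable[of "\<lambda>_. R" "\<bar>R\<bar>"]) auto
  have M: "0 < measure \<beta> UNIV" by (rule nonzero_measuresD(2)[OF \<beta>])
  have pos: "0 < (\<integral>y. exp ((R - C x y) / \<epsilon>) \<partial>\<beta>)" by (rule exp_softmin_pos(2)[of "\<lambda>_. R" "\<bar>R\<bar>"]) auto
  have "(\<integral>y. exp ((R - C x y) / \<epsilon>) \<partial>\<beta>) \<le> (\<integral>y. exp ((R + K) / \<epsilon>) \<partial>\<beta>)"
    using i Cb[of x] \<epsilon> by (intro integral_mono) (auto simp: divide_right_mono abs_le_iff minus_le_iff)
  then have "ln (\<integral>y. exp ((R - C x y) / \<epsilon>) \<partial>\<beta>) \<le> ln (exp ((R + K) / \<epsilon>) * measure \<beta> UNIV)"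
    using pos m M by (simp add: mult.commute)
  then have "\<epsilon> * ln (\<integral>y. exp ((R - C x y) / \<epsilon>) \<partial>\<beta>) \<le> \<epsilon> * ((R + K) / \<epsilon> + ln (measure \<beta> UNIV))"
    using M \<epsilon> by (simp add: ln_mult)
  also have "\<dots> = \<epsilon> * ((R + K) / \<epsilon>) + \<epsilon> * ln (measure \<beta> UNIV)" by (rule distrib_left)
  finally show "softmin C \<epsilon> \<beta> (\<lambda>_. R) x \<le> R + K + \<epsilon> * ln (measure \<beta> UNIV)"
    using \<epsilon> by (simp add: softmin_def)
  have "(\<integral>y. exp ((R - K) / \<epsilon>) \<partial>\<beta>) \<le> (\<integral>y. exp ((R - C x y) / \<epsilon>) \<partial>\<beta>)"
    using i Cb[of x] \<epsilon> by (intro integral_mono) (auto simp: divide_right_mono abs_le_iff)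
  then have "ln (exp ((R - K) / \<epsilon>) * measure \<beta> UNIV) \<le> ln (\<integral>y. exp ((R - C x y) / \<epsilon>) \<partial>\<beta>)"
    using pos m M by (simp add: mult.commute mult_pos_pos)
  then have "\<epsilon> * ((R - K) / \<epsilon> + ln (measure \<beta> UNIV)) \<le> \<epsilon> * ln (\<integral>y. exp ((R - C x y) / \<epsilon>) \<partial>\<beta>)"
    using M \<epsilon> by (simp add: ln_mult)
  moreover have "\<epsilon> * ((R - K) / \<epsilon> + ln (measure \<beta> UNIV)) = \<epsilon> * ((R - K) / \<epsilon>) + \<epsilon> * ln (measure \<beta> UNIV)"
    by (rule distrib_left)
  ultimately show "R - K + \<epsilon> * ln (measure \<beta> UNIV) \<le> softmin C \<epsilon> \<beta> (\<lambda>_. R) x"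
    using \<epsilon> by (simp add: softmin_def)
qed

text \<open>The modulus of continuity comes from the cost alone, so a merely measurable bounded g
  already has a continuous softmin.\<close>

lemma softmin_continuous:
  assumes g: "g \<in> borel_measurable borel" "\<And>y. \<bar>g y\<bar> \<le> R"
  shows "continuous_on UNIV (softmin C \<epsilon> \<beta> g)"
proof -
  have *: "softmin C \<epsilon> \<beta> g x \<le> softmin C \<epsilon> \<beta> g x' + \<gamma> * dist x x'" for x x'
    using CL[of x _ x'] by (intro softmin_shift[OF g g]) (smt (verit))
  have L: "\<bar>softmin C \<epsilon> \<beta> g x - softmin C \<epsilon> \<beta> g x'\<bar> \<le> \<bar>\<gamma>\<bar> * dist x x'" for x x'
    using *[of x x'] *[of x' x] mult_right_mono[OF abs_ge_self[of \<gamma>], of "dist x x'"] by (auto simp: dist_commute)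
  show ?thesis
    unfolding continuous_on_iff
  proof (intro ballI allI impI)
    fix x :: 'a and r :: real assume r: "0 < r"
    \<comment> \<open>The constant \<gamma> may be 0; the added 1 keeps the radius positive.\<close>
    show "\<exists>d>0. \<forall>x'\<in>UNIV. dist x' x < d \<longrightarrow> dist (softmin C \<epsilon> \<beta> g x') (softmin C \<epsilon> \<beta> g x) < r"
    proof (intro exI[of _ "r / (\<bar>\<gamma>\<bar> + 1)"] conjI ballI impI)
      show "0 < r / (\<bar>\<gamma>\<bar> + 1)" using r by simp
      fix x' assume "dist x' x < r / (\<bar>\<gamma>\<bar> + 1)"
      then have "(\<bar>\<gamma>\<bar> + 1) * dist x' x < r" by (simp add: field_simps)
      moreover have "\<bar>\<gamma>\<bar> * dist x' x \<le> (\<bar>\<gamma>\<bar> + 1) * dist x' x" by (intro mult_right_mono) auto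
      ultimately show "dist (softmin C \<epsilon> \<beta> g x') (softmin C \<epsilon> \<beta> g x) < r"
        using L[of x' x] by (simp add: dist_real_def)
    qed
  qed
qed

lemma softmin_limit:
  assumes g: "\<And>n. g n \<in> borel_measurable borel" "\<And>n y. \<bar>g n y\<bar> \<le> R"
    and lim: "\<And>y. (\<lambda>n. g n y) \<longlonglongrightarrow> h y" and h: "h \<in> borel_measurable borel" "\<And>y. \<bar>h y\<bar> \<le> R"
  shows "(\<lambda>n. softmin C \<epsilon> \<beta> (g n) x) \<longlonglongrightarrow> softmin C \<epsilon> \<beta> h x"
proof -
  note m = pos_measuresD[OF nonzero_measuresD(1)[OF \<beta>]]
  interpret finite_measure \<beta> by (rule m)
  have "(\<lambda>n. \<integral>y. exp ((g n y - C x y) / \<epsilon>) \<partial>\<beta>) \<longlonglongrightarrow> (\<integral>y. exp ((h y - C x y) / \<epsilon>) \<partial>\<beta>)"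
  proof (rule integral_dominated_convergence)
    show "integrable \<beta> (\<lambda>_. exp ((R + K) / \<epsilon>))" by simp
    show "AE y in \<beta>. (\<lambda>n. exp ((g n y - C x y) / \<epsilon>)) \<longlonglongrightarrow> exp ((h y - C x y) / \<epsilon>)"
      using \<epsilon> by (intro AE_I2 tendsto_intros lim) auto
    show "AE y in \<beta>. norm (exp ((g n y - C x y) / \<epsilon>)) \<le> exp ((R + K) / \<epsilon>)" for n
    proof (rule AE_I2)
      fix y
      have "g n y - C x y \<le> R + K" using g(2)[of n y] Cb[of x y] by linarith
      then show "norm (exp ((g n y - C x y) / \<epsilon>)) \<le> exp ((R + K) / \<epsilon>)" using \<epsilon> by (simp add: divide_right_mono)
    qed
  qed (use softmin_integrable[OF g] softmin_integrable[OF h] in auto)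
  then show ?thesis unfolding softmin_def
    using exp_softmin_pos(2)[OF h, of x] by (intro tendsto_intros) auto
qed

end

section \<open>The Sinkhorn fixed point\<close>

text \<open>Each half step reverses order, because \<open>a\<close> is antitone and the softmin
  increasing, so two half steps preserve it. The limit passes through the softmin by dominated
  convergence, which asks for pointwise convergence only.\<close>

lemma potentials_exist:
  fixes C :: "'a::compact_metric_space \<Rightarrow> 'a \<Rightarrow> real" and \<alpha> \<beta> :: "'a measure"
  assumes sym: "\<And>x y. C x y = C y x" and Cc: "continuous_on UNIV (\<lambda>z. C (fst z) (snd z))"
    and CL: "\<And>x y z. \<bar>C x z - C y z\<bar> \<le> \<gamma> * dist x y"
    and e: "entropy_function \<phi>" "\<epsilon> > 0" and cont: "continuous_on {0..} \<phi>"
    and A2: "subgradients_reach_zero_or_infinity (legendre \<phi>)"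
    and m: "\<alpha> \<in> nonzero_measures" "\<beta> \<in> nonzero_measures"
  obtains f g w1 w2 :: "'a \<Rightarrow> real" where "continuous_on UNIV f" "continuous_on UNIV g"
    "\<And>x. \<phi> (\<integral>y. exp ((f x + g y - C x y) / \<epsilon>) \<partial>\<beta>) = ereal (w1 x)"
    "\<And>x p v. 0 \<le> p \<Longrightarrow> \<phi> p = ereal v \<Longrightarrow>
       w1 x - f x * (p - (\<integral>y. exp ((f x + g y - C x y) / \<epsilon>) \<partial>\<beta>)) \<le> v"
    "\<And>y. \<phi> (\<integral>x. exp ((f x + g y - C x y) / \<epsilon>) \<partial>\<alpha>) = ereal (w2 y)"
    "\<And>y p v. 0 \<le> p \<Longrightarrow> \<phi> p = ereal v \<Longrightarrow>
       w2 y - g y * (p - (\<integral>x. exp ((f x + g y - C x y) / \<epsilon>) \<partial>\<alpha>)) \<le> v"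
proof -
  obtain K where K: "0 \<le> K" "\<And>x y. \<bar>C x y\<bar> \<le> K" using cost_bounded[OF Cc] by metis
  obtain a w where aw: "\<And>E. \<phi> (exp ((E + a E) / \<epsilon>)) = ereal (w E)"
    "\<And>E p v. 0 \<le> p \<Longrightarrow> \<phi> p = ereal v \<Longrightarrow> w E - a E * (p - exp ((E + a E) / \<epsilon>)) \<le> v"
    and mono: "\<And>E E'. E \<le> E' \<Longrightarrow> a E' \<le> a E \<and> E + a E \<le> E' + a E'"
    using aprox_exists[OF e cont] by metis
  define c where "c = \<epsilon> * ln (measure \<alpha> UNIV)"
  define d where "d = \<epsilon> * ln (measure \<beta> UNIV)"
  obtain R where R: "0 \<le> R" "a (c - K + a (R + K + d)) \<le> R" "- R \<le> a (c + K + a (- R - K + d))"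
    using aprox_trap[OF e A2 aw mono, of c K d] by metis
  have anti: "a E' \<le> a E" if "E \<le> E'" for E E' using mono[OF that] by simp
  \<comment> \<open>An antitone \<open>a\<close> with E + a E monotone is 1-Lipschitz.\<close>
  have "\<bar>a E - a E'\<bar> \<le> \<bar>E - E'\<bar>" for E E'
    using mono[of E E'] mono[of E' E] by (cases "E \<le> E'") auto
  then have "isCont a E" for E
    unfolding isCont_def LIM_def dist_real_def by (metis le_less_trans)
  then have ac: "continuous_on UNIV a" by (simp add: continuous_at_imp_continuous_on)
  let ?S = "softmin C \<epsilon> \<beta>" and ?S' = "softmin C \<epsilon> \<alpha>"
  note S = K(2) Cc CL e(2) m(2) and S' = K(2) Cc CL e(2) m(1)
  define F where "F g x = a (?S g x)" for g x
  define T where "T g y = a (?S' (F g) y)" for g y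
  \<comment> \<open>\<open>q1\<close> and \<open>q2\<close> enclose the first potential as long as
    the second lies in [- R, R]; the trap inequalities then return the second to [- R, R].\<close>
  define q1 where "q1 = a (R + K + d)"
  define q2 where "q2 = a (- R - K + d)"
  define B where "B = max \<bar>q1\<bar> \<bar>q2\<bar>"
  define ok where "ok g \<longleftrightarrow> g \<in> borel_measurable borel \<and> (\<forall>y. \<bar>g y\<bar> \<le> R)" for g :: "'a \<Rightarrow> real"
  have okD: "g \<in> borel_measurable borel" "\<And>y. \<bar>g y\<bar> \<le> R" if "ok g" for g using that by (auto simp: ok_def)
  have okR: "ok (\<lambda>_. R)" "ok (\<lambda>_. - R)" using R by (auto simp: ok_def)
  have Fm: "continuous_on UNIV (F g)" if "ok g" for g
    unfolding F_def
    by (rule continuous_on_compose2[OF ac softmin_continuous[OF S okD[OF that]] subset_UNIV])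
  have Sm: "?S g x \<le> ?S h x" if "ok g" "ok h" "\<And>y. g y \<le> h y" for g h x
    using softmin_shift[OF S okD[OF that(1)] okD[OF that(2)], of x x 0] that(3) by simp
  have Fb: "q1 \<le> F g x" "F g x \<le> q2" "\<bar>F g x\<bar> \<le> B" if g: "ok g" for g x
  proof -
    have "?S g x \<le> ?S (\<lambda>_. R) x" "?S (\<lambda>_. - R) x \<le> ?S g x"
      using okD(2)[OF g] by (intro Sm g okR; force simp: abs_le_iff minus_le_iff)+
    moreover have "?S (\<lambda>_. R) x \<le> R + K + d" "- R - K + d \<le> ?S (\<lambda>_. - R) x"
      using softmin_const(1)[OF S order_refl, of R x] softmin_const(2)[OF S order_refl, of "- R" x] by (auto simp: d_def)
    ultimately show "q1 \<le> F g x" "F g x \<le> q2" unfolding F_def q1_def q2_def by (auto intro!: anti)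
    then show "\<bar>F g x\<bar> \<le> B" by (auto simp: B_def)
  qed
  have Fmeas: "F g \<in> borel_measurable borel" if "ok g" for g
    by (rule borel_measurable_continuous_onI[OF Fm[OF that]])
  have S'm: "?S' g x \<le> ?S' h x" if "g \<in> borel_measurable borel" "\<And>y. \<bar>g y\<bar> \<le> B"
      "h \<in> borel_measurable borel" "\<And>y. \<bar>h y\<bar> \<le> B" "\<And>y. g y \<le> h y" for g h x
    using softmin_shift[OF S' that(1-4), of x x 0] that(5) by simp
  have Tb: "\<bar>T g y\<bar> \<le> R" if g: "ok g" for g y
  proof -
    have "?S' (F g) y \<le> ?S' (\<lambda>_. q2) y" "?S' (\<lambda>_. q1) y \<le> ?S' (F g) y"
      using Fb[OF g] by (intro S'm Fmeas g; force simp: B_def)+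
    moreover have "?S' (\<lambda>_. q2) y \<le> c + K + q2" "c - K + q1 \<le> ?S' (\<lambda>_. q1) y"
      using softmin_const(1)[OF S' order_refl, of q2 y] softmin_const(2)[OF S' order_refl, of q1 y] by (auto simp: c_def)
    ultimately have "a (c + K + q2) \<le> T g y" "T g y \<le> a (c - K + q1)" unfolding T_def by (auto intro!: anti)
    then show ?thesis using R by (simp add: q1_def q2_def)
  qed
  have Tc: "continuous_on UNIV (T g)" if "ok g" for g
    unfolding T_def
    by (rule continuous_on_compose2[OF ac softmin_continuous[OF S' Fmeas[OF that] Fb(3)[OF that]] subset_UNIV])
  have Tok: "ok (T g)" if "ok g" for g
    unfolding ok_def using Tb[OF that] borel_measurable_continuous_onI[OF Tc[OF that]] by auto
  have Tm: "T g y \<le> T h y" if gh: "ok g" "ok h" "\<And>y. g y \<le> h y" for g h y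
    unfolding T_def by (intro anti S'm Fmeas Fb(3) gh(1,2)) (auto simp: F_def intro!: anti Sm gh)
  \<comment> \<open>Starting at the lower barrier makes the first step upward, and monotonicity of
    \<open>T\<close> passes this on to all later steps.\<close>
  define G where "G n = (T ^^ n) (\<lambda>_. - R)" for n
  have G: "G 0 = (\<lambda>_. - R)" "\<And>n. G (Suc n) = T (G n)" by (simp_all add: G_def)
  have Gok: "ok (G n)" for n by (induction n) (auto simp: G okR intro: Tok)
  have Ginc: "G n y \<le> G (Suc n) y" for n y
  proof (induction n arbitrary: y)
    case 0 then show ?case using okD(2)[OF Gok, of 1 y] by (simp add: G abs_le_iff)
  next
    case (Suc n) then show ?case unfolding G(2) by (intro Tm Tok Gok) (simp add: G(2)[symmetric])
  qed
  define g where "g y = (SUP n. G n y)" for y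
  have lim: "(\<lambda>n. G n y) \<longlonglongrightarrow> g y" for y
    unfolding g_def
  proof (rule LIMSEQ_incseq_SUP)
    show "bdd_above (range (\<lambda>n. G n y))" using okD(2)[OF Gok] by (intro bdd_aboveI[of _ R]) (auto simp: abs_le_iff)
    show "incseq (\<lambda>n. G n y)" using Ginc by (rule incseq_SucI)
  qed
  have gok: "ok g" unfolding ok_def
  proof (intro conjI allI)
    show "g \<in> borel_measurable borel" by (rule borel_measurable_LIMSEQ_real[OF lim okD(1)[OF Gok]])
    fix y
    have "(\<lambda>n. \<bar>G n y\<bar>) \<longlonglongrightarrow> \<bar>g y\<bar>" by (intro tendsto_intros lim)
    then show "\<bar>g y\<bar> \<le> R" by (rule LIMSEQ_le_const2) (auto intro: okD(2)[OF Gok])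
  qed
  have a_lim: "(\<lambda>n. a (X n)) \<longlonglongrightarrow> a E" if "X \<longlonglongrightarrow> E" for X E
    using isCont_tendsto_compose[OF \<open>\<And>E. isCont a E\<close> that] .
  have Flim: "(\<lambda>n. F (G n) x) \<longlonglongrightarrow> F g x" for x
    unfolding F_def by (intro a_lim softmin_limit[OF S okD[OF Gok] lim okD[OF gok]])
  have "(\<lambda>n. T (G n) y) \<longlonglongrightarrow> T g y" for y
    unfolding T_def by (intro a_lim softmin_limit[OF S' Fmeas[OF Gok] Fb(3)[OF Gok] Flim Fmeas[OF gok] Fb(3)[OF gok]])
  moreover have "(\<lambda>n. T (G n) y) \<longlonglongrightarrow> g y" for y using LIMSEQ_Suc[OF lim[of y]] by (simp add: G)
  ultimately have fix_g: "T g y = g y" for y using LIMSEQ_unique by blast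
  define f where "f = F g"
  \<comment> \<open>At each x the marginal density is exp((E + a E) / \<epsilon>) with E the softmin
    at x and f x = a E, so the optimality conditions of \<open>aprox_exists\<close> hold
    pointwise.\<close>
  have s1: "(\<integral>y. exp ((f x + g y - C x y) / \<epsilon>) \<partial>\<beta>) = exp ((?S g x + a (?S g x)) / \<epsilon>)" for x
  proof -
    have "(\<integral>y. exp ((f x + g y - C x y) / \<epsilon>) \<partial>\<beta>) = (\<integral>y. exp (f x / \<epsilon>) * exp ((g y - C x y) / \<epsilon>) \<partial>\<beta>)"
      by (simp add: exp_add[symmetric] add_divide_distrib[symmetric] add_diff_eq)
    also have "\<dots> = exp (f x / \<epsilon>) * exp (?S g x / \<epsilon>)"
      using exp_softmin[OF S okD[OF gok], of x] by simp
    finally show ?thesis by (simp add: f_def F_def exp_add[symmetric] add_divide_distrib[symmetric] add.commute)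
  qed
  \<comment> \<open>Symmetry of the cost enters here: \<open>?S'\<close> at y integrates over C y
    x.\<close>
  have s2: "(\<integral>x. exp ((f x + g y - C x y) / \<epsilon>) \<partial>\<alpha>) = exp ((?S' f y + a (?S' f y)) / \<epsilon>)" for y
  proof -
    have "(\<integral>x. exp ((f x + g y - C x y) / \<epsilon>) \<partial>\<alpha>) = (\<integral>x. exp (g y / \<epsilon>) * exp ((f x - C y x) / \<epsilon>) \<partial>\<alpha>)"
      by (simp add: exp_add[symmetric] add_divide_distrib[symmetric] add_diff_eq sym[of _ y] add.commute)
    also have "\<dots> = exp (g y / \<epsilon>) * exp (?S' f y / \<epsilon>)"
      using exp_softmin[OF S' Fmeas[OF gok] Fb(3)[OF gok], of y] by (simp add: f_def)
    finally show ?thesis using fix_g[of y]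
      by (simp add: T_def f_def exp_add[symmetric] add_divide_distrib[symmetric] add.commute)
  qed
  have fx: "f x = a (?S g x)" and gy: "g y = a (?S' f y)" for x y
    using fix_g[of y] by (simp_all add: f_def F_def T_def)
  have "continuous_on UNIV f" unfolding f_def by (rule Fm[OF gok])
  \<comment> \<open>As a pointwise limit \<open>g\<close> is so far only measurable;
    \<open>T\<close> has continuous values, so the fixed point equation makes it continuous.\<close>
  moreover have "g = T g" using fix_g by auto
  then have "continuous_on UNIV g" using Tc[OF gok] by simp
  ultimately show thesis
  proof (rule that[of f g "\<lambda>x. w (?S g x)" "\<lambda>y. w (?S' f y)"])
    fix x p v assume "0 \<le> p" "\<phi> p = ereal v"
    then show "w (?S g x) - f x * (p - (\<integral>y. exp ((f x + g y - C x y) / \<epsilon>) \<partial>\<beta>)) \<le> v"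
      unfolding s1 unfolding fx by (rule aw(2))
  next
    fix y p v assume "0 \<le> p" "\<phi> p = ereal v"
    then show "w (?S' f y) - g y * (p - (\<integral>x. exp ((f x + g y - C x y) / \<epsilon>) \<partial>\<alpha>)) \<le> v"
      unfolding s2 unfolding gy by (rule aw(2))
  qed (simp_all add: s1 s2 aw(1))
qed

section \<open>Integrals along weak* convergent sequences\<close>

lemma compact_space_bounded:
  fixes f :: "'a::compact_metric_space \<Rightarrow> real"
  assumes "continuous_on UNIV f"
  obtains K where "0 \<le> K" "\<And>x. \<bar>f x\<bar> \<le> K"
proof -
  have "bounded (range f)"
    using assms compact_UNIV by (intro compact_imp_bounded compact_continuous_image)
  then obtain K where "\<And>x. \<bar>f x\<bar> \<le> K" by (auto simp: bounded_iff)
  then show ?thesis using that[of "max 0 K"] by (simp add: le_max_iff_disj)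
qed

lemma product_compact_space_bounded:
  fixes k :: "'a::compact_metric_space \<times> 'a \<Rightarrow> real"
  assumes "continuous_on UNIV k"
  obtains K where "0 \<le> K" "\<And>z. \<bar>k z\<bar> \<le> K"
proof -
  have "continuous_on UNIV (\<lambda>z. k (fst z, snd z))" using assms by simp
  then obtain K where K: "0 \<le> K" "\<And>x y. \<bar>k (x, y)\<bar> \<le> K" using cost_bounded[of "\<lambda>x y. k (x, y)"] by metis
  show thesis
  proof (rule that[OF K(1)])
    show "\<bar>k z\<bar> \<le> K" for z using K(2)[of "fst z" "snd z"] by simp
  qed
qed

lemma integrable_continuous:
  fixes f :: "'a::compact_metric_space \<Rightarrow> real"
  assumes "\<mu> \<in> pos_measures" "continuous_on UNIV f"
  shows "integrable \<mu> f"
proof -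
  obtain K where "0 \<le> K" "\<And>x. \<bar>f x\<bar> \<le> K" using compact_space_bounded[OF assms(2)] by blast
  from integrable_bounded[OF assms(1) borel_measurable_continuous_onI[OF assms(2)] this(2)] show ?thesis .
qed

lemma integrable_product_continuous:
  fixes k :: "'a::compact_metric_space \<times> 'a \<Rightarrow> real"
  assumes "\<mu> \<in> pos_measures" "continuous_on UNIV k"
  shows "integrable \<mu> k"
proof -
  obtain K where "0 \<le> K" "\<And>z. \<bar>k z\<bar> \<le> K" using product_compact_space_bounded[OF assms(2)] by blast
  from integrable_bounded[OF assms(1) borel_measurable_continuous_onI[OF assms(2)] this(2)] show ?thesis .
qed

lemma weak_star_mass_bounded:
  fixes \<mu>s :: "nat \<Rightarrow> 'a::topological_space measure"
  assumes "\<And>n. \<mu>s n \<in> pos_measures" "\<mu> \<in> pos_measures" "weak_star_conv \<mu>s \<mu>"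
  obtains M where "0 < M" "\<And>n. measure (\<mu>s n) UNIV \<le> M" "measure \<mu> UNIV \<le> M"
proof -
  have "(\<lambda>n. measure (\<mu>s n) UNIV) \<longlonglongrightarrow> measure \<mu> UNIV"
    using assms(3)[unfolded weak_star_conv_def, rule_format, of "\<lambda>_. 1"]
      pos_measuresD(2)[OF assms(1)] pos_measuresD(2)[OF assms(2)] by simp
  then have "Bseq (\<lambda>n. measure (\<mu>s n) UNIV)" by (rule convergent_imp_Bseq[OF convergentI])
  then obtain M where "\<And>n. \<bar>measure (\<mu>s n) UNIV\<bar> \<le> M" by (auto simp: Bseq_def)
  then show ?thesis using that[of "max 1 (max M (measure \<mu> UNIV))"] by (auto simp: le_max_iff_disj)
qed

lemma abs_integral_diff_le:
  fixes f g :: "'a::compact_metric_space \<Rightarrow> real"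
  assumes m: "\<mu> \<in> pos_measures" and c: "continuous_on UNIV f" "continuous_on UNIV g"
    and le: "\<And>x. \<bar>f x - g x\<bar> \<le> e" and M: "measure \<mu> UNIV \<le> M"
  shows "\<bar>(\<integral>x. f x \<partial>\<mu>) - (\<integral>x. g x \<partial>\<mu>)\<bar> \<le> e * M"
proof -
  note p = pos_measuresD[OF m]
  interpret finite_measure \<mu> by (rule p)
  note i = integrable_continuous[OF m c(1)] integrable_continuous[OF m c(2)]
  have "0 \<le> e" using le[of undefined] by linarith
  have "\<bar>(\<integral>x. f x \<partial>\<mu>) - (\<integral>x. g x \<partial>\<mu>)\<bar> = \<bar>\<integral>x. f x - g x \<partial>\<mu>\<bar>" using i by simp
  also have "\<dots> \<le> (\<integral>x. \<bar>f x - g x\<bar> \<partial>\<mu>)" by (rule integral_abs_bound)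
  also have "\<dots> \<le> (\<integral>x. e \<partial>\<mu>)" using i le by (intro integral_mono) auto
  also have "\<dots> = e * measure \<mu> UNIV" using p by simp
  also have "\<dots> \<le> e * M" using M \<open>0 \<le> e\<close> by (rule mult_left_mono)
  finally show ?thesis .
qed

text \<open>Masses are bounded along a weak* convergent sequence (test function 1), so a uniformly
  small error of the integrand stays small after integration.\<close>

lemma weak_star_uniform_limit:
  fixes \<mu>s :: "nat \<Rightarrow> 'a::compact_metric_space measure" and U :: "nat \<Rightarrow> 'a \<Rightarrow> real" and V :: "'a \<Rightarrow> real"
  assumes m: "\<And>n. \<mu>s n \<in> pos_measures" "\<mu> \<in> pos_measures" "weak_star_conv \<mu>s \<mu>"
    and c: "\<And>n. continuous_on UNIV (U n)" "continuous_on UNIV V"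
    and u: "uniform_limit UNIV U V sequentially"
  shows "(\<lambda>n. \<integral>x. U n x \<partial>\<mu>s n) \<longlonglongrightarrow> (\<integral>x. V x \<partial>\<mu>)"
proof -
  obtain M where M: "0 < M" "\<And>n. measure (\<mu>s n) UNIV \<le> M" using weak_star_mass_bounded[OF m] by metis
  have "(\<lambda>n. (\<integral>x. U n x \<partial>\<mu>s n) - (\<integral>x. V x \<partial>\<mu>s n)) \<longlonglongrightarrow> 0"
  proof (rule LIMSEQ_I)
    fix r :: real assume r: "0 < r"
    then have "0 < r / (2 * M)" using M by simp
    then obtain N where N: "\<And>n x. N \<le> n \<Longrightarrow> dist (U n x) (V x) < r / (2 * M)"
      using uniform_limitD[OF u] unfolding eventually_sequentially by blast
    have "\<bar>(\<integral>x. U n x \<partial>\<mu>s n) - (\<integral>x. V x \<partial>\<mu>s n)\<bar> \<le> r / (2 * M) * M" if "N \<le> n" for n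
      using N[OF that] by (intro abs_integral_diff_le m c M) (simp add: dist_real_def less_imp_le)
    then have "\<bar>(\<integral>x. U n x \<partial>\<mu>s n) - (\<integral>x. V x \<partial>\<mu>s n)\<bar> < r" if "N \<le> n" for n
      using that M r by (force simp: field_simps)
    then show "\<exists>no. \<forall>n\<ge>no. norm ((\<integral>x. U n x \<partial>\<mu>s n) - (\<integral>x. V x \<partial>\<mu>s n) - 0) < r" by auto
  qed
  moreover have "(\<lambda>n. \<integral>x. V x \<partial>\<mu>s n) \<longlonglongrightarrow> (\<integral>x. V x \<partial>\<mu>)" using m(3) c(2) by (simp add: weak_star_conv_def)
  ultimately have "(\<lambda>n. ((\<integral>x. U n x \<partial>\<mu>s n) - (\<integral>x. V x \<partial>\<mu>s n)) + (\<integral>x. V x \<partial>\<mu>s n)) \<longlonglongrightarrow> 0 + (\<integral>x. V x \<partial>\<mu>)"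
    by (rule tendsto_add)
  then show ?thesis by simp
qed

lemma equicontinuous_slices:
  fixes k :: "'a::compact_metric_space \<times> 'a \<Rightarrow> real"
  assumes "continuous_on UNIV k" "0 < e"
  obtains d where "0 < d" "\<And>x x' y. dist x x' < d \<Longrightarrow> \<bar>k (x, y) - k (x', y)\<bar> \<le> e"
proof -
  have "compact (UNIV :: ('a \<times> 'a) set)" using compact_Times[OF compact_UNIV compact_UNIV] by simp
  then have "uniformly_continuous_on UNIV k" using assms(1) by (rule compact_uniformly_continuous[rotated])
  then obtain d where d: "0 < d" "\<And>z z'. dist z' z < d \<Longrightarrow> dist (k z') (k z) < e"
    using assms(2) unfolding uniformly_continuous_on_def by blast
  have "\<bar>k (x, y) - k (x', y)\<bar> \<le> e" if "dist x x' < d" for x x' y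
    using d(2)[of "(x, y)" "(x', y)"] that by (simp add: dist_Pair_Pair dist_real_def)
  then show ?thesis using that d(1) by blast
qed

lemma continuous_slice:
  fixes k :: "'a::topological_space \<times> 'a \<Rightarrow> real"
  assumes "continuous_on UNIV k" shows "continuous_on UNIV (\<lambda>y. k (x, y))"
  using continuous_on_compose2[OF assms continuous_on_Pair[OF continuous_on_const continuous_on_id], of x UNIV] by simp

lemma continuous_partial_integral:
  fixes k :: "'a::compact_metric_space \<times> 'a \<Rightarrow> real"
  assumes m: "\<mu> \<in> pos_measures" and k: "continuous_on UNIV k"
  shows "continuous_on UNIV (\<lambda>x. \<integral>y. k (x, y) \<partial>\<mu>)"
  unfolding continuous_on_iff
proof (intro ballI allI impI)
  fix x :: 'a and r :: real assume r: "0 < r"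
  define M where "M = measure \<mu> UNIV + 1"
  have M: "0 < M" "measure \<mu> UNIV \<le> M" using measure_nonneg[of \<mu> UNIV] unfolding M_def by linarith+
  have "0 < r / (2 * M)" using r M by simp
  from equicontinuous_slices[OF k this] obtain d where d: "0 < d"
    "\<And>x x' y. dist x x' < d \<Longrightarrow> \<bar>k (x, y) - k (x', y)\<bar> \<le> r / (2 * M)" by metis
  have "dist (\<integral>y. k (x', y) \<partial>\<mu>) (\<integral>y. k (x, y) \<partial>\<mu>) < r" if "dist x' x < d" for x'
  proof -
    have "\<bar>(\<integral>y. k (x', y) \<partial>\<mu>) - (\<integral>y. k (x, y) \<partial>\<mu>)\<bar> \<le> r / (2 * M) * M"
      by (intro abs_integral_diff_le m continuous_slice k d(2) that M)
    also have "\<dots> < r" using r M by simp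
    finally show ?thesis by (simp add: dist_real_def)
  qed
  then show "\<exists>d>0. \<forall>x'\<in>UNIV. dist x' x < d \<longrightarrow> dist (\<integral>y. k (x', y) \<partial>\<mu>) (\<integral>y. k (x, y) \<partial>\<mu>) < r"
    using d(1) by blast
qed

text \<open>Weak* convergence is pointwise in x. Bounded masses and uniformly continuous k make the
  partial integrals equicontinuous, so control on a finite net spreads to the whole space, with
  three errors of at most r / 4.\<close>

lemma uniform_limit_partial_integral:
  fixes k :: "'a::compact_metric_space \<times> 'a \<Rightarrow> real"
  assumes m: "\<And>n. \<mu>s n \<in> pos_measures" "\<mu> \<in> pos_measures" "weak_star_conv \<mu>s \<mu>"
    and k: "continuous_on UNIV k"
  shows "uniform_limit UNIV (\<lambda>n x. \<integral>y. k (x, y) \<partial>\<mu>s n) (\<lambda>x. \<integral>y. k (x, y) \<partial>\<mu>) sequentially"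
proof (rule uniform_limitI)
  fix r :: real assume r: "0 < r"
  obtain M where M: "0 < M" "\<And>n. measure (\<mu>s n) UNIV \<le> M" "measure \<mu> UNIV \<le> M"
    using weak_star_mass_bounded[OF m] by metis
  have "0 < r / (4 * M)" using r M by simp
  from equicontinuous_slices[OF k this] obtain d where d: "0 < d"
    "\<And>x x' y. dist x x' < d \<Longrightarrow> \<bar>k (x, y) - k (x', y)\<bar> \<le> r / (4 * M)" by metis
  obtain N where N: "finite N" "(UNIV :: 'a set) \<subseteq> (\<Union>x\<in>N. ball x d)"
    using compact_UNIV[where 'a='a] d(1) unfolding compact_eq_totally_bounded by blast
  have "eventually (\<lambda>n. \<forall>x\<in>N. dist (\<integral>y. k (x, y) \<partial>\<mu>s n) (\<integral>y. k (x, y) \<partial>\<mu>) < r / 4) sequentially"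
  proof (rule eventually_ball_finite[OF N(1)], intro ballI)
    fix x
    have "(\<lambda>n. \<integral>y. k (x, y) \<partial>\<mu>s n) \<longlonglongrightarrow> (\<integral>y. k (x, y) \<partial>\<mu>)"
      using m(3) continuous_slice[OF k, of x] by (simp add: weak_star_conv_def)
    then show "eventually (\<lambda>n. dist (\<integral>y. k (x, y) \<partial>\<mu>s n) (\<integral>y. k (x, y) \<partial>\<mu>) < r / 4) sequentially"
      using r by (intro tendstoD) auto
  qed
  then show "eventually (\<lambda>n. \<forall>x\<in>UNIV. dist (\<integral>y. k (x, y) \<partial>\<mu>s n) (\<integral>y. k (x, y) \<partial>\<mu>) < r) sequentially"
  proof eventually_elim
    case (elim n)
    show ?case
    proof
      fix x
      have "x \<in> (\<Union>z\<in>N. ball z d)" using N(2) by blast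
      then obtain z where z: "z \<in> N" "dist z x < d" by auto
      have "\<bar>(\<integral>y. k (z, y) \<partial>\<mu>s n) - (\<integral>y. k (x, y) \<partial>\<mu>s n)\<bar> \<le> r / (4 * M) * M"
        "\<bar>(\<integral>y. k (z, y) \<partial>\<mu>) - (\<integral>y. k (x, y) \<partial>\<mu>)\<bar> \<le> r / (4 * M) * M"
        by (intro abs_integral_diff_le m continuous_slice k d(2) z M)+
      moreover have "r / (4 * M) * M = r / 4" using M by simp
      moreover have "\<bar>(\<integral>y. k (z, y) \<partial>\<mu>s n) - (\<integral>y. k (z, y) \<partial>\<mu>)\<bar> < r / 4"
        using elim z(1) by (simp add: dist_real_def)
      ultimately show "dist (\<integral>y. k (x, y) \<partial>\<mu>s n) (\<integral>y. k (x, y) \<partial>\<mu>) < r"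
        unfolding dist_real_def using r by linarith
    qed
  qed
qed

lemma continuous_swap:
  fixes k :: "'a::topological_space \<times> 'a \<Rightarrow> real"
  assumes "continuous_on UNIV k" shows "continuous_on UNIV (\<lambda>z. k (snd z, fst z))"
  by (rule continuous_on_compose2[OF assms]) (auto intro!: continuous_intros)

lemma integral_pair_measure:
  fixes k :: "'a::compact_metric_space \<times> 'a \<Rightarrow> real"
  assumes m: "\<alpha> \<in> pos_measures" "\<beta> \<in> pos_measures" and k: "continuous_on UNIV k"
  shows "(\<integral>z. k z \<partial>(\<alpha> \<Otimes>\<^sub>M \<beta>)) = (\<integral>x. (\<integral>y. k (x, y) \<partial>\<beta>) \<partial>\<alpha>)"
    "(\<integral>z. k z \<partial>(\<alpha> \<Otimes>\<^sub>M \<beta>)) = (\<integral>y. (\<integral>x. k (x, y) \<partial>\<alpha>) \<partial>\<beta>)"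
proof -
  interpret pair_sigma_finite \<alpha> \<beta>
    using pos_measuresD(4)[OF m(1)] pos_measuresD(4)[OF m(2)] by (simp add: pair_sigma_finite_def)
  have i: "integrable (\<alpha> \<Otimes>\<^sub>M \<beta>) k"
    by (rule integrable_product_continuous[OF pair_measure_in_pos_measures[OF m] k])
  show "(\<integral>z. k z \<partial>(\<alpha> \<Otimes>\<^sub>M \<beta>)) = (\<integral>x. (\<integral>y. k (x, y) \<partial>\<beta>) \<partial>\<alpha>)"
    using integral_fst'[OF i] by simp
  show "(\<integral>z. k z \<partial>(\<alpha> \<Otimes>\<^sub>M \<beta>)) = (\<integral>y. (\<integral>x. k (x, y) \<partial>\<alpha>) \<partial>\<beta>)"
    using integral_snd[of "\<lambda>x y. k (x, y)"] i by simp
qed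

text \<open>The inner integral converges uniformly, so the outer limit may be taken with a varying
  integrand; approximation by sums of product functions is bypassed.\<close>

lemma tendsto_integral_pair_measure:
  fixes k :: "'a::compact_metric_space \<times> 'a \<Rightarrow> real"
  assumes a: "\<And>n. \<alpha>s n \<in> pos_measures" "\<alpha> \<in> pos_measures" "weak_star_conv \<alpha>s \<alpha>"
    and b: "\<And>n. \<beta>s n \<in> pos_measures" "\<beta> \<in> pos_measures" "weak_star_conv \<beta>s \<beta>"
    and k: "continuous_on UNIV k"
  shows "(\<lambda>n. \<integral>z. k z \<partial>(\<alpha>s n \<Otimes>\<^sub>M \<beta>s n)) \<longlonglongrightarrow> (\<integral>z. k z \<partial>(\<alpha> \<Otimes>\<^sub>M \<beta>))"
proof -
  have "(\<lambda>n. \<integral>x. (\<integral>y. k (x, y) \<partial>\<beta>s n) \<partial>\<alpha>s n) \<longlonglongrightarrow> (\<integral>x. (\<integral>y. k (x, y) \<partial>\<beta>) \<partial>\<alpha>)"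
  proof (rule weak_star_uniform_limit[OF a])
    show "continuous_on UNIV (\<lambda>x. \<integral>y. k (x, y) \<partial>\<beta>s n)" for n by (rule continuous_partial_integral[OF b(1) k])
    show "continuous_on UNIV (\<lambda>x. \<integral>y. k (x, y) \<partial>\<beta>)" by (rule continuous_partial_integral[OF b(2) k])
  qed (rule uniform_limit_partial_integral[OF b k])
  then show ?thesis
    by (simp only: integral_pair_measure(1)[OF a(1) b(1) k] integral_pair_measure(1)[OF a(2) b(2) k])
qed

section \<open>Weak* continuity\<close>

text \<open>\<phi> may be infinite, so \<open>Us\<close> must first be kept inside its domain.
  Continuity into the extended reals makes the positive part of the domain open; the compact range
  of \<open>U\<close> has a compact neighbourhood in it, on which \<phi> is uniformly
  continuous.\<close>

lemma uniform_limit_entropy: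
  fixes Us :: "nat \<Rightarrow> 'a::compact_metric_space \<Rightarrow> real"
  assumes e: "entropy_function \<phi>" and cont: "continuous_on {0..} \<phi>"
    and U: "continuous_on UNIV U" "\<And>x. 0 < U x" "\<And>x. \<phi> (U x) = ereal (w x)"
    and Us: "\<And>n. continuous_on UNIV (Us n)" "uniform_limit UNIV Us U sequentially"
  shows "continuous_on UNIV w"
    and "\<exists>wn. (\<forall>n. continuous_on UNIV (wn n)) \<and> uniform_limit UNIV wn w sequentially \<and>
      eventually (\<lambda>n. \<forall>x. \<phi> (Us n x) = ereal (wn n x)) sequentially"
proof -
  define D where "D = {0<..} \<inter> \<phi> -` {..<\<infinity>}"
  define \<psi> where "\<psi> = real_of_ereal \<circ> \<phi>"
  have "continuous_on {0<..} \<phi>" using cont by (rule continuous_on_subset) auto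
  then have D: "open D" unfolding D_def by (intro continuous_open_preimage) auto
  have \<psi>: "\<phi> p = ereal (\<psi> p)" if "p \<in> D" for p
    using that entropy_functionD(2)[OF e, of p] by (cases "\<phi> p") (auto simp: D_def \<psi>_def)
  have "continuous_on D \<phi>" using cont by (rule continuous_on_subset) (auto simp: D_def)
  moreover have "\<bar>\<phi> p\<bar> \<noteq> \<infinity>" if "p \<in> D" for p using \<psi>[OF that] by simp
  ultimately have \<psi>c: "continuous_on D \<psi>" unfolding \<psi>_def by (subst continuous_on_iff_real[symmetric]) auto
  define S where "S = range U"
  have S: "compact S" "S \<subseteq> D"
    unfolding S_def using U compact_UNIV by (auto simp: D_def intro!: compact_continuous_image)
  obtain d where d: "0 < d" "(\<Union>x\<in>S. cball x d) \<subseteq> D"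
    using compact_subset_open_imp_cball_epsilon_subset[OF S(1) D S(2)] by metis
  define S' where "S' = {x + y | x y. x \<in> S \<and> y \<in> cball 0 d}"
  have "S' \<subseteq> (\<Union>x\<in>S. cball x d)" by (auto simp: S'_def dist_real_def)
  then have S'D: "S' \<subseteq> D" using d by blast
  have "compact S'" unfolding S'_def by (intro compact_sums S compact_cball)
  then have uc: "uniformly_continuous_on S' \<psi>"
    using continuous_on_subset[OF \<psi>c S'D] by (intro compact_uniformly_continuous)
  have in_S': "p \<in> S'" if "dist p (U x) < d" for p x
    unfolding S'_def using that
    by (intro CollectI exI[of _ "U x"] exI[of _ "p - U x"]) (auto simp: S_def dist_real_def abs_minus_commute)
  have US': "U x \<in> S'" for x using in_S'[of "U x" x] d by simp
  have w: "w x = \<psi> (U x)" for x using \<psi>[of "U x"] U(3)[of x] S'D US'[of x] by auto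
  show wc: "continuous_on UNIV w"
    unfolding w[abs_def] using S'D US' by (intro continuous_on_compose2[OF \<psi>c U(1)]) auto
  define good where "good n \<longleftrightarrow> (\<forall>x. dist (Us n x) (U x) < d)" for n
  \<comment> \<open>Finitely many n may leave the neighbourhood; there \<open>w\<close> is a
    continuous placeholder.\<close>
  define wn where "wn n = (if good n then \<lambda>x. \<psi> (Us n x) else w)" for n
  have evgood: "eventually good sequentially"
    using uniform_limitD[OF Us(2) d(1)] by (simp add: good_def[abs_def])
  have "continuous_on UNIV (wn n)" for n
  proof (cases "good n")
    case True
    then have "Us n x \<in> D" for x using in_S'[of "Us n x" x] S'D by (auto simp: good_def)
    then show ?thesis using True by (auto simp: wn_def intro!: continuous_on_compose2[OF \<psi>c Us(1)])
  qed (simp add: wn_def wc)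
  moreover have "uniform_limit UNIV wn w sequentially"
  proof (rule uniform_limitI)
    fix r :: real assume "0 < r"
    then obtain \<delta> where \<delta>: "0 < \<delta>" "\<And>p q. p \<in> S' \<Longrightarrow> q \<in> S' \<Longrightarrow> dist q p < \<delta> \<Longrightarrow> dist (\<psi> q) (\<psi> p) < r"
      using uc unfolding uniformly_continuous_on_def by blast
    show "eventually (\<lambda>n. \<forall>x\<in>UNIV. dist (wn n x) (w x) < r) sequentially"
      using uniform_limitD[OF Us(2) \<delta>(1)] evgood
    proof eventually_elim
      case (elim n)
      have "dist (\<psi> (Us n x)) (\<psi> (U x)) < r" for x
        using elim in_S'[of "Us n x" x] US'[of x] by (intro \<delta>(2)) (auto simp: good_def)
      then show ?case using elim(2) by (simp add: wn_def w)
    qed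
  qed
  moreover have "eventually (\<lambda>n. \<forall>x. \<phi> (Us n x) = ereal (wn n x)) sequentially"
    using evgood
  proof eventually_elim
    case (elim n)
    then have "Us n x \<in> D" for x using in_S'[of "Us n x" x] S'D by (auto simp: good_def)
    then show ?case using \<psi> elim by (simp add: wn_def)
  qed
  ultimately show "\<exists>wn. (\<forall>n. continuous_on UNIV (wn n)) \<and> uniform_limit UNIV wn w sequentially \<and>
      eventually (\<lambda>n. \<forall>x. \<phi> (Us n x) = ereal (wn n x)) sequentially" by blast
qed

definition gibbs :: "('a \<Rightarrow> 'a \<Rightarrow> real) \<Rightarrow> real \<Rightarrow> ('a \<Rightarrow> real) \<Rightarrow> ('a \<Rightarrow> real) \<Rightarrow> 'a \<times> 'a \<Rightarrow> real" where
  "gibbs C \<epsilon> f g z = exp ((f (fst z) + g (snd z) - C (fst z) (snd z)) / \<epsilon>)"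

lemma gibbs_continuous:
  fixes C :: "'a::compact_metric_space \<Rightarrow> 'a \<Rightarrow> real"
  assumes "continuous_on UNIV (\<lambda>z. C (fst z) (snd z))" "continuous_on UNIV f" "continuous_on UNIV g" "\<epsilon> > 0"
  shows "continuous_on UNIV (gibbs C \<epsilon> f g)"
  unfolding gibbs_def[abs_def] using assms
  by (intro continuous_intros continuous_on_compose2[OF assms(2)] continuous_on_compose2[OF assms(3)]) auto

lemma nn_integral_continuous:
  assumes m: "\<mu> \<in> pos_measures" and k: "continuous_on UNIV k" "\<And>x. 0 \<le> k (x :: 'a::compact_metric_space)"
  shows "(\<integral>\<^sup>+x. ennreal (k x) \<partial>\<mu>) = ennreal (\<integral>x. k x \<partial>\<mu>)"
  using k by (intro nn_integral_eq_integral integrable_continuous m) auto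

lemma marginals_density:
  fixes r :: "'a::compact_metric_space \<times> 'a \<Rightarrow> real"
  assumes m: "\<alpha> \<in> pos_measures" "\<beta> \<in> pos_measures" and r: "continuous_on UNIV r" "\<And>z. 0 \<le> r z"
  defines "\<pi> \<equiv> density (\<alpha> \<Otimes>\<^sub>M \<beta>) (\<lambda>z. ennreal (r z))"
  shows "distr \<pi> borel fst = density \<alpha> (\<lambda>x. ennreal (\<integral>y. r (x, y) \<partial>\<beta>))"
    "distr \<pi> borel snd = density \<beta> (\<lambda>y. ennreal (\<integral>x. r (x, y) \<partial>\<alpha>))"
proof -
  note a = pos_measuresD[OF m(1)] and b = pos_measuresD[OF m(2)]
  interpret pair_sigma_finite \<alpha> \<beta> using a b by (simp add: pair_sigma_finite_def)
  note p = pos_measuresD[OF pair_measure_in_pos_measures[OF m]]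
  note [measurable_cong] = a(1) b(1)
  have rm: "r \<in> borel_measurable (\<alpha> \<Otimes>\<^sub>M \<beta>)"
    using borel_measurable_continuous_onI[OF r(1)] p by (simp cong: measurable_cong_sets)
  note [measurable] = this
  have c1: "continuous_on UNIV (\<lambda>y. r (x, y))" for x by (rule continuous_slice[OF r(1)])
  have c2: "continuous_on UNIV (\<lambda>x. r (x, y))" for y
    using continuous_slice[OF continuous_swap[OF r(1)], of y] by simp
  have c3: "continuous_on UNIV (\<lambda>x. \<integral>y. r (x, y) \<partial>\<beta>)" by (rule continuous_partial_integral[OF m(2) r(1)])
  have c4: "continuous_on UNIV (\<lambda>y. \<integral>x. r (x, y) \<partial>\<alpha>)"
    using continuous_partial_integral[OF m(1) continuous_swap[OF r(1)]] by simp
  note [measurable] = borel_measurable_continuous_onI[OF c3] borel_measurable_continuous_onI[OF c4]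
  show "distr \<pi> borel fst = density \<alpha> (\<lambda>x. ennreal (\<integral>y. r (x, y) \<partial>\<beta>))"
  proof (rule measure_eqI)
    fix A assume "A \<in> sets (distr \<pi> borel fst)"
    then have A [measurable]: "A \<in> sets borel" by simp
    have "emeasure (distr \<pi> borel fst) A
      = (\<integral>\<^sup>+z. ennreal (r z) * indicator A (fst z) \<partial>(\<alpha> \<Otimes>\<^sub>M \<beta>))"
      unfolding \<pi>_def by (subst emeasure_distr) (auto simp: emeasure_density indicator_def intro!: nn_integral_cong)
    also have "\<dots> = (\<integral>\<^sup>+x. \<integral>\<^sup>+y. ennreal (r (x, y)) * indicator A x \<partial>\<beta> \<partial>\<alpha>)"
      by (subst M2.nn_integral_fst[symmetric]) auto
    also have "\<dots> = (\<integral>\<^sup>+x. ennreal (\<integral>y. r (x, y) \<partial>\<beta>) * indicator A x \<partial>\<alpha>)"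
      by (intro nn_integral_cong, subst nn_integral_multc) (auto simp: nn_integral_continuous[OF m(2) c1] r(2))
    also have "\<dots> = emeasure (density \<alpha> (\<lambda>x. ennreal (\<integral>y. r (x, y) \<partial>\<beta>))) A"
      using a by (subst emeasure_density) auto
    finally show "emeasure (distr \<pi> borel fst) A = \<dots>" .
  qed (simp add: a)
  show "distr \<pi> borel snd = density \<beta> (\<lambda>y. ennreal (\<integral>x. r (x, y) \<partial>\<alpha>))"
  proof (rule measure_eqI)
    fix A assume "A \<in> sets (distr \<pi> borel snd)"
    then have A [measurable]: "A \<in> sets borel" by simp
    have "emeasure (distr \<pi> borel snd) A
      = (\<integral>\<^sup>+z. ennreal (r z) * indicator A (snd z) \<partial>(\<alpha> \<Otimes>\<^sub>M \<beta>))"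
      unfolding \<pi>_def by (subst emeasure_distr) (auto simp: emeasure_density indicator_def intro!: nn_integral_cong)
    also have "\<dots> = (\<integral>\<^sup>+y. \<integral>\<^sup>+x. ennreal (r (x, y)) * indicator A y \<partial>\<alpha> \<partial>\<beta>)"
      by (subst nn_integral_snd[symmetric]) auto
    also have "\<dots> = (\<integral>\<^sup>+y. ennreal (\<integral>x. r (x, y) \<partial>\<alpha>) * indicator A y \<partial>\<beta>)"
      by (intro nn_integral_cong, subst nn_integral_multc) (auto simp: nn_integral_continuous[OF m(1) c2] r(2))
    also have "\<dots> = emeasure (density \<beta> (\<lambda>y. ennreal (\<integral>x. r (x, y) \<partial>\<alpha>))) A"
      using b by (subst emeasure_density) auto
    finally show "emeasure (distr \<pi> borel snd) A = \<dots>" .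
  qed (simp add: b)
qed

text \<open>Since \<epsilon> ln r = f + g - C for the Gibbs density r, transport and entropy merge
  into (f + g) r + \<epsilon> (1 - r), a continuous integrand on the product.\<close>

lemma OT_le_gibbs:
  fixes C :: "'a::compact_metric_space \<Rightarrow> 'a \<Rightarrow> real"
  assumes m: "\<alpha> \<in> pos_measures" "\<beta> \<in> pos_measures" and e: "entropy_function \<phi>" "\<epsilon> > 0"
    and Cc: "continuous_on UNIV (\<lambda>z. C (fst z) (snd z))" and fg: "continuous_on UNIV f" "continuous_on UNIV g"
    and v1: "continuous_on UNIV v1" "\<And>x. \<phi> (\<integral>y. gibbs C \<epsilon> f g (x, y) \<partial>\<beta>) = ereal (v1 x)"
    and v2: "continuous_on UNIV v2" "\<And>y. \<phi> (\<integral>x. gibbs C \<epsilon> f g (x, y) \<partial>\<alpha>) = ereal (v2 y)"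
  shows "OT C \<phi> \<epsilon> \<alpha> \<beta> \<le> ereal ((\<integral>x. v1 x \<partial>\<alpha>) + (\<integral>y. v2 y \<partial>\<beta>)
    + (\<integral>z. (f (fst z) + g (snd z)) * gibbs C \<epsilon> f g z + \<epsilon> * (1 - gibbs C \<epsilon> f g z) \<partial>(\<alpha> \<Otimes>\<^sub>M \<beta>)))"
proof -
  define r where "r = gibbs C \<epsilon> f g"
  have rc: "continuous_on UNIV r" unfolding r_def by (rule gibbs_continuous[OF Cc fg e(2)])
  have r0: "0 < r z" for z by (simp add: r_def gibbs_def)
  note p = pair_measure_in_pos_measures[OF m]
  note p' = pos_measuresD[OF p]
  have rm: "r \<in> borel_measurable borel" by (rule borel_measurable_continuous_onI[OF rc])
  have ri: "integrable (\<alpha> \<Otimes>\<^sub>M \<beta>) r" by (rule integrable_product_continuous[OF p rc])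
  define \<pi> where "\<pi> = density (\<alpha> \<Otimes>\<^sub>M \<beta>) (\<lambda>z. ennreal (r z))"
  have \<pi>: "\<pi> \<in> pos_measures" unfolding \<pi>_def by (rule density_in_pos_measures[OF p rm ri])
  define s1 where "s1 x = (\<integral>y. r (x, y) \<partial>\<beta>)" for x
  define s2 where "s2 y = (\<integral>x. r (x, y) \<partial>\<alpha>)" for y
  have s1: "s1 \<in> borel_measurable borel" "0 \<le> s1 x" for x
    using borel_measurable_continuous_onI[OF continuous_partial_integral[OF m(2) rc]] r0
    by (auto simp: s1_def[abs_def] less_imp_le)
  have s2: "s2 \<in> borel_measurable borel" "0 \<le> s2 y" for y
    using borel_measurable_continuous_onI[OF continuous_partial_integral[OF m(1) continuous_swap[OF rc]]] r0
    by (auto simp: s2_def[abs_def] less_imp_le)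
  have n1: "0 \<le> v1 x" for x using entropy_functionD(2)[OF e(1)] v1(2)[of x] by (metis ereal_less_eq(5))
  have n2: "0 \<le> v2 x" for x using entropy_functionD(2)[OF e(1)] v2(2)[of x] by (metis ereal_less_eq(5))
  note md = marginals_density[OF m rc less_imp_le[OF r0], folded \<pi>_def s1_def s2_def]
  have "OT C \<phi> \<epsilon> \<alpha> \<beta> \<le> objective C \<phi> \<epsilon> \<alpha> \<beta> \<pi>"
    unfolding OT_objective by (rule INF_lower[OF \<pi>])
  also have "\<dots> = ereal (\<integral>z. C (fst z) (snd z) \<partial>\<pi>) + enn2ereal (penalty \<phi> \<epsilon> \<alpha> \<beta> s1 s2 r)"
    by (rule objective_penalty[OF m e(2) s1 md(1) s2 md(2) rm less_imp_le[OF r0] ri \<pi>_def])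
  also have "penalty \<phi> \<epsilon> \<alpha> \<beta> s1 s2 r =
      ennreal ((\<integral>x. v1 x \<partial>\<alpha>) + (\<integral>y. v2 y \<partial>\<beta>) + \<epsilon> * (\<integral>z. kl (r z) \<partial>(\<alpha> \<Otimes>\<^sub>M \<beta>)))"
  proof -
    have klc: "continuous_on UNIV (\<lambda>z. kl (r z))"
      by (rule continuous_on_compose2[OF continuous_on_kl rc]) (use r0 in \<open>auto intro: less_imp_le\<close>)
    have "(\<integral>\<^sup>+x. ephi \<phi> (s1 x) \<partial>\<alpha>) = ennreal (\<integral>x. v1 x \<partial>\<alpha>)"
      using v1 n1 by (simp add: s1_def r_def ephi_def nn_integral_continuous[OF m(1)])
    moreover have "(\<integral>\<^sup>+x. ephi \<phi> (s2 x) \<partial>\<beta>) = ennreal (\<integral>x. v2 x \<partial>\<beta>)"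
      using v2 n2 by (simp add: s2_def r_def ephi_def nn_integral_continuous[OF m(2)])
    moreover have "(\<integral>\<^sup>+z. ennreal (kl (r z)) \<partial>(\<alpha> \<Otimes>\<^sub>M \<beta>)) = ennreal (\<integral>z. kl (r z) \<partial>(\<alpha> \<Otimes>\<^sub>M \<beta>))"
      using kl_nonneg[OF less_imp_le[OF r0]]
      by (intro nn_integral_eq_integral integrable_product_continuous p klc) auto
    moreover have "0 \<le> (\<integral>x. v1 x \<partial>\<alpha>)" "0 \<le> (\<integral>y. v2 y \<partial>\<beta>)" "0 \<le> (\<integral>z. kl (r z) \<partial>(\<alpha> \<Otimes>\<^sub>M \<beta>))"
      using n1 n2 kl_nonneg[OF less_imp_le[OF r0]] by (auto intro!: integral_nonneg_AE)
    ultimately show ?thesis using e(2) by (simp add: penalty_def ennreal_mult)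
  qed
  also have "enn2ereal \<dots> = ereal ((\<integral>x. v1 x \<partial>\<alpha>) + (\<integral>y. v2 y \<partial>\<beta>) + \<epsilon> * (\<integral>z. kl (r z) \<partial>(\<alpha> \<Otimes>\<^sub>M \<beta>)))"
  proof (rule enn2ereal_ennreal)
    show "0 \<le> (\<integral>x. v1 x \<partial>\<alpha>) + (\<integral>y. v2 y \<partial>\<beta>) + \<epsilon> * (\<integral>z. kl (r z) \<partial>(\<alpha> \<Otimes>\<^sub>M \<beta>))"
      using n1 n2 kl_nonneg[OF less_imp_le[OF r0]] e(2)
      by (intro add_nonneg_nonneg mult_nonneg_nonneg integral_nonneg_AE) auto
  qed
  also have "(\<integral>z. C (fst z) (snd z) \<partial>\<pi>) = (\<integral>z. r z * C (fst z) (snd z) \<partial>(\<alpha> \<Otimes>\<^sub>M \<beta>))"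
  proof -
    have "(\<lambda>z. C (fst z) (snd z)) \<in> borel_measurable (\<alpha> \<Otimes>\<^sub>M \<beta>)" "r \<in> borel_measurable (\<alpha> \<Otimes>\<^sub>M \<beta>)"
      using borel_measurable_continuous_onI[OF Cc] rm p' by (simp_all cong: measurable_cong_sets)
    then show ?thesis unfolding \<pi>_def using less_imp_le[OF r0] by (subst integral_real_density) simp_all
  qed
  also have "ereal (\<integral>z. r z * C (fst z) (snd z) \<partial>(\<alpha> \<Otimes>\<^sub>M \<beta>)) +
      ereal ((\<integral>x. v1 x \<partial>\<alpha>) + (\<integral>y. v2 y \<partial>\<beta>) + \<epsilon> * (\<integral>z. kl (r z) \<partial>(\<alpha> \<Otimes>\<^sub>M \<beta>))) =
      ereal ((\<integral>x. v1 x \<partial>\<alpha>) + (\<integral>y. v2 y \<partial>\<beta>)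
        + ((\<integral>z. r z * C (fst z) (snd z) \<partial>(\<alpha> \<Otimes>\<^sub>M \<beta>)) + (\<integral>z. \<epsilon> * kl (r z) \<partial>(\<alpha> \<Otimes>\<^sub>M \<beta>))))" by simp
  also have "(\<integral>z. r z * C (fst z) (snd z) \<partial>(\<alpha> \<Otimes>\<^sub>M \<beta>)) + (\<integral>z. \<epsilon> * kl (r z) \<partial>(\<alpha> \<Otimes>\<^sub>M \<beta>)) =
      (\<integral>z. r z * C (fst z) (snd z) + \<epsilon> * kl (r z) \<partial>(\<alpha> \<Otimes>\<^sub>M \<beta>))"
  proof (rule Bochner_Integration.integral_add[symmetric])
    show "integrable (\<alpha> \<Otimes>\<^sub>M \<beta>) (\<lambda>z. r z * C (fst z) (snd z))"
      by (intro integrable_product_continuous p continuous_intros rc Cc)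
    show "integrable (\<alpha> \<Otimes>\<^sub>M \<beta>) (\<lambda>z. \<epsilon> * kl (r z))"
      by (intro integrable_product_continuous p continuous_intros continuous_on_compose2[OF continuous_on_kl rc])
        (use r0 in \<open>auto intro: less_imp_le\<close>)
  qed
  also have "(\<lambda>z. r z * C (fst z) (snd z) + \<epsilon> * kl (r z)) =
      (\<lambda>z. (f (fst z) + g (snd z)) * gibbs C \<epsilon> f g z + \<epsilon> * (1 - gibbs C \<epsilon> f g z))"
  proof
    fix z
    have "\<epsilon> * ln (r z) = f (fst z) + g (snd z) - C (fst z) (snd z)" using e(2) by (simp add: r_def gibbs_def)
    then have "r z * (\<epsilon> * ln (r z)) = r z * (f (fst z) + g (snd z) - C (fst z) (snd z))" by simp
    then show "r z * C (fst z) (snd z) + \<epsilon> * kl (r z) =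
      (f (fst z) + g (snd z)) * gibbs C \<epsilon> f g z + \<epsilon> * (1 - gibbs C \<epsilon> f g z)"
      unfolding r_def[symmetric] kl_def by (simp add: algebra_simps)
  qed
  finally show ?thesis .
qed

lemma OT_weak_star_continuous:
  fixes C :: "'a::compact_metric_space \<Rightarrow> 'a \<Rightarrow> real"
  assumes sym: "\<And>x y. C x y = C y x" and Cc: "continuous_on UNIV (\<lambda>z. C (fst z) (snd z))"
    and CL: "\<And>x y z. \<bar>C x z - C y z\<bar> \<le> \<gamma> * dist x y"
    and e: "entropy_function \<phi>" "\<epsilon> > 0" and cont: "continuous_on {0..} \<phi>"
    and A2: "subgradients_reach_zero_or_infinity (legendre \<phi>)"
    and ms: "\<And>n. \<alpha>s n \<in> pos_measures" "\<And>n. \<beta>s n \<in> pos_measures"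
    and m: "\<alpha> \<in> nonzero_measures" "\<beta> \<in> nonzero_measures"
    and lim: "weak_star_conv \<alpha>s \<alpha>" "weak_star_conv \<beta>s \<beta>"
  shows "(\<lambda>n. OT C \<phi> \<epsilon> (\<alpha>s n) (\<beta>s n)) \<longlonglongrightarrow> OT C \<phi> \<epsilon> \<alpha> \<beta>"
proof -
  note mp = nonzero_measuresD(1)[OF m(1)] nonzero_measuresD(1)[OF m(2)]
  obtain K where K: "0 \<le> K" "\<And>x y. \<bar>C x y\<bar> \<le> K" using cost_bounded[OF Cc] by metis
  obtain f g w1 w2 :: "'a \<Rightarrow> real" where
    fg: "continuous_on UNIV f" "continuous_on UNIV g"
    and w1: "\<And>x. \<phi> (\<integral>y. gibbs C \<epsilon> f g (x, y) \<partial>\<beta>) = ereal (w1 x)"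
    and o1: "\<And>x p v. 0 \<le> p \<Longrightarrow> \<phi> p = ereal v \<Longrightarrow> w1 x - f x * (p - (\<integral>y. gibbs C \<epsilon> f g (x, y) \<partial>\<beta>)) \<le> v"
    and w2: "\<And>y. \<phi> (\<integral>x. gibbs C \<epsilon> f g (x, y) \<partial>\<alpha>) = ereal (w2 y)"
    and o2: "\<And>y p v. 0 \<le> p \<Longrightarrow> \<phi> p = ereal v \<Longrightarrow> w2 y - g y * (p - (\<integral>x. gibbs C \<epsilon> f g (x, y) \<partial>\<alpha>)) \<le> v"
    by (rule potentials_exist[OF sym Cc CL e cont A2 m], rule that[unfolded gibbs_def fst_conv snd_conv])
  define r where "r = gibbs C \<epsilon> f g"
  define r' where "r' z = r (snd z, fst z)" for z
  have rc: "continuous_on UNIV r" unfolding r_def by (rule gibbs_continuous[OF Cc fg e(2)])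
  have rc': "continuous_on UNIV r'" unfolding r'_def[abs_def] by (rule continuous_swap[OF rc])
  have r0: "0 < r z" for z by (simp add: r_def gibbs_def)
  define s1 where "s1 x = (\<integral>y. r (x, y) \<partial>\<beta>)" for x
  define s2 where "s2 y = (\<integral>x. r (x, y) \<partial>\<alpha>)" for y
  have s2': "s2 = (\<lambda>y. \<integral>x. r' (y, x) \<partial>\<alpha>)" by (simp add: s2_def[abs_def] r'_def)
  have s1c: "continuous_on UNIV s1" unfolding s1_def[abs_def] by (rule continuous_partial_integral[OF mp(2) rc])
  have s2c: "continuous_on UNIV s2" unfolding s2' by (rule continuous_partial_integral[OF mp(1) rc'])
  have s1_pos: "0 < s1 x" for x
  proof -
    have c: "continuous_on UNIV (\<lambda>y. f x + g y)" by (intro continuous_intros fg)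
    then obtain R where R: "\<And>y. \<bar>f x + g y\<bar> \<le> R" using compact_space_bounded by blast
    show ?thesis
      using exp_softmin_pos(2)[OF K(2) Cc CL e(2) m(2) borel_measurable_continuous_onI[OF c] R, of x]
      by (simp add: s1_def r_def gibbs_def)
  qed
  have s2_pos: "0 < s2 y" for y
  proof -
    have c: "continuous_on UNIV (\<lambda>x. f x + g y)" by (intro continuous_intros fg)
    then obtain R where R: "\<And>x. \<bar>f x + g y\<bar> \<le> R" using compact_space_bounded by blast
    show ?thesis
      using exp_softmin_pos(2)[OF K(2) Cc CL e(2) m(1) borel_measurable_continuous_onI[OF c] R, of y]
      by (simp add: s2_def r_def gibbs_def sym[of y])
  qed
  \<comment> \<open>By \<open>o1\<close>, h1 x is the minimum over p \<ge> 0 of \<phi>(p) + f x p,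
    attained at s1 x; it is minus the conjugate of \<phi> at - f x. The same holds for
    \<open>h2\<close> and g.\<close>
  define h1 where "h1 x = w1 x + f x * s1 x" for x
  define h2 where "h2 y = w2 y + g y * s2 y" for y
  define J where "J a b = (\<integral>x. h1 x \<partial>a) + (\<integral>y. h2 y \<partial>b) + \<epsilon> * (\<integral>z. 1 - r z \<partial>(a \<Otimes>\<^sub>M b))" for a b
  define k where "k z = (f (fst z) + g (snd z)) * r z + \<epsilon> * (1 - r z)" for z
  have kc: "continuous_on UNIV k" unfolding k_def[abs_def]
    by (intro continuous_intros rc continuous_on_compose2[OF fg(1)] continuous_on_compose2[OF fg(2)]) auto
  have w1': "\<phi> (s1 x) = ereal (w1 x)" and w2': "\<phi> (s2 x) = ereal (w2 x)" for x
    using w1 w2 by (simp_all add: s1_def s2_def r_def)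
  note uc1 = uniform_limit_entropy(1)[OF e(1) cont s1c s1_pos w1' s1c uniform_limit_const]
  note uc2 = uniform_limit_entropy(1)[OF e(1) cont s2c s2_pos w2' s2c uniform_limit_const]
  have h1c: "continuous_on UNIV h1" unfolding h1_def[abs_def] by (intro continuous_intros uc1 fg s1c)
  have h2c: "continuous_on UNIV h2" unfolding h2_def[abs_def] by (intro continuous_intros uc2 fg s2c)
  have lower: "ereal (J a b) \<le> OT C \<phi> \<epsilon> a b" if ab: "a \<in> pos_measures" "b \<in> pos_measures" for a b
    unfolding OT_objective
  proof (rule INF_greatest)
    fix \<pi> :: "('a \<times> 'a) measure" assume \<pi>: "\<pi> \<in> pos_measures"
    obtain F where F: "\<And>x. \<bar>f x\<bar> \<le> F" using compact_space_bounded[OF fg(1)] by blast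
    obtain G where G: "\<And>x. \<bar>g x\<bar> \<le> G" using compact_space_bounded[OF fg(2)] by blast
    obtain H1 where H1: "\<And>x. \<bar>h1 x\<bar> \<le> H1" using compact_space_bounded[OF h1c] by blast
    obtain H2 where H2: "\<And>x. \<bar>h2 x\<bar> \<le> H2" using compact_space_bounded[OF h2c] by blast
    note bd = F G H1 H2
    have "ereal ((\<integral>x. h1 x \<partial>a) + (\<integral>y. h2 y \<partial>b)
      + \<epsilon> * (\<integral>z. 1 - exp ((f (fst z) + g (snd z) - C (fst z) (snd z)) / \<epsilon>) \<partial>(a \<Otimes>\<^sub>M b)))
      \<le> objective C \<phi> \<epsilon> a b \<pi>"
    proof (rule objective_ge[OF ab \<pi> e borel_measurable_continuous_onI[OF Cc] K(2)
        borel_measurable_continuous_onI[OF fg(1)] bd(1) borel_measurable_continuous_onI[OF fg(2)] bd(2)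
        borel_measurable_continuous_onI[OF h1c] bd(3) borel_measurable_continuous_onI[OF h2c] bd(4)])
      fix x :: 'a and p :: real assume p: "0 \<le> p"
      show "ereal (h1 x - f x * p) \<le> \<phi> p"
      proof (cases rule: entropy_function_cases[OF e(1), of p])
        case (2 v)
        then show ?thesis using o1[OF p 2(1), of x] by (simp add: h1_def s1_def r_def algebra_simps)
      qed simp
      show "ereal (h2 x - g x * p) \<le> \<phi> p"
      proof (cases rule: entropy_function_cases[OF e(1), of p])
        case (2 v)
        then show ?thesis using o2[OF p 2(1), of x] by (simp add: h2_def s2_def r_def algebra_simps)
      qed simp
    qed
    then show "ereal (J a b) \<le> objective C \<phi> \<epsilon> a b \<pi>" by (simp add: J_def r_def gibbs_def)
  qed
  \<comment> \<open>There is no duality gap at the limit pair: by Fubini, f s1 integrates against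
    \<alpha> to the integral of f r over the product, and likewise g s2, so the dual value becomes
    the primal value of the Gibbs plan.\<close>
  have J: "J \<alpha> \<beta> = (\<integral>x. w1 x \<partial>\<alpha>) + (\<integral>y. w2 y \<partial>\<beta>) + (\<integral>z. k z \<partial>(\<alpha> \<Otimes>\<^sub>M \<beta>))"
  proof -
    note p = pair_measure_in_pos_measures[OF mp]
    have c1: "continuous_on UNIV (\<lambda>z. f (fst z) * r z)"
      by (intro continuous_intros rc continuous_on_compose2[OF fg(1)]) auto
    have c2: "continuous_on UNIV (\<lambda>z. g (snd z) * r z)"
      by (intro continuous_intros rc continuous_on_compose2[OF fg(2)]) auto
    have c3: "continuous_on UNIV (\<lambda>z. 1 - r z)" by (intro continuous_intros rc)
    note i = integrable_product_continuous[OF p c1] integrable_product_continuous[OF p c2] integrable_product_continuous[OF p c3]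
    have "(\<integral>z. k z \<partial>(\<alpha> \<Otimes>\<^sub>M \<beta>)) = (\<integral>z. f (fst z) * r z \<partial>(\<alpha> \<Otimes>\<^sub>M \<beta>)) + (\<integral>z. g (snd z) * r z \<partial>(\<alpha> \<Otimes>\<^sub>M \<beta>))
      + \<epsilon> * (\<integral>z. 1 - r z \<partial>(\<alpha> \<Otimes>\<^sub>M \<beta>))"
      using i unfolding k_def by (simp only: distrib_right Bochner_Integration.integral_add
          Bochner_Integration.integrable_add integrable_mult_right integral_mult_right_zero)
    also have "(\<integral>z. f (fst z) * r z \<partial>(\<alpha> \<Otimes>\<^sub>M \<beta>)) = (\<integral>x. f x * s1 x \<partial>\<alpha>)"
      using integral_pair_measure(1)[OF mp c1] by (simp add: s1_def)
    also have "(\<integral>z. g (snd z) * r z \<partial>(\<alpha> \<Otimes>\<^sub>M \<beta>)) = (\<integral>y. g y * s2 y \<partial>\<beta>)"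
      using integral_pair_measure(2)[OF mp c2] by (simp add: s2_def)
    finally have "(\<integral>z. k z \<partial>(\<alpha> \<Otimes>\<^sub>M \<beta>)) = (\<integral>x. f x * s1 x \<partial>\<alpha>) + (\<integral>y. g y * s2 y \<partial>\<beta>) + \<epsilon> * (\<integral>z. 1 - r z \<partial>(\<alpha> \<Otimes>\<^sub>M \<beta>))" .
    moreover have "(\<integral>x. h1 x \<partial>\<alpha>) = (\<integral>x. w1 x \<partial>\<alpha>) + (\<integral>x. f x * s1 x \<partial>\<alpha>)"
      unfolding h1_def by (intro Bochner_Integration.integral_add integrable_continuous mp uc1 continuous_intros fg s1c)
    moreover have "(\<integral>x. h2 x \<partial>\<beta>) = (\<integral>x. w2 x \<partial>\<beta>) + (\<integral>x. g x * s2 x \<partial>\<beta>)"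
      unfolding h2_def by (intro Bochner_Integration.integral_add integrable_continuous mp uc2 continuous_intros fg s2c)
    ultimately show ?thesis by (simp add: J_def)
  qed
  \<comment> \<open>Stated for arbitrary sequences because the constant one is needed as well: it
    identifies the common limit of the bounds with OT at (\<alpha>, \<beta>).\<close>
  have main: "(\<lambda>n. OT C \<phi> \<epsilon> (a n) (b n)) \<longlonglongrightarrow> ereal (J \<alpha> \<beta>)"
    if a: "\<And>n. a n \<in> pos_measures" "weak_star_conv a \<alpha>" and b: "\<And>n. b n \<in> pos_measures" "weak_star_conv b \<beta>" for a b
  proof -
    define t1 where "t1 n x = (\<integral>y. r (x, y) \<partial>b n)" for n x
    define t2 where "t2 n y = (\<integral>x. r' (y, x) \<partial>a n)" for n y
    have t1: "continuous_on UNIV (t1 n)" "uniform_limit UNIV t1 s1 sequentially" for n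
      unfolding t1_def[abs_def] s1_def[abs_def]
      by (rule continuous_partial_integral[OF b(1) rc] uniform_limit_partial_integral[OF b(1) mp(2) b(2) rc])+
    have t2: "continuous_on UNIV (t2 n)" "uniform_limit UNIV t2 s2 sequentially" for n
      unfolding t2_def[abs_def] s2'
      by (rule continuous_partial_integral[OF a(1) rc'] uniform_limit_partial_integral[OF a(1) mp(1) a(2) rc'])+
    obtain w1n where w1n: "\<And>n. continuous_on UNIV (w1n n)" "uniform_limit UNIV w1n w1 sequentially"
      "eventually (\<lambda>n. \<forall>x. \<phi> (t1 n x) = ereal (w1n n x)) sequentially"
      using uniform_limit_entropy(2)[OF e(1) cont s1c s1_pos w1' t1] by blast
    obtain w2n where w2n: "\<And>n. continuous_on UNIV (w2n n)" "uniform_limit UNIV w2n w2 sequentially"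
      "eventually (\<lambda>n. \<forall>x. \<phi> (t2 n x) = ereal (w2n n x)) sequentially"
      using uniform_limit_entropy(2)[OF e(1) cont s2c s2_pos w2' t2] by blast
    define V where "V n = (\<integral>x. w1n n x \<partial>a n) + (\<integral>y. w2n n y \<partial>b n) + (\<integral>z. k z \<partial>(a n \<Otimes>\<^sub>M b n))" for n
    have "V \<longlonglongrightarrow> J \<alpha> \<beta>" unfolding V_def[abs_def] J
      by (intro tendsto_add weak_star_uniform_limit[OF a(1) mp(1) a(2) w1n(1) uc1 w1n(2)]
          weak_star_uniform_limit[OF b(1) mp(2) b(2) w2n(1) uc2 w2n(2)]
          tendsto_integral_pair_measure[OF a(1) mp(1) a(2) b(1) mp(2) b(2) kc])
    then have Vlim: "(\<lambda>n. ereal (V n)) \<longlonglongrightarrow> ereal (J \<alpha> \<beta>)" by simp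
    have c3: "continuous_on UNIV (\<lambda>z. 1 - r z)" by (intro continuous_intros rc)
    have "(\<lambda>n. J (a n) (b n)) \<longlonglongrightarrow> J \<alpha> \<beta>" unfolding J_def
      using a(2) b(2) h1c h2c
      by (intro tendsto_add tendsto_mult tendsto_const tendsto_integral_pair_measure[OF a(1) mp(1) a(2) b(1) mp(2) b(2) c3])
        (auto simp: weak_star_conv_def)
    then have Jlim: "(\<lambda>n. ereal (J (a n) (b n))) \<longlonglongrightarrow> ereal (J \<alpha> \<beta>)" by simp
    show ?thesis
    proof (rule tendsto_sandwich[OF _ _ Jlim Vlim])
      show "eventually (\<lambda>n. ereal (J (a n) (b n)) \<le> OT C \<phi> \<epsilon> (a n) (b n)) sequentially"
        using lower[OF a(1) b(1)] by simp
      show "eventually (\<lambda>n. OT C \<phi> \<epsilon> (a n) (b n) \<le> ereal (V n)) sequentially"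
        using w1n(3) w2n(3)
      proof eventually_elim
        case (elim n)
        have "\<phi> (\<integral>y. gibbs C \<epsilon> f g (x, y) \<partial>b n) = ereal (w1n n x)" for x
          using elim(1) by (simp add: t1_def r_def)
        moreover have "\<phi> (\<integral>x. gibbs C \<epsilon> f g (x, y) \<partial>a n) = ereal (w2n n y)" for y
          using elim(2) by (simp add: t2_def r'_def r_def)
        ultimately show ?case unfolding V_def k_def r_def
          by (intro OT_le_gibbs[OF a(1) b(1) e Cc fg w1n(1) _ w2n(1)])
      qed
    qed
  qed
  have "(\<lambda>n::nat. OT C \<phi> \<epsilon> \<alpha> \<beta>) \<longlonglongrightarrow> ereal (J \<alpha> \<beta>)"
    by (intro main mp) (auto simp: weak_star_conv_def)
  then have "OT C \<phi> \<epsilon> \<alpha> \<beta> = ereal (J \<alpha> \<beta>)" by (rule LIMSEQ_unique[OF tendsto_const])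
  then show ?thesis using main[OF ms(1) lim(1) ms(2) lim(2)] by simp
qed

text \<open>The third claim sets aside the case where \<phi> vanishes on [0, \<infinity>) and C = 0:
  then the product plan has cost 0, so OT is identically 0 and jointly convex.\<close>

theorem theorem2:
  fixes C :: "'a::compact_metric_space \<Rightarrow> 'a \<Rightarrow> real"
    and \<phi> :: "real \<Rightarrow> ereal" and \<epsilon> \<gamma> :: real
  assumes "\<And>x y. C x y = C y x"
    and "continuous_on UNIV (\<lambda>z. C (fst z) (snd z))"
    and "\<And>x y z. \<bar>C x z - C y z\<bar> \<le> \<gamma> * dist x y"
    and "entropy_function \<phi>"
    and "\<epsilon> > 0"
  shows "(\<forall>\<beta>\<in>pos_measures. convex_on_measures (\<lambda>\<alpha>. OT C \<phi> \<epsilon> \<alpha> \<beta>)) \<and>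
    (\<forall>\<alpha>\<in>pos_measures. convex_on_measures (\<lambda>\<beta>. OT C \<phi> \<epsilon> \<alpha> \<beta>)) \<and>
    ((\<exists>p\<ge>0. \<phi> p \<noteq> 0) \<or> (\<exists>x y. C x y \<noteq> 0) \<longrightarrow> \<not> jointly_convex_on_measures (OT C \<phi> \<epsilon>)) \<and>
    (continuous_on {0..} \<phi> \<and> strictly_convex (legendre \<phi>) \<and>
       subgradients_reach_zero_or_infinity (legendre \<phi>) \<longrightarrow>
     (\<forall>\<alpha>s \<beta>s \<alpha> \<beta>.
        (\<forall>n. \<alpha>s n \<in> pos_measures \<and> \<beta>s n \<in> pos_measures) \<and>
        \<alpha> \<in> nonzero_measures \<and> \<beta> \<in> nonzero_measures \<and>
        weak_star_conv \<alpha>s \<alpha> \<and> weak_star_conv \<beta>s \<beta> \<longrightarrow>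
        (\<lambda>n. OT C \<phi> \<epsilon> (\<alpha>s n) (\<beta>s n)) \<longlonglongrightarrow> OT C \<phi> \<epsilon> \<alpha> \<beta>))"
proof -
  obtain K where K: "\<And>x y. \<bar>C x y\<bar> \<le> K" using cost_bounded[OF assms(2)] by metis
  have Cm: "(\<lambda>z. C (fst z) (snd z)) \<in> borel_measurable borel"
    by (rule borel_measurable_continuous_onI[OF assms(2)])
  have "OT C \<phi> \<epsilon> (mix_measure t \<alpha>0 \<alpha>1) \<beta> \<le> ereal (1 - t) * OT C \<phi> \<epsilon> \<alpha>0 \<beta> + ereal t * OT C \<phi> \<epsilon> \<alpha>1 \<beta>"
    if "\<alpha>0 \<in> pos_measures" "\<alpha>1 \<in> pos_measures" "\<beta> \<in> pos_measures" "t \<in> {0..1}" for \<alpha>0 \<alpha>1 \<beta> :: "'a measure" and t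
    using OT_mix[OF that(1,2,3,3,4) assms(4,5) Cm K] pair_measure_mix_left[OF that(1-3)]
    by (simp add: mix_measure_same[OF that(4)])
  moreover have "OT C \<phi> \<epsilon> \<alpha> (mix_measure t \<beta>0 \<beta>1) \<le> ereal (1 - t) * OT C \<phi> \<epsilon> \<alpha> \<beta>0 + ereal t * OT C \<phi> \<epsilon> \<alpha> \<beta>1"
    if "\<alpha> \<in> pos_measures" "\<beta>0 \<in> pos_measures" "\<beta>1 \<in> pos_measures" "t \<in> {0..1}" for \<alpha> \<beta>0 \<beta>1 :: "'a measure" and t
    using OT_mix[OF that(1,1,2,3,4) assms(4,5) Cm K] pair_measure_mix_right[OF that(1-3)]
    by (simp add: mix_measure_same[OF that(4)])
  moreover have "C x y = 0 \<and> (\<forall>p\<ge>0. \<phi> p = 0)" if "jointly_convex_on_measures (OT C \<phi> \<epsilon>)" for x y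
    by (rule jointly_convex_imp_trivial[OF assms(4,5) Cm K that])
  ultimately show ?thesis
    using OT_weak_star_continuous[OF assms(1-5)] by (auto simp: convex_on_measures_def)
qed

end
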